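(* Let $E_2(T)$ be defined by $$\int_0^T|\zeta(\tfrac12+it)|^4\,dt = TP_4(\log T)+E_2(T),$$ where $P_4$ is the polynomial of degree four (with leading coefficient $\frac{1}{2\pi^2}$) for which $E_2(T)=o(T)$, let $Q_4(x)=P_4(x)+P_4'(x)$, and let $\mathcal{K}(s)$ be the analytic continuation to $\operatorname{Re}s>1$ of $$\mathcal{K}(s)=\int_1^\infty\bigl(|\zeta(\tfrac12+ix)|^4-Q_4(\log x)\bigr)E_2(x)x^{-s}\,dx\qquad(\operatorname{Re}s>\tfrac53).$$ Then for every fixed $\sigma>1$ and every $\varepsilon>0$, $$\int_T^{2T}E_2^4(t)\,dt\ll_\varepsilon T^{2\sigma+1}\left(1+\int_0^{T^{1+\varepsilon}}\frac{|\mathcal{K}(\sigma+it)|^2}{1+t^2}\,dt\right)\qquad(T\to\infty).$$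
   Context: $\zeta$ is the Riemann zeta-function. The function $\mathcal{K}(s)$ is regular in $\operatorname{Re}s>1$ (its continuation is given by $\mathcal{K}(s)=-\frac12E_2^2(1)-\frac12 s\int_1^\infty E_2^2(x)x^{-s-1}dx$). Implied constants may depend on $\varepsilon$ and $\sigma$. *)

theory Defs
  imports
    "HOL-Complex_Analysis.Complex_Analysis"
    "HOL-Library.Landau_Symbols"
    "HOL-Computational_Algebra.Polynomial"
begin

definition is_zeta_continuation :: "(complex \<Rightarrow> complex) \<Rightarrow> bool" where
  "is_zeta_continuation Z \<longleftrightarrow>
     Z holomorphic_on (- {1}) \<and>
     (\<forall>s. Re s > 1 \<longrightarrow> (\<lambda>n. of_nat (Suc n) powr (-s)) sums Z s)"

(* The value at the pole s = 1 is arbitrary. *)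
definition riemann_zeta :: "complex \<Rightarrow> complex" where
  "riemann_zeta = (SOME Z. is_zeta_continuation Z)"

lemma open_half_plane: "open {s::complex. Re s > b}"
  by (rule open_halfspace_Re_gt)

lemma half_plane_series:
  fixes f :: "nat \<Rightarrow> complex \<Rightarrow> complex" and C :: "complex \<Rightarrow> real"
  assumes hol: "\<And>n. f n holomorphic_on {s. Re s > b}"
    and C: "continuous_on UNIV C"
    and bd: "\<And>n s. Re s > b \<Longrightarrow> norm (f n s) \<le> C s * real (Suc n) powr (b - Re s - 1)"
  shows "(\<lambda>s. \<Sum>n. f n s) holomorphic_on {s. Re s > b}"
    and "\<And>s. Re s > b \<Longrightarrow> summable (\<lambda>n. f n s)"
proof -
  have sm: "summable (\<lambda>n. B * real (Suc n) powr (b - a - 1))" if "a > b" for a B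
    using that summable_real_powr_iff[of "b - a - 1"]
    by (intro summable_mult) (subst summable_Suc_iff, simp)
  show "summable (\<lambda>n. f n s)" if "Re s > b" for s
    by (rule summable_comparison_test'[OF sm[OF that, of "C s"], of 0]) (use bd[OF that] in auto)
  show "(\<lambda>s. \<Sum>n. f n s) holomorphic_on {s. Re s > b}"
  proof (rule holomorphic_uniform_sequence[where f = "\<lambda>N s. \<Sum>n<N. f n s"])
    show "open {s. Re s > b}" by (rule open_half_plane)
    show "(\<lambda>s. \<Sum>n<N. f n s) holomorphic_on {s. Re s > b}" for N
      by (intro holomorphic_on_sum hol)
    fix x assume x: "x \<in> {s. Re s > b}"
    define d where "d = (Re x - b) / 2"
    have d: "d > 0" using x by (simp add: d_def)
    define a where "a = Re x - d"
    have a: "a > b" using x by (simp add: a_def d_def field_simps)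
    have ge: "Re s \<ge> a" if "s \<in> cball x d" for s
      using that abs_Re_le_cmod[of "x - s"] by (simp add: dist_norm a_def)
    have "bounded (C ` cball x d)"
      by (intro compact_imp_bounded compact_continuous_image continuous_on_subset[OF C]) auto
    then obtain B where B: "\<And>s. s \<in> cball x d \<Longrightarrow> \<bar>C s\<bar> \<le> B"
      unfolding bounded_iff by (metis imageI real_norm_def)
    have "uniform_limit (cball x d) (\<lambda>N s. \<Sum>n<N. f n s) (\<lambda>s. \<Sum>n. f n s) sequentially"
    proof (rule Weierstrass_m_test)
      show "summable (\<lambda>n. B * real (Suc n) powr (b - a - 1))" by (rule sm[OF a])
      fix n s assume s: "s \<in> cball x d"
      have "norm (f n s) \<le> C s * real (Suc n) powr (b - Re s - 1)"
        using ge[OF s] a by (intro bd) auto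
      also have "\<dots> \<le> B * real (Suc n) powr (b - a - 1)"
        using ge[OF s] B[OF s] by (intro mult_mono powr_mono) auto
      finally show "norm (f n s) \<le> B * real (Suc n) powr (b - a - 1)" .
    qed
    moreover have "cball x d \<subseteq> {s. Re s > b}" using ge a by force
    ultimately show "\<exists>d>0. cball x d \<subseteq> {s. Re s > b} \<and>
        uniform_limit (cball x d) (\<lambda>N s. \<Sum>n<N. f n s) (\<lambda>s. \<Sum>n. f n s) sequentially"
      using d by blast
  qed
qed

abbreviation (input) dirichlet_sum :: "complex \<Rightarrow> complex" where
  "dirichlet_sum s \<equiv> (\<Sum>n. of_nat (Suc n) powr (-s))"

lemma norm_of_nat_Suc_powr: "norm (of_nat (Suc n) powr s :: complex) = real (Suc n) powr Re s"
  using norm_powr_real_powr[of "of_nat (Suc n)" s] by simp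

lemma dirichlet_sum_holomorphic: "dirichlet_sum holomorphic_on {s. Re s > 1}"
  and dirichlet_sum_summable: "Re s > 1 \<Longrightarrow> summable (\<lambda>n. of_nat (Suc n) powr (-s) :: complex)"
proof -
  have *: "norm (of_nat (Suc n) powr (-s) :: complex) \<le> 1 * real (Suc n) powr (1 - Re s - 1)" for n s
    using norm_of_nat_Suc_powr[of n "-s"] by simp
  show "dirichlet_sum holomorphic_on {s. Re s > 1}"
    by (rule half_plane_series(1)[where C = "\<lambda>_. 1"]) (intro holomorphic_intros | use * in force)+
  show "Re s > 1 \<Longrightarrow> summable (\<lambda>n. of_nat (Suc n) powr (-s) :: complex)"
    by (rule half_plane_series(2)[where C = "\<lambda>_. 1" and b = 1]) (intro holomorphic_intros | use * in force)+
qed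

(* Existence of the continuation. With c_i(s) = (1-s)(-s)...(2-s-i), the Taylor remainder
   (n+1)^(1-s) - (sum over i <= N of c_i(s)/i! n^(1-s-i)) sums to a holomorphic function on
   Re s > 1-N; summing it termwise for Re s > 1 expresses (s-1) zeta(s) through the values
   of (w-1) zeta(w) at w = s+1, ..., s+N-1, which extends it one strip at a time. *)

definition zeta_coeff :: "nat \<Rightarrow> complex \<Rightarrow> complex" where
  "zeta_coeff i s = (\<Prod>j<i. 1 - s - of_nat j)"

definition zeta_remainder :: "nat \<Rightarrow> nat \<Rightarrow> complex \<Rightarrow> complex" where
  "zeta_remainder N n s = of_nat (Suc (Suc n)) powr (1 - s)
     - (\<Sum>i\<le>N. zeta_coeff i s / fact i * of_nat (Suc n) powr (1 - s - of_nat i))"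

lemma zeta_coeff_holomorphic [holomorphic_intros]: "zeta_coeff i holomorphic_on A"
  unfolding zeta_coeff_def by (intro holomorphic_intros)

lemma zeta_remainder_bound:
  assumes "Re s > 1 - real N"
  shows "norm (zeta_remainder N n s) \<le> norm (zeta_coeff (Suc N) s) * real (Suc n) powr (1 - real N - Re s - 1)"
proof -
  define S where "S = closed_segment (of_nat (Suc n)) (of_nat (Suc (Suc n)) :: complex)"
  define f where "f = (\<lambda>i (x::complex). zeta_coeff i s * x powr (1 - s - of_nat i))"
  have S: "\<exists>y. x = of_real y \<and> y \<ge> real (Suc n)" if "x \<in> S" for x
  proof -
    have "x \<in> closed_segment (of_real (real (Suc n))) (of_real (real (Suc (Suc n))) :: complex)"
      using that by (simp only: S_def of_real_of_nat_eq)
    thus ?thesis unfolding closed_segment_of_real by (auto simp: closed_segment_eq_real_ivl)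
  qed
  have "norm (f 0 (of_nat (Suc (Suc n))) -
      (\<Sum>i\<le>N. f i (of_nat (Suc n)) * (of_nat (Suc (Suc n)) - of_nat (Suc n)) ^ i / fact i))
      \<le> (norm (zeta_coeff (Suc N) s) * real (Suc n) powr (1 - real N - Re s - 1))
         * norm (of_nat (Suc (Suc n)) - of_nat (Suc n) :: complex) ^ Suc N / fact N"
  proof (rule complex_Taylor)
    show "convex S" by (simp add: S_def)
    fix i :: nat and x assume x: "x \<in> S"
    then obtain y where y: "x = of_real y" "y \<ge> real (Suc n)" using S by blast
    hence nz: "x \<notin> \<real>\<^sub>\<le>\<^sub>0" by (auto simp: complex_nonpos_Reals_iff)
    show "(f i has_field_derivative f (Suc i) x) (at x within S)"
      unfolding f_def using nz
      by (auto intro!: derivative_eq_intros simp: zeta_coeff_def algebra_simps)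
  next
    fix x assume x: "x \<in> S"
    then obtain y where y: "x = of_real y" "y \<ge> real (Suc n)" using S by blast
    have "norm (f (Suc N) x) = norm (zeta_coeff (Suc N) s) * y powr (1 - real N - Re s - 1)"
      using y by (simp add: f_def norm_mult norm_powr_real_powr algebra_simps)
    also have "\<dots> \<le> norm (zeta_coeff (Suc N) s) * real (Suc n) powr (1 - real N - Re s - 1)"
      using y assms by (intro mult_left_mono powr_mono2') auto
    finally show "norm (f (Suc N) x) \<le> norm (zeta_coeff (Suc N) s) * real (Suc n) powr (1 - real N - Re s - 1)" .
  qed (auto simp: S_def)
  also have "\<dots> \<le> norm (zeta_coeff (Suc N) s) * real (Suc n) powr (1 - real N - Re s - 1)"
  proof -
    have "x / fact N \<le> x" if "x \<ge> 0" for x :: real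
      using that mult_left_mono[of 1 "fact N" x] by (simp add: divide_le_eq fact_ge_1)
    thus ?thesis by simp
  qed
  also have "of_nat (Suc (Suc n)) - of_nat (Suc n) = (1 :: complex)" by simp
  finally show ?thesis by (simp add: zeta_remainder_def f_def zeta_coeff_def del: of_nat_Suc)
qed

lemma zeta_remainder_holomorphic: "(\<lambda>s. \<Sum>n. zeta_remainder N n s) holomorphic_on {s. Re s > 1 - real N}"
proof (rule half_plane_series(1)[where C = "\<lambda>s. norm (zeta_coeff (Suc N) s)"])
  show "continuous_on UNIV (\<lambda>s. norm (zeta_coeff (Suc N) s))"
    by (intro continuous_intros holomorphic_on_imp_continuous_on holomorphic_intros)
  show "zeta_remainder N n holomorphic_on {s. Re s > 1 - real N}" for n
    unfolding zeta_remainder_def by (intro holomorphic_intros) auto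
qed (use zeta_remainder_bound in auto)

lemma zeta_remainder_sum:
  assumes s: "Re s > 1"
  shows "(\<Sum>n. zeta_remainder N n s) = -1 - (\<Sum>i=1..N. zeta_coeff i s / fact i * dirichlet_sum (s + of_nat i - 1))"
proof -
  have "(\<lambda>n. of_nat (Suc (Suc n)) powr (1 - s) - of_nat (Suc n) powr (1 - s) :: complex) sums (0 - of_nat (Suc 0) powr (1 - s))"
  proof (rule telescope_sums)
    have "(\<lambda>n. real (Suc n) powr (1 - Re s)) \<longlonglongrightarrow> 0"
      using s by (intro tendsto_neg_powr filterlim_compose[OF filterlim_real_sequentially filterlim_Suc]) auto
    thus "(\<lambda>n. of_nat (Suc n) powr (1 - s) :: complex) \<longlonglongrightarrow> 0"
      by (subst tendsto_norm_zero_iff [symmetric]) (simp add: norm_of_nat_Suc_powr del: of_nat_Suc)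
  qed
  hence 1: "(\<lambda>n. of_nat (Suc (Suc n)) powr (1 - s) - of_nat (Suc n) powr (1 - s) :: complex) sums (-1)"
    by simp
  have 2: "(\<lambda>n. \<Sum>i=1..N. zeta_coeff i s / fact i * of_nat (Suc n) powr (1 - s - of_nat i))
     sums (\<Sum>i=1..N. zeta_coeff i s / fact i * dirichlet_sum (s + of_nat i - 1))"
  proof (intro sums_sum sums_mult)
    fix i assume "i \<in> {1..N}"
    hence "Re (s + of_nat i - 1) > 1" using s by simp
    from summable_sums[OF dirichlet_sum_summable[OF this]]
    show "(\<lambda>n. of_nat (Suc n) powr (1 - s - of_nat i)) sums dirichlet_sum (s + of_nat i - 1)"
      by (simp add: algebra_simps)
  qed
  have "zeta_remainder N n s = (of_nat (Suc (Suc n)) powr (1 - s) - of_nat (Suc n) powr (1 - s))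
     - (\<Sum>i=1..N. zeta_coeff i s / fact i * of_nat (Suc n) powr (1 - s - of_nat i))" for n
  proof -
    have "{..N} = insert 0 {1..N}" by auto
    thus ?thesis by (simp add: zeta_remainder_def zeta_coeff_def algebra_simps)
  qed
  thus ?thesis using sums_diff[OF 1 2] by (simp add: sums_iff)
qed

lemma zeta_strip:
  "\<exists>E. E holomorphic_on {s. Re s > 1 - real m} \<and> (\<forall>s. Re s > 1 \<longrightarrow> E s = (s - 1) * dirichlet_sum s)"
proof (induction m)
  case 0
  show ?case
    by (rule exI[of _ "\<lambda>s. (s - 1) * dirichlet_sum s"]) (use dirichlet_sum_holomorphic in \<open>auto intro!: holomorphic_intros\<close>)
next
  case (Suc m)
  then obtain E where E: "E holomorphic_on {s. Re s > 1 - real m}"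
      "\<And>s. Re s > 1 \<Longrightarrow> E s = (s - 1) * dirichlet_sum s" by blast
  define N where "N = Suc m"
  define F where "F = (\<lambda>s. 1 + (\<Sum>n. zeta_remainder N n s)
      - (\<Sum>i=2..N. zeta_coeff (i - 1) s / fact i * E (s + of_nat i - 1)))"
  have holE: "(\<lambda>s. E (s + of_nat i - 1)) holomorphic_on {s. Re s > 1 - real N}" if "i \<ge> 2" for i
  proof -
    have "(E \<circ> (\<lambda>s. s + of_nat i - 1)) holomorphic_on {s. Re s > 1 - real N}"
      by (rule holomorphic_on_compose_gen[OF _ E(1)]) (use that in \<open>auto intro!: holomorphic_intros simp: N_def\<close>)
    thus ?thesis by (simp add: o_def)
  qed
  have "F holomorphic_on {s. Re s > 1 - real N}"
    unfolding F_def by (intro holomorphic_intros zeta_remainder_holomorphic holE) auto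
  moreover have "F s = (s - 1) * dirichlet_sum s" if s: "Re s > 1" for s
  proof -
    have "(\<Sum>n. zeta_remainder N n s) = -1 - (\<Sum>i=1..N. zeta_coeff i s / fact i * dirichlet_sum (s + of_nat i - 1))"
      by (rule zeta_remainder_sum[OF s])
    also have "(\<Sum>i=1..N. zeta_coeff i s / fact i * dirichlet_sum (s + of_nat i - 1))
        = (\<Sum>i=1..N. - (zeta_coeff (i - 1) s / fact i * E (s + of_nat i - 1)))"
    proof (rule sum.cong)
      fix i assume i: "i \<in> {1..N}"
      then obtain j where j: "i = Suc j" by (cases i) auto
      have "E (s + of_nat i - 1) = (s + of_nat i - 1 - 1) * dirichlet_sum (s + of_nat i - 1)"
        by (rule E(2)) (use s i in auto)
      moreover have "zeta_coeff i s = - (zeta_coeff (i - 1) s * (s + of_nat i - 1 - 1))"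
        by (simp add: j zeta_coeff_def algebra_simps)
      ultimately show "zeta_coeff i s / fact i * dirichlet_sum (s + of_nat i - 1) =
          - (zeta_coeff (i - 1) s / fact i * E (s + of_nat i - 1))"
        by simp
    qed auto
    also have "\<dots> = - E s - (\<Sum>i=2..N. zeta_coeff (i - 1) s / fact i * E (s + of_nat i - 1))"
    proof -
      have "{1..N} = insert 1 {2..N}" by (auto simp: N_def)
      thus ?thesis by (simp add: zeta_coeff_def sum_negf)
    qed
    finally show ?thesis using E(2)[OF s] by (simp add: F_def)
  qed
  ultimately show ?case unfolding N_def by blast
qed

lemma is_zeta_continuation_exists: "\<exists>Z. is_zeta_continuation Z"
proof -
  obtain E where E: "\<And>m. E m holomorphic_on {s. Re s > 1 - real m}"
      "\<And>m s. Re s > 1 \<Longrightarrow> E m s = (s - 1) * dirichlet_sum s"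
    using zeta_strip by metis
  have agree: "E m s = E k s" if "m \<le> k" "Re s > 1 - real m" for m k s
  proof (rule analytic_continuation_open[where s = "{s. Re s > 1}" and s' = "{s. Re s > 1 - real m}"
        and f = "E m" and g = "E k"])
    show "{s. Re s > 1} \<noteq> {}" by (auto intro!: exI[of _ 2])
    show "connected {s. Re s > 1 - real m}"
      by (intro convex_connected convex_halfspace_Re_gt)
    show "E k holomorphic_on {s. Re s > 1 - real m}"
      by (rule holomorphic_on_subset[OF E(1)]) (use that in auto)
    show "E m w = E k w" if "w \<in> {s. Re s > 1}" for w
      using E(2)[of w m] E(2)[of w k] that by simp
  qed (use E(1) that(2) in \<open>auto simp: open_half_plane\<close>)
  define M where "M = (\<lambda>s. Suc (nat \<lceil>1 - Re s\<rceil>))"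
  have M: "Re s > 1 - real (M s)" for s unfolding M_def by linarith
  have EM: "E (M s) s = E k s" if "Re s > 1 - real k" for s k
    using agree[OF _ M[of s], of k] agree[OF _ that, of "M s"] by (metis nat_le_linear)
  define Z where "Z = (\<lambda>s. E (M s) s / (s - 1))"
  have "Z holomorphic_on (- {1})"
  proof -
    have "\<exists>f'. (Z has_field_derivative f') (at s)" if s: "s \<in> - {1}" for s
    proof -
      define U where "U = {w. Re w > 1 - real (M s)} - {1}"
      have U: "open U" "s \<in> U" using s M[of s] by (auto simp: U_def open_half_plane open_Diff)
      have "(\<lambda>w. E (M s) w / (w - 1)) holomorphic_on U"
        by (intro holomorphic_intros holomorphic_on_subset[OF E(1)]) (auto simp: U_def)
      hence "Z holomorphic_on U"
        by (rule holomorphic_transform) (auto simp: U_def Z_def EM)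
      thus ?thesis using U holomorphic_on_open by blast
    qed
    thus ?thesis using holomorphic_on_open[of "- {1}" Z] by (simp add: open_Compl)
  qed
  moreover have "(\<lambda>n. of_nat (Suc n) powr (-s)) sums Z s" if "Re s > 1" for s
  proof -
    have "Z s = dirichlet_sum s" using E(2)[OF that, of "M s"] that by (auto simp: Z_def)
    thus ?thesis using summable_sums[OF dirichlet_sum_summable[OF that]] by simp
  qed
  ultimately show ?thesis unfolding is_zeta_continuation_def by blast
qed

lemma is_zeta_continuation_unique:
  assumes "is_zeta_continuation Z" "is_zeta_continuation Z'" "s \<noteq> 1"
  shows "Z s = Z' s"
proof (rule analytic_continuation_open[where s = "{s. Re s > 1}" and s' = "- {1}"
      and f = Z and g = Z'])
  show "{s. Re s > 1} \<noteq> {}" by (auto intro!: exI[of _ 2])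
  show "connected (- {1::complex})"
    by (intro connected_punctured_universe) simp
  show "Z w = Z' w" if "w \<in> {s. Re s > 1}" for w
    using assms that sums_unique2 unfolding is_zeta_continuation_def by blast
qed (use assms in \<open>auto simp: open_half_plane is_zeta_continuation_def\<close>)

lemma riemann_zeta_is_continuation: "is_zeta_continuation riemann_zeta"
  unfolding riemann_zeta_def using is_zeta_continuation_exists by (rule someI_ex)

definition E2 :: "real poly \<Rightarrow> real \<Rightarrow> real" where
  "E2 P T = integral {0..T} (\<lambda>t. norm (riemann_zeta (Complex (1/2) t)) ^ 4) - T * poly P (ln T)"

definition Q4 :: "real poly \<Rightarrow> real poly" where
  "Q4 P = P + pderiv P"

definition K_integral :: "real poly \<Rightarrow> complex \<Rightarrow> complex" where
  "K_integral P s =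
     integral {1..} (\<lambda>x. of_real ((norm (riemann_zeta (Complex (1/2) x)) ^ 4 - poly (Q4 P) (ln x)) * E2 P x)
                          * of_real x powr (-s))"

end

theory Submission
  imports Defs "HOL-Probability.Probability" "HOL-Real_Asymp.Real_Asymp"
begin

text \<open>
  Write \<open>G u = (E2 P (exp u))\<^sup>2 * exp (- \<sigma> * u)\<close> for \<open>u > 0\<close>. Integration by parts shows that for large \<open>Re s\<close>
  the Laplace transform of \<open>(E2 P (exp u))\<^sup>2\<close> is \<open>(2 * K s + (E2 P 1)\<^sup>2) / s\<close>; since this function is nonnegative
  and \<open>K\<close> is holomorphic on \<open>Re s > 1\<close>, Landau's theorem extends convergence and identity to that half
  plane. Hence \<open>G\<close> is integrable and its Fourier transform is known in terms of \<open>K\<close>.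

  By the polynomial growth of zeta near the critical line, \<open>E2\<close> extends holomorphically to a strip around
  the real axis with polynomial bounds, so \<open>G\<close> is analytic at scale \<open>1 / T\<close> near \<open>ln T\<close>. Averaging its \<open>n\<close>-th
  difference over a Gaussian of width \<open>T powr (- (1 + \<epsilon> / 2))\<close> expresses \<open>G\<close> as a combination of Gaussian
  convolutions of \<open>G\<close> up to an error that is bounded once \<open>n\<close> is large. The convolutions have Fourier transforms
  concentrated on \<open>\<bar>t\<bar> \<le> T powr (1 + \<epsilon>)\<close>, and Plancherel's inequality bounds their mean square by the
  mean square of the transform of \<open>G\<close> on that range.
\<close>

section \<open>Functions of polynomial growth\<close>

definition poly_bounded_on :: "('a::real_normed_vector \<Rightarrow> 'b::real_normed_vector) \<Rightarrow> 'a set \<Rightarrow> bool"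
    (infix "poly'_bounded'_on" 50) where
  "f poly_bounded_on S \<longleftrightarrow> (\<exists>C n. \<forall>x\<in>S. norm (f x) \<le> C * (1 + norm x) ^ n)"

named_theorems poly_bounded_intros

lemma poly_bounded_onI:
  assumes "\<And>x. x \<in> S \<Longrightarrow> norm (f x) \<le> C * (1 + norm x) ^ n"
  shows "f poly_bounded_on S"
  using assms unfolding poly_bounded_on_def by blast

lemma poly_bounded_onE:
  assumes "f poly_bounded_on S"
  obtains C n where "C \<ge> 0" "\<And>x. x \<in> S \<Longrightarrow> norm (f x) \<le> C * (1 + norm x) ^ n"
proof -
  obtain C n where C: "\<And>x. x \<in> S \<Longrightarrow> norm (f x) \<le> C * (1 + norm x) ^ n"
    using assms unfolding poly_bounded_on_def by blast
  have "norm (f x) \<le> \<bar>C\<bar> * (1 + norm x) ^ n" if "x \<in> S" for x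
    using C[OF that] mult_right_mono[of C "\<bar>C\<bar>" "(1 + norm x) ^ n"] by force
  thus ?thesis by (intro that[of "\<bar>C\<bar>" n]) auto
qed

lemma poly_bounded_on_const [poly_bounded_intros]: "(\<lambda>_. c) poly_bounded_on S"
  by (rule poly_bounded_onI[where C = "norm c" and n = 0]) simp

lemma poly_bounded_on_ident [poly_bounded_intros]: "(\<lambda>x. x) poly_bounded_on S"
  by (rule poly_bounded_onI[where C = 1 and n = 1]) simp

lemma poly_bounded_on_add [poly_bounded_intros]:
  assumes "f poly_bounded_on S" "g poly_bounded_on S"
  shows "(\<lambda>x. f x + g x) poly_bounded_on S"
proof -
  obtain C n where C: "C \<ge> 0" "\<And>x. x \<in> S \<Longrightarrow> norm (f x) \<le> C * (1 + norm x) ^ n"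
    using assms(1) by (rule poly_bounded_onE) blast
  obtain D m where D: "D \<ge> 0" "\<And>x. x \<in> S \<Longrightarrow> norm (g x) \<le> D * (1 + norm x) ^ m"
    using assms(2) by (rule poly_bounded_onE) blast
  show ?thesis
  proof (rule poly_bounded_onI)
    fix x assume x: "x \<in> S"
    have "norm (f x + g x) \<le> C * (1 + norm x) ^ n + D * (1 + norm x) ^ m"
      using C(2)[OF x] D(2)[OF x] norm_triangle_ineq[of "f x" "g x"] by linarith
    also have "\<dots> \<le> C * (1 + norm x) ^ (n + m) + D * (1 + norm x) ^ (n + m)"
      using C(1) D(1) by (intro add_mono mult_left_mono power_increasing) auto
    also have "\<dots> = (C + D) * (1 + norm x) ^ (n + m)" by (simp add: distrib_right)
    finally show "norm (f x + g x) \<le> (C + D) * (1 + norm x) ^ (n + m)" .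
  qed
qed

lemma poly_bounded_on_minus [poly_bounded_intros]:
  "f poly_bounded_on S \<Longrightarrow> (\<lambda>x. - f x) poly_bounded_on S"
  unfolding poly_bounded_on_def by simp

lemma poly_bounded_on_diff [poly_bounded_intros]:
  assumes "f poly_bounded_on S" "g poly_bounded_on S"
  shows "(\<lambda>x. f x - g x) poly_bounded_on S"
  using poly_bounded_on_add[OF assms(1) poly_bounded_on_minus[OF assms(2)]] by simp

lemma poly_bounded_on_mult [poly_bounded_intros]:
  fixes f g :: "'a::real_normed_vector \<Rightarrow> 'b::real_normed_algebra"
  assumes "f poly_bounded_on S" "g poly_bounded_on S"
  shows "(\<lambda>x. f x * g x) poly_bounded_on S"
proof -
  obtain C n where C: "C \<ge> 0" "\<And>x. x \<in> S \<Longrightarrow> norm (f x) \<le> C * (1 + norm x) ^ n"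
    using assms(1) by (rule poly_bounded_onE) blast
  obtain D m where D: "D \<ge> 0" "\<And>x. x \<in> S \<Longrightarrow> norm (g x) \<le> D * (1 + norm x) ^ m"
    using assms(2) by (rule poly_bounded_onE) blast
  show ?thesis
  proof (rule poly_bounded_onI)
    fix x assume x: "x \<in> S"
    have "norm (f x * g x) \<le> norm (f x) * norm (g x)" by (rule norm_mult_ineq)
    also have "\<dots> \<le> (C * (1 + norm x) ^ n) * (D * (1 + norm x) ^ m)"
      using C(1) by (intro mult_mono C(2) D(2) x) auto
    finally show "norm (f x * g x) \<le> (C * D) * (1 + norm x) ^ (n + m)"
      by (simp add: power_add mult_ac)
  qed
qed

lemma poly_bounded_on_power [poly_bounded_intros]:
  fixes f :: "'a::real_normed_vector \<Rightarrow> 'b::real_normed_algebra_1"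
  shows "f poly_bounded_on S \<Longrightarrow> (\<lambda>x. f x ^ k) poly_bounded_on S"
  by (induction k) (auto intro: poly_bounded_intros)

lemma poly_bounded_on_poly [poly_bounded_intros]:
  fixes f :: "'a::real_normed_vector \<Rightarrow> 'b::real_normed_field"
  shows "f poly_bounded_on S \<Longrightarrow> (\<lambda>x. poly p (f x)) poly_bounded_on S"
  by (induction p) (auto intro: poly_bounded_intros)

lemma poly_bounded_on_compose:
  assumes "f poly_bounded_on T" "g poly_bounded_on S" "g ` S \<subseteq> T"
  shows "(\<lambda>x. f (g x)) poly_bounded_on S"
proof -
  obtain C n where C: "C \<ge> 0" "\<And>x. x \<in> T \<Longrightarrow> norm (f x) \<le> C * (1 + norm x) ^ n"
    using assms(1) by (rule poly_bounded_onE) blast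
  obtain D m where D: "D \<ge> 0" "\<And>x. x \<in> S \<Longrightarrow> norm (g x) \<le> D * (1 + norm x) ^ m"
    using assms(2) by (rule poly_bounded_onE) blast
  show ?thesis
  proof (rule poly_bounded_onI)
    fix x assume x: "x \<in> S"
    have "norm (f (g x)) \<le> C * (1 + norm (g x)) ^ n" using assms(3) x by (intro C(2)) auto
    also have "\<dots> \<le> C * ((1 + D) * (1 + norm x) ^ m) ^ n"
    proof (intro mult_left_mono power_mono)
      have "1 \<le> (1 + norm x) ^ m" by (rule one_le_power) simp
      thus "1 + norm (g x) \<le> (1 + D) * (1 + norm x) ^ m"
        using D(2)[OF x] unfolding distrib_right by linarith
    qed (use C(1) in auto)
    finally show "norm (f (g x)) \<le> (C * (1 + D) ^ n) * (1 + norm x) ^ (m * n)"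
      by (simp add: power_mult_distrib power_mult)
  qed
qed

lemma poly_bounded_on_Ln:
  assumes "c > 0"
  shows "Ln poly_bounded_on {z. norm z \<ge> c}"
proof (rule poly_bounded_onI)
  fix z :: complex assume z: "z \<in> {z. norm z \<ge> c}"
  hence z0: "z \<noteq> 0" and inv: "1 / norm z \<le> 1 / c"
    using assms by (auto intro!: divide_left_mono mult_pos_pos)
  have "norm (Ln z) \<le> \<bar>ln (norm z)\<bar> + pi"
    using cmod_le[of "Ln z"] z0 mpi_less_Im_Ln[of z] Im_Ln_le_pi[of z] by (simp add: abs_le_iff)
  also have "\<bar>ln (norm z)\<bar> \<le> norm z + 1 / c"
  proof -
    have "ln (norm z) \<le> norm z - 1" "- ln (norm z) \<le> 1 / norm z - 1"
      using z0 ln_le_minus_one[of "norm z"] ln_le_minus_one[of "1 / norm z"] by (simp_all add: ln_div)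
    moreover have "0 < 1 / c" "0 \<le> norm z" using assms by auto
    ultimately show ?thesis using inv by linarith
  qed
  also have "norm z + 1 / c + pi \<le> (1 + 1 / c + pi) * (1 + norm z) ^ 1"
    using assms by (simp add: algebra_simps)
  finally show "norm (Ln z) \<le> (1 + 1 / c + pi) * (1 + norm z) ^ 1" by simp
qed

lemma norm_diff_le_of_deriv_poly_bound:
  fixes F f :: "complex \<Rightarrow> complex"
  assumes S: "convex S" "a \<in> S" "z \<in> S"
    and deriv: "\<And>w. w \<in> S \<Longrightarrow> (F has_field_derivative f w) (at w)"
    and C: "C \<ge> 0" "\<And>w. w \<in> S \<Longrightarrow> norm (f w) \<le> C * (1 + norm w) ^ n"
  shows "norm (F z - F a) \<le> C * (1 + norm a) ^ Suc n * (1 + norm z) ^ Suc n"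
proof -
  have mem: "w \<in> S" and bound: "norm w \<le> norm a + norm z" if "w \<in> closed_segment a z" for w
  proof -
    show "w \<in> S" using closed_segment_subset[OF S(2,3,1)] that by blast
    have "closed_segment a z \<subseteq> cball 0 (norm a + norm z)"
      by (intro closed_segment_subset convex_cball) auto
    thus "norm w \<le> norm a + norm z" using that by auto
  qed
  have "norm (F z - F a) \<le> C * (1 + (norm a + norm z)) ^ n * norm (z - a)"
  proof (rule field_differentiable_bound[of "closed_segment a z"])
    show "(F has_field_derivative f w) (at w within closed_segment a z)"
        if "w \<in> closed_segment a z" for w
      by (rule has_field_derivative_at_within[OF deriv[OF mem[OF that]]])
    show "norm (f w) \<le> C * (1 + (norm a + norm z)) ^ n" if "w \<in> closed_segment a z" for w
      using C(2)[OF mem[OF that]] bound[OF that] C(1)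
      by (elim order.trans) (intro mult_left_mono power_mono, auto)
  qed auto
  also have "\<dots> \<le> C * ((1 + norm a) * (1 + norm z)) ^ n * ((1 + norm a) * (1 + norm z))"
  proof -
    have "1 + (norm a + norm z) \<le> (1 + norm a) * (1 + norm z)" by (simp add: algebra_simps)
    moreover from this have "norm (z - a) \<le> (1 + norm a) * (1 + norm z)"
      using norm_triangle_ineq4[of z a] by linarith
    ultimately show ?thesis using C(1) by (intro mult_mono mult_left_mono power_mono) auto
  qed
  finally show ?thesis by (simp add: power_mult_distrib mult_ac)
qed

lemma holomorphic_primitive_poly_bounded:
  assumes S: "convex S" "open S" and f: "f holomorphic_on S" "f poly_bounded_on S" and a: "a \<in> S"
  obtains F where "\<And>z. z \<in> S \<Longrightarrow> (F has_field_derivative f z) (at z)"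
    and "F poly_bounded_on S" and "F a = b"
proof -
  obtain H where "\<And>z. z \<in> S \<Longrightarrow> (H has_field_derivative f z) (at z within S)"
    using holomorphic_convex_primitive'[OF S f(1)] by blast
  hence H: "(H has_field_derivative f z) (at z)" if "z \<in> S" for z
    using that at_within_open[OF that S(2)] by metis
  obtain C n where C: "C \<ge> 0" "\<And>z. z \<in> S \<Longrightarrow> norm (f z) \<le> C * (1 + norm z) ^ n"
    using f(2) by (rule poly_bounded_onE) blast
  have "(\<lambda>z. H z - H a) poly_bounded_on S"
    by (rule poly_bounded_onI) (rule norm_diff_le_of_deriv_poly_bound[OF S(1) a _ H C])
  hence "(\<lambda>z. H z - H a + b) poly_bounded_on S"
    by (rule poly_bounded_on_add[OF _ poly_bounded_on_const])
  thus ?thesis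
  proof (rule that[rotated])
    show "((\<lambda>z. H z - H a + b) has_field_derivative f z) (at z)" if "z \<in> S" for z
      using H[OF that] by (auto intro!: derivative_eq_intros)
  qed simp
qed

section \<open>The zeta function inside the critical strip\<close>

lemma riemann_zeta_holomorphic: "riemann_zeta holomorphic_on - {1}"
  using riemann_zeta_is_continuation by (simp add: is_zeta_continuation_def)

lemma riemann_zeta_sums: "Re s > 1 \<Longrightarrow> (\<lambda>n. of_nat (Suc n) powr (-s)) sums riemann_zeta s"
  using riemann_zeta_is_continuation by (simp add: is_zeta_continuation_def)

lemma riemann_zeta_eq_remainder:
  assumes "Re s > 0" "s \<noteq> 1"
  shows "(s - 1) * riemann_zeta s = 1 + (\<Sum>n. zeta_remainder 1 n s)"
proof (rule analytic_continuation_open[where s = "{s. Re s > 1}" and s' = "{s. Re s > 0} - {1}"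
      and f = "\<lambda>s. (s - 1) * riemann_zeta s" and g = "\<lambda>s. 1 + (\<Sum>n. zeta_remainder 1 n s)"])
  show "(\<lambda>s. (s - 1) * riemann_zeta s) holomorphic_on {s. Re s > 0} - {1}"
    by (intro holomorphic_intros holomorphic_on_subset[OF riemann_zeta_holomorphic]) auto
  show "(\<lambda>s. 1 + (\<Sum>n. zeta_remainder 1 n s)) holomorphic_on {s. Re s > 0} - {1}"
    using zeta_remainder_holomorphic[of 1]
    by (intro holomorphic_intros) (auto elim: holomorphic_on_subset)
  show "{s. Re s > 1} \<noteq> {}" by (auto intro!: exI[of _ 2])
  show "connected ({s::complex. Re s > 0} - {1})"
    by (intro connected_open_delete convex_connected convex_halfspace_Re_gt open_half_plane) auto
  show "(w - 1) * riemann_zeta w = 1 + (\<Sum>n. zeta_remainder 1 n w)" if "w \<in> {s. Re s > 1}" for w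
    using zeta_remainder_sum[of w 1] riemann_zeta_sums[of w] that
    by (simp add: sums_iff zeta_coeff_def algebra_simps)
qed (use assms in \<open>auto simp: open_half_plane open_Diff\<close>)

lemma summable_Suc_powr_minus_one:
  fixes a :: real
  assumes "a > 0"
  shows "summable (\<lambda>n. real (Suc n) powr (- a - 1))"
  using assms summable_real_powr_iff[of "- a - 1"] by (subst summable_Suc_iff) simp

lemma norm_riemann_zeta_le:
  assumes "Re s > 0" "s \<noteq> 1"
  shows "norm (riemann_zeta s) \<le> 1 / norm (s - 1) + norm s * (\<Sum>n. real (Suc n) powr (- Re s - 1))"
proof -
  let ?S = "\<Sum>n. real (Suc n) powr (- Re s - 1)"
  have summable: "summable (\<lambda>n. real (Suc n) powr (- Re s - 1))"
    by (rule summable_Suc_powr_minus_one[OF assms(1)])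
  have coeff: "norm (zeta_coeff 2 s) = norm (s - 1) * norm s"
    by (simp add: zeta_coeff_def numeral_2_eq_2 norm_mult norm_minus_commute)
  have "norm (\<Sum>n. zeta_remainder 1 n s) \<le> (\<Sum>n. norm (zeta_coeff 2 s) * real (Suc n) powr (- Re s - 1))"
    using assms(1) zeta_remainder_bound[of 1 s]
    by (intro norm_suminf_le summable_mult summable) (simp add: numeral_2_eq_2)
  also have "\<dots> = norm (s - 1) * norm s * ?S"
    unfolding coeff by (rule suminf_mult[OF summable])
  finally have "norm (s - 1) * norm (riemann_zeta s) \<le> 1 + norm (s - 1) * (norm s * ?S)"
    unfolding norm_mult[of _ "riemann_zeta s", symmetric] riemann_zeta_eq_remainder[OF assms] mult.assoc
    by (intro order.trans[OF norm_triangle_ineq] add_mono) auto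
  thus ?thesis using assms(2) by (simp add: field_simps)
qed

lemma poly_bounded_on_riemann_zeta:
  assumes "0 < a" "b < 1"
  shows "riemann_zeta poly_bounded_on {s. a \<le> Re s \<and> Re s \<le> b}"
proof (rule poly_bounded_onI)
  fix s assume s: "s \<in> {s. a \<le> Re s \<and> Re s \<le> b}"
  let ?S = "\<lambda>x. \<Sum>n. real (Suc n) powr (- x - 1)"
  have "norm (s - 1) \<ge> 1 - b" using abs_Re_le_cmod[of "s - 1"] s by auto
  hence pole: "1 / norm (s - 1) \<le> 1 / (1 - b)"
    using assms(2) by (intro divide_left_mono mult_pos_pos) linarith+
  have "?S (Re s) \<le> ?S a"
    using s assms by (intro suminf_le summable_Suc_powr_minus_one powr_mono) auto
  hence "1 / norm (s - 1) + norm s * ?S (Re s) \<le> 1 / (1 - b) + norm s * ?S a"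
    by (intro add_mono pole mult_left_mono) auto
  moreover have "Re s > 0" "s \<noteq> 1" using s assms by auto
  ultimately have "norm (riemann_zeta s) \<le> 1 / (1 - b) + norm s * ?S a"
    using norm_riemann_zeta_le[of s] by linarith
  also have "\<dots> \<le> (1 / (1 - b) + ?S a) * (1 + norm s) ^ 1"
  proof -
    have "A + x * S \<le> (A + S) * (1 + x) ^ 1" if "A \<ge> 0" "S \<ge> 0" "x \<ge> 0" for A S x :: real
      using that by (simp add: algebra_simps)
    thus ?thesis using assms suminf_nonneg[OF summable_Suc_powr_minus_one[of a]] by simp
  qed
  finally show "norm (riemann_zeta s) \<le> (1 / (1 - b) + ?S a) * (1 + norm s) ^ 1" .
qed

lemma riemann_zeta_cnj:
  assumes "s \<noteq> 1"
  shows "riemann_zeta (cnj s) = cnj (riemann_zeta s)"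
proof -
  have "is_zeta_continuation (cnj \<circ> riemann_zeta \<circ> cnj)"
    unfolding is_zeta_continuation_def
  proof (intro conjI allI impI)
    have "cnj ` (- {1}) = - {1}" by (auto intro!: image_eqI[of _ cnj "cnj _"])
    thus "(cnj \<circ> riemann_zeta \<circ> cnj) holomorphic_on - {1}"
      using riemann_zeta_holomorphic
      by (intro holomorphic_on_compose_cnj_cnj) (auto simp: open_Compl)
    fix s :: complex assume "Re s > 1"
    hence "(\<lambda>n. of_nat (Suc n) powr (-cnj s)) sums riemann_zeta (cnj s)"
      by (intro riemann_zeta_sums) simp
    hence "(\<lambda>n. cnj (of_nat (Suc n) powr (-cnj s))) sums cnj (riemann_zeta (cnj s))"
      by (simp only: sums_cnj)
    thus "(\<lambda>n. of_nat (Suc n) powr (-s)) sums (cnj \<circ> riemann_zeta \<circ> cnj) s"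
      by (simp add: cnj_powr del: of_nat_Suc)
  qed
  from is_zeta_continuation_unique[OF this riemann_zeta_is_continuation assms]
  show ?thesis by (metis comp_apply complex_cnj_cnj)
qed

section \<open>Holomorphic extension of the error term\<close>

definition half_strip :: "complex set" where
  "half_strip = {z. Re z > 1/2 \<and> \<bar>Im z\<bar> < 1/4}"

lemma convex_half_strip: "convex half_strip"
  and open_half_strip: "open half_strip"
proof -
  have eq: "half_strip = {z. Re z > 1/2} \<inter> {z. Im z < 1/4} \<inter> {z. Im z > -1/4}"
    by (auto simp: half_strip_def)
  show "convex half_strip"
    unfolding eq
    by (intro convex_Int convex_halfspace_Re_gt convex_halfspace_Im_lt convex_halfspace_Im_gt)
  show "open half_strip"
    unfolding eq by (intro open_Int open_halfspace_Re_gt open_halfspace_Im_lt open_halfspace_Im_gt)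
qed

definition zeta_fourth :: "complex \<Rightarrow> complex" where
  "zeta_fourth z = riemann_zeta (1/2 + \<i> * z) ^ 2 * riemann_zeta (1/2 - \<i> * z) ^ 2"

lemma zeta_fourth_holomorphic: "zeta_fourth holomorphic_on {z. Re z > 0}"
proof -
  have "(riemann_zeta \<circ> (\<lambda>z. 1/2 + w * z)) holomorphic_on {z. Re z > 0}" if "w = \<i> \<or> w = -\<i>" for w
    by (rule holomorphic_on_compose_gen[OF _ riemann_zeta_holomorphic])
       (use that in \<open>auto intro!: holomorphic_intros simp: complex_eq_iff\<close>)
  from this[of \<i>] this[of "-\<i>"] show ?thesis
    unfolding zeta_fourth_def[abs_def] by (auto intro!: holomorphic_intros simp: o_def)
qed

lemma poly_bounded_on_zeta_fourth: "zeta_fourth poly_bounded_on half_strip"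
  unfolding zeta_fourth_def[abs_def]
  by (intro poly_bounded_intros poly_bounded_on_compose[OF poly_bounded_on_riemann_zeta[of "1/4" "3/4"]])
     (auto simp: half_strip_def)

lemma zeta_fourth_of_real:
  "zeta_fourth (of_real x) = of_real (norm (riemann_zeta (Complex (1/2) x)) ^ 4)"
proof -
  have arg: "1/2 + \<i> * of_real x = Complex (1/2) x" "1/2 - \<i> * of_real x = cnj (Complex (1/2) x)"
    by (auto simp: complex_eq_iff)
  have "riemann_zeta (cnj (Complex (1/2) x)) = cnj (riemann_zeta (Complex (1/2) x))"
    by (rule riemann_zeta_cnj) (auto simp: complex_eq_iff)
  hence "zeta_fourth (of_real x)
      = (riemann_zeta (Complex (1/2) x) * cnj (riemann_zeta (Complex (1/2) x)))\<^sup>2"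
    unfolding zeta_fourth_def arg by (simp add: power_mult_distrib)
  thus ?thesis by (simp add: complex_norm_square[symmetric] flip: power_mult)
qed

definition E2_deriv :: "real poly \<Rightarrow> real \<Rightarrow> real" where
  "E2_deriv P x = norm (riemann_zeta (Complex (1/2) x)) ^ 4 - poly (Q4 P) (ln x)"

lemma continuous_on_norm_riemann_zeta_fourth:
  "continuous_on A (\<lambda>t. norm (riemann_zeta (Complex (1/2) t)) ^ 4)"
proof -
  have "continuous_on A (\<lambda>t. riemann_zeta (Complex (1/2) t))"
    by (rule continuous_on_compose2[OF holomorphic_on_imp_continuous_on[OF riemann_zeta_holomorphic]])
       (auto intro!: continuous_intros simp: complex_eq_iff Complex_eq)
  thus ?thesis by (intro continuous_intros)
qed

lemma E2_has_real_derivative: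
  assumes "x > 0"
  shows "(E2 P has_real_derivative E2_deriv P x) (at x)"
proof -
  let ?z = "\<lambda>t. norm (riemann_zeta (Complex (1/2) t)) ^ 4"
  have "((\<lambda>T. integral {0..T} ?z) has_real_derivative ?z x) (at x within {0..x+1})"
    using assms by (intro integral_has_real_derivative continuous_on_norm_riemann_zeta_fourth) auto
  moreover have "at x within {0..x+1} = at x"
    using assms by (intro at_within_interior) auto
  ultimately have "((\<lambda>T. integral {0..T} ?z) has_real_derivative ?z x) (at x)" by simp
  thus ?thesis
    unfolding E2_def[abs_def] E2_deriv_def Q4_def using assms
    by (auto intro!: derivative_eq_intros DERIV_chain2[OF poly_DERIV] simp: field_simps)
qed

lemma continuous_on_E2_deriv: "continuous_on {0<..} (E2_deriv P)"
  unfolding E2_deriv_def[abs_def]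
  by (intro continuous_intros continuous_on_norm_riemann_zeta_fourth) auto

lemma E2_deriv_holomorphic_extension:
  obtains f where "f holomorphic_on half_strip" and "f poly_bounded_on half_strip"
    and "\<And>x. x > 0 \<Longrightarrow> f (of_real x) = of_real (E2_deriv P x)"
proof
  let ?f = "\<lambda>z. zeta_fourth z - poly (map_poly of_real (Q4 P)) (Ln z)"
  show "?f holomorphic_on half_strip"
    by (intro holomorphic_intros holomorphic_on_subset[OF zeta_fourth_holomorphic])
       (auto simp: half_strip_def complex_nonpos_Reals_iff)
  have "1/2 \<le> norm z" if "z \<in> half_strip" for z
    using that complex_Re_le_cmod[of z] by (simp add: half_strip_def)
  hence "(\<lambda>z. Ln z) poly_bounded_on half_strip"
    using poly_bounded_on_compose[OF poly_bounded_on_Ln[of "1/2"] poly_bounded_on_ident, of half_strip]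
    by (simp add: subset_iff)
  thus "?f poly_bounded_on half_strip"
    by (intro poly_bounded_intros poly_bounded_on_zeta_fourth)
  have "poly (map_poly of_real p) (of_real y) = (of_real (poly p y) :: complex)" for p y
    by (induction p) (auto simp: map_poly_pCons)
  thus "?f (of_real x) = of_real (E2_deriv P x)" if "x > 0" for x
    using that by (simp add: E2_deriv_def zeta_fourth_of_real Ln_of_real)
qed

lemma E2_holomorphic_extension:
  obtains F where "F holomorphic_on half_strip" and "F poly_bounded_on half_strip"
    and "\<And>x. x > 1/2 \<Longrightarrow> F (of_real x) = of_real (E2 P x)"
proof -
  obtain f where f: "f holomorphic_on half_strip" "f poly_bounded_on half_strip"
    "\<And>x. x > 0 \<Longrightarrow> f (of_real x) = of_real (E2_deriv P x)"
    by (rule E2_deriv_holomorphic_extension[of P]) blast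
  have "1 \<in> half_strip" by (simp add: half_strip_def)
  then obtain F where F: "\<And>z. z \<in> half_strip \<Longrightarrow> (F has_field_derivative f z) (at z)"
      "F poly_bounded_on half_strip" "F 1 = of_real (E2 P 1)"
    using holomorphic_primitive_poly_bounded[OF convex_half_strip open_half_strip f(1,2)] by blast
  obtain c where c: "\<And>x. x \<in> {1/2<..} \<Longrightarrow> F (of_real x) - of_real (E2 P x) = c"
  proof (rule has_vector_derivative_zero_constant[where f = "\<lambda>x. F (of_real x) - of_real (E2 P x)"])
    show "convex {1/2::real<..}" by (rule convex_real_interval)
    fix x :: real assume x: "x \<in> {1/2<..}"
    have "((\<lambda>x. F (of_real x)) has_vector_derivative f (of_real x)) (at x)"
      using x by (intro has_vector_derivative_real_field F(1)) (simp add: half_strip_def)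
    moreover have "((\<lambda>x. of_real (E2 P x)) has_vector_derivative f (of_real x)) (at x)"
      using x E2_has_real_derivative[of x P] f(3)[of x] has_vector_derivative_of_real
      by (simp add: has_real_derivative_iff_has_vector_derivative)
    ultimately have "((\<lambda>x. F (of_real x) - of_real (E2 P x)) has_vector_derivative 0) (at x)"
      using has_vector_derivative_diff by fastforce
    thus "((\<lambda>x. F (of_real x) - of_real (E2 P x)) has_vector_derivative 0) (at x within {1/2<..})"
      by (rule has_vector_derivative_at_within)
  qed blast
  from c[of 1] F(3) have "c = 0" by simp
  show ?thesis
  proof
    show "F holomorphic_on half_strip"
      using F(1) open_half_strip by (auto simp: holomorphic_on_open)
    show "F (of_real x) = of_real (E2 P x)" if "x > 1/2" for x
      using c[of x] \<open>c = 0\<close> that by simp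
  qed (rule F(2))
qed

lemma poly_bounded_on_of_real_half_strip:
  fixes F :: "complex \<Rightarrow> complex" and f :: "real \<Rightarrow> real"
  assumes "F poly_bounded_on half_strip" "\<And>x. x > 1/2 \<Longrightarrow> F (of_real x) = of_real (f x)"
  shows "f poly_bounded_on {1..}"
proof -
  have "(\<lambda>x::real. F (of_real x)) poly_bounded_on {1..}"
    by (rule poly_bounded_on_compose[OF assms(1) poly_bounded_onI[of _ _ 1 1]])
       (auto simp: half_strip_def)
  thus ?thesis using assms(2) by (simp add: poly_bounded_on_def)
qed

lemma poly_bounded_on_E2: "E2 P poly_bounded_on {1..}"
  by (rule E2_holomorphic_extension[of P]) (rule poly_bounded_on_of_real_half_strip)

lemma poly_bounded_on_E2_deriv: "E2_deriv P poly_bounded_on {1..}"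
  by (rule E2_deriv_holomorphic_extension[of P]) (rule poly_bounded_on_of_real_half_strip, auto)

lemma continuous_on_E2: "continuous_on {0<..} (E2 P)"
  by (rule DERIV_continuous_on[OF has_field_derivative_at_within[OF E2_has_real_derivative]]) simp

section \<open>Landau's theorem for Laplace transforms\<close>

definition damped :: "real \<Rightarrow> (real \<Rightarrow> real) \<Rightarrow> real \<Rightarrow> real" where
  "damped c g u = g u * exp (- (c * u))"

definition laplace :: "(real \<Rightarrow> real) \<Rightarrow> complex \<Rightarrow> complex" where
  "laplace g s = (\<integral>u. of_real (g u) * exp (- (s * of_real u)) \<partial>lborel)"

definition fourier_integral :: "(real \<Rightarrow> complex) \<Rightarrow> real \<Rightarrow> complex" where
  "fourier_integral h x = (\<integral>t. h t * iexp (x * t) \<partial>lborel)"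

definition fourier :: "(real \<Rightarrow> real) \<Rightarrow> real \<Rightarrow> complex" where
  "fourier G t = fourier_integral (\<lambda>u. of_real (G u)) (- t)"

definition laplace_coeff :: "(real \<Rightarrow> real) \<Rightarrow> real \<Rightarrow> nat \<Rightarrow> real" where
  "laplace_coeff g c n = (\<integral>u. damped c g u * (- u) ^ n / fact n \<partial>lborel)"

lemma damped_measurable [measurable]:
  assumes [measurable]: "g \<in> borel_measurable borel"
  shows "damped c g \<in> borel_measurable borel"
  unfolding damped_def[abs_def] by measurable

lemma damped_add: "damped (c + d) g u = damped c g u * exp (- (d * u))"
  by (simp add: damped_def algebra_simps flip: exp_add)

lemma damped_diff: "damped (c - r) g u = damped c g u * exp (r * u)"
  using damped_add[of c "- r" g u] by simp

lemma laplace_kernel_eq_damped: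
  "of_real (g u) * exp (- (s * of_real u)) = of_real (damped (Re s) g u) * iexp (- Im s * u)"
proof -
  have "of_real (exp (- (Re s * u))) * iexp (- Im s * u) = exp (- (s * of_real u))"
    unfolding exp_of_real[symmetric] exp_add[symmetric]
    by (cases s) (simp add: Complex_eq algebra_simps)
  thus ?thesis by (simp add: damped_def mult.assoc)
qed

lemma laplace_eq_fourier: "laplace g s = fourier (damped (Re s) g) (Im s)"
  unfolding laplace_def fourier_def fourier_integral_def laplace_kernel_eq_damped ..

lemma integrable_damped_mono:
  assumes [measurable]: "g \<in> borel_measurable borel" and supp: "\<And>u. u < 0 \<Longrightarrow> g u = 0"
    and int: "integrable lborel (damped c g)" and "c \<le> c'"
  shows "integrable lborel (damped c' g)"
proof (rule Bochner_Integration.integrable_bound[OF int])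
  have "\<bar>g u\<bar> * exp (- (c' * u)) \<le> \<bar>g u\<bar> * exp (- (c * u))" for u
    using assms(4) supp[of u] by (cases "u < 0") (auto intro!: mult_left_mono mult_right_mono)
  thus "AE u in lborel. norm (damped c' g u) \<le> norm (damped c g u)"
    by (simp add: damped_def abs_mult)
qed measurable

lemma exp_partial_sum_le:
  fixes x :: real
  assumes "x \<ge> 0"
  shows "(\<Sum>n<N. x ^ n / fact n) \<le> exp x"
proof -
  have "(\<Sum>n<N. x ^ n /\<^sub>R fact n) \<le> (\<Sum>n. x ^ n /\<^sub>R fact n)"
    using assms by (intro sum_le_suminf summable_exp_generic) auto
  thus ?thesis by (simp add: exp_def divide_inverse mult.commute)
qed

lemma power_div_fact_le_exp:
  fixes x :: real
  assumes "x \<ge> 0"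
  shows "x ^ n / fact n \<le> exp x"
proof -
  have "x ^ n / fact n \<le> (\<Sum>k<Suc n. x ^ k / fact k)"
    using assms by (intro member_le_sum) auto
  also have "\<dots> \<le> exp x" by (rule exp_partial_sum_le[OF assms])
  finally show ?thesis .
qed

lemma integrable_damped_power:
  assumes [measurable]: "g \<in> borel_measurable borel" and supp: "\<And>u. u < 0 \<Longrightarrow> g u = 0"
    and int: "integrable lborel (damped c g)" and "c < c'"
  shows "integrable lborel (\<lambda>u. damped c' g u * (a * u) ^ n / fact n)"
proof (rule Bochner_Integration.integrable_bound)
  define d where "d = c' - c"
  have d: "d > 0" using assms(4) by (simp add: d_def)
  show "integrable lborel (\<lambda>u. (\<bar>a\<bar> / d) ^ n * damped c g u)" using int by simp
  show "AE u in lborel. norm (damped c' g u * (a * u) ^ n / fact n)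
      \<le> norm ((\<bar>a\<bar> / d) ^ n * damped c g u)"
  proof (rule AE_I2)
    fix u
    show "norm (damped c' g u * (a * u) ^ n / fact n) \<le> norm ((\<bar>a\<bar> / d) ^ n * damped c g u)"
    proof (cases "u < 0")
      case False
      have "norm (damped c' g u * (a * u) ^ n / fact n) =
          (\<bar>a\<bar> / d) ^ n * \<bar>damped c g u\<bar> * (exp (- (d * u)) * ((d * u) ^ n / fact n))"
        using d False damped_add[of c d g u]
        by (simp add: d_def abs_mult power_abs power_mult_distrib power_divide)
      also have "\<dots> \<le> (\<bar>a\<bar> / d) ^ n * \<bar>damped c g u\<bar> * (exp (- (d * u)) * exp (d * u))"
        using d False by (intro mult_left_mono power_div_fact_le_exp) auto
      finally show ?thesis using d by (simp add: abs_mult flip: exp_add)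
    qed (simp add: damped_def supp)
  qed
qed measurable

lemma dominated_sums_integral:
  fixes f :: "nat \<Rightarrow> 'a \<Rightarrow> 'b::{banach, second_countable_topology}"
  assumes f: "\<And>n. integrable M (f n)" and w: "integrable M w"
    and bound: "\<And>N x. norm (\<Sum>n<N. f n x) \<le> w x" and sums: "\<And>x. (\<lambda>n. f n x) sums S x"
  shows "(\<lambda>n. \<integral>x. f n x \<partial>M) sums (\<integral>x. S x \<partial>M)"
proof -
  have lim: "(\<lambda>N. \<Sum>n<N. f n x) \<longlonglongrightarrow> S x" for x using sums by (simp add: sums_def)
  have [measurable]: "(\<lambda>x. \<Sum>n<N. f n x) \<in> borel_measurable M" for N using f by auto
  have "(\<lambda>N. \<integral>x. (\<Sum>n<N. f n x) \<partial>M) \<longlonglongrightarrow> (\<integral>x. S x \<partial>M)"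
    by (rule integral_dominated_convergence[where w = w])
       (use lim w bound in \<open>auto intro!: borel_measurable_LIMSEQ_metric[OF _ lim]\<close>)
  thus ?thesis unfolding sums_def using f by (simp add: Bochner_Integration.integral_sum)
qed

lemma norm_damped_exp_partial_sum_le:
  assumes supp: "\<And>u. u < 0 \<Longrightarrow> g u = 0" and z: "norm z \<le> r"
  shows "norm (\<Sum>n<N. of_real (damped c g u * (- u) ^ n / fact n) * (z :: complex) ^ n)
      \<le> \<bar>damped (c - r) g u\<bar>"
proof (cases "u < 0")
  case False
  have "norm (of_real (damped c g u * (- u) ^ n / fact n) * z ^ n)
      \<le> \<bar>damped c g u\<bar> * ((r * u) ^ n / fact n)" for n
  proof -
    have "norm (of_real (damped c g u * (- u) ^ n / fact n) * z ^ n)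
        = \<bar>damped c g u\<bar> * ((norm z * u) ^ n / fact n)"
      using False by (simp add: norm_mult norm_divide norm_power power_mult_distrib power_abs abs_mult
          del: of_real_mult)
    also have "\<dots> \<le> \<bar>damped c g u\<bar> * ((r * u) ^ n / fact n)"
      using z False by (intro mult_left_mono divide_right_mono power_mono mult_right_mono) auto
    finally show ?thesis .
  qed
  hence "norm (\<Sum>n<N. of_real (damped c g u * (- u) ^ n / fact n) * z ^ n)
      \<le> (\<Sum>n<N. \<bar>damped c g u\<bar> * ((r * u) ^ n / fact n))"
    by (rule sum_norm_le)
  also have "\<dots> \<le> \<bar>damped c g u\<bar> * exp (r * u)"
    unfolding sum_distrib_left[symmetric] using order.trans[OF norm_ge_zero z] False
    by (intro mult_left_mono exp_partial_sum_le) auto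
  finally show ?thesis by (simp add: damped_diff abs_mult)
qed (simp add: damped_def supp)

lemma laplace_sums:
  assumes meas [measurable]: "g \<in> borel_measurable borel" and supp: "\<And>u. u < 0 \<Longrightarrow> g u = 0"
    and int: "integrable lborel (damped (c - r) g)" and r: "r > 0" and s: "norm (s - of_real c) \<le> r"
  shows "(\<lambda>n. of_real (laplace_coeff g c n) * (s - of_real c) ^ n) sums laplace g s"
proof -
  define f where "f n u = of_real (damped c g u * (- u) ^ n / fact n) * (s - of_real c) ^ n" for n u
  have "(\<lambda>n. \<integral>u. f n u \<partial>lborel) sums (\<integral>u. of_real (g u) * exp (- (s * of_real u)) \<partial>lborel)"
  proof (rule dominated_sums_integral)
    show "integrable lborel (f n)" for n
      unfolding f_def using integrable_damped_power[OF meas supp int, of c "-1" n] r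
      by (intro integrable_mult_left complex_of_real_integrable_eq[THEN iffD2]) simp
    show "integrable lborel (\<lambda>u. \<bar>damped (c - r) g u\<bar>)" using int by simp
    show "norm (\<Sum>n<N. f n u) \<le> \<bar>damped (c - r) g u\<bar>" for N u
      unfolding f_def by (rule norm_damped_exp_partial_sum_le[OF supp s])
    show "(\<lambda>n. f n u) sums (of_real (g u) * exp (- (s * of_real u)))" for u
    proof -
      have "(\<lambda>n. of_real (damped c g u) * ((- of_real u * (s - of_real c)) ^ n /\<^sub>R fact n))
          sums (of_real (damped c g u) * exp (- of_real u * (s - of_real c)))"
        by (intro sums_mult exp_converges)
      moreover have "of_real (damped c g u) * exp (- of_real u * (s - of_real c)) =
          of_real (g u) * exp (- (s * of_real u))"
        by (simp add: damped_def algebra_simps flip: exp_of_real exp_add)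
      moreover have "of_real (damped c g u) * ((- of_real u * (s - of_real c)) ^ n /\<^sub>R fact n)
          = f n u" for n
        unfolding power_mult_distrib by (simp add: f_def scaleR_conv_of_real field_simps)
      ultimately show ?thesis by simp
    qed
  qed
  thus ?thesis
    by (simp only: f_def laplace_def laplace_coeff_def integral_mult_left_zero integral_complex_of_real)
qed

text \<open>For nonnegative \<open>g\<close> the Taylor coefficients alternate in sign, so to the left of \<open>c\<close> the series has
  nonnegative terms and may be summed under the integral.\<close>

lemma integrable_damped_of_summable:
  assumes meas [measurable]: "g \<in> borel_measurable borel" and supp: "\<And>u. u < 0 \<Longrightarrow> g u = 0"
    and nonneg: "\<And>u. g u \<ge> 0" and int: "integrable lborel (damped c0 g)" "c0 < c" and r: "r \<ge> 0"
    and summable: "summable (\<lambda>n. laplace_coeff g c n * (- r) ^ n)"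
  shows "integrable lborel (damped (c - r) g)"
proof -
  define f where "f n u = damped c g u * (r * u) ^ n / fact n" for n u
  have f_nonneg: "f n u \<ge> 0" for n u
    using nonneg[of u] supp[of u] r by (cases "u < 0") (auto simp: f_def damped_def)
  have f_sums: "(\<lambda>n. f n u) sums damped (c - r) g u" for u
    using sums_mult[OF exp_converges[of "r * u"], of "damped c g u"]
    by (simp add: f_def damped_diff divide_inverse mult_ac)
  have f_int: "integrable lborel (f n)" for n
    unfolding f_def by (rule integrable_damped_power[OF meas supp int])
  have coeff: "(\<integral>u. f n u \<partial>lborel) = laplace_coeff g c n * (- r) ^ n" for n
    unfolding laplace_coeff_def integral_mult_left_zero[symmetric]
    by (intro Bochner_Integration.integral_cong) (simp_all add: f_def mult.commute flip: power_mult_distrib)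
  have "(\<integral>\<^sup>+u. ennreal (damped (c - r) g u) \<partial>lborel) = (\<integral>\<^sup>+u. (\<Sum>n. ennreal (f n u)) \<partial>lborel)"
    using f_sums f_nonneg by (intro nn_integral_cong) (simp add: suminf_ennreal2 sums_iff)
  also have "\<dots> = (\<Sum>n. ennreal (\<integral>u. f n u \<partial>lborel))"
    using f_int f_nonneg by (subst nn_integral_suminf) (auto simp: nn_integral_eq_integral)
  also have "\<dots> < \<infinity>"
    using summable f_nonneg by (simp add: coeff[symmetric] less_top ennreal_suminf_neq_top)
  finally show ?thesis
    using nonneg by (intro integrableI_nonneg) (auto simp: damped_def)
qed

lemma laplace_coeff_eq_higher_deriv:
  assumes meas: "g \<in> borel_measurable borel" and supp: "\<And>u. u < 0 \<Longrightarrow> g u = 0"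
    and int: "integrable lborel (damped (c - r) g)" and r: "r > 0"
    and hol: "N holomorphic_on ball (of_real c) r"
    and eq: "\<And>s. s \<in> ball (of_real c) r \<Longrightarrow> N s = laplace g s"
  shows "of_real (laplace_coeff g c n) = (deriv ^^ n) N (of_real c) / fact n"
proof -
  let ?F = "Abs_fps (\<lambda>n. complex_of_real (laplace_coeff g c n))"
  have "(\<lambda>z. N (of_real c + z)) has_fps_expansion ?F"
  proof (rule has_fps_expansionI)
    have "(\<lambda>n. fps_nth ?F n * z ^ n) sums N (of_real c + z)" if "z \<in> ball 0 r" for z
      using laplace_sums[OF meas supp int r, of "of_real c + z"] eq[of "of_real c + z"] that
      by (simp add: dist_norm)
    thus "\<forall>\<^sub>F z in nhds 0. (\<lambda>n. fps_nth ?F n * z ^ n) sums N (of_real c + z)"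
      using r by (intro eventually_nhds_in_open[of "ball 0 r", THEN eventually_mono]) auto
  qed
  moreover have "(\<lambda>z. N (of_real c + z)) has_fps_expansion fps_expansion N (of_real c)"
    using hol r
    by (intro analytic_at_imp_has_fps_expansion)
       (auto simp: analytic_at intro!: exI[of _ "ball (of_real c) r"])
  ultimately have "?F = fps_expansion N (of_real c)" by (rule fps_expansion_unique_complex)
  thus ?thesis by (simp add: fps_eq_iff fps_expansion_def)
qed

lemma landau_laplace_disc:
  assumes meas: "g \<in> borel_measurable borel" and supp: "\<And>u. u < 0 \<Longrightarrow> g u = 0"
    and nonneg: "\<And>u. g u \<ge> 0"
    and hol: "N holomorphic_on ball (of_real c) R" and r0: "r0 > 0" "r0 \<le> R"
    and int: "integrable lborel (damped (c - r0) g)"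
    and eq: "\<And>s. s \<in> ball (of_real c) r0 \<Longrightarrow> N s = laplace g s"
    and s: "s \<in> ball (of_real c) R"
  shows "integrable lborel (damped (Re s) g)" and "N s = laplace g s"
proof -
  have "norm (s - of_real c) < R" using s by (simp add: dist_norm norm_minus_commute)
  then obtain r where "norm (s - of_real c) < r" "r < R" using dense by blast
  hence r: "norm (s - of_real c) \<le> r" "0 < r" "r < R"
    using norm_ge_zero[of "s - of_real c"] by linarith+
  have coeff: "of_real (laplace_coeff g c n) = (deriv ^^ n) N (of_real c) / fact n" for n
    by (rule laplace_coeff_eq_higher_deriv[OF meas supp int r0(1) holomorphic_on_subset[OF hol] eq])
       (use r0 in auto)
  have taylor: "(\<lambda>n. of_real (laplace_coeff g c n) * (w - of_real c) ^ n) sums N w"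
    if "w \<in> ball (of_real c) R" for w
    unfolding coeff by (rule holomorphic_power_series[OF hol that])
  have "(\<lambda>n. of_real (laplace_coeff g c n) * (of_real (c - r) - of_real c) ^ n)
      sums N (of_real (c - r))"
    using r by (intro taylor) (simp add: dist_norm)
  hence "summable (\<lambda>n. complex_of_real (laplace_coeff g c n * (- r) ^ n))"
    by (simp add: sums_iff)
  hence int_r: "integrable lborel (damped (c - r) g)"
    using r0(1) r(2) by (intro integrable_damped_of_summable[OF meas supp nonneg int])
      (auto simp only: summable_of_real_iff)
  have "c - r \<le> Re s" using r(1) abs_Re_le_cmod[of "s - of_real c"] by simp
  thus "integrable lborel (damped (Re s) g)" by (intro integrable_damped_mono[OF meas supp int_r])
  show "N s = laplace g s"
    using laplace_sums[OF meas supp int_r r(2,1)] taylor[OF s] by (rule sums_unique2[symmetric])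
qed

lemma half_plane_obtains_disc:
  assumes "Re s > b"
  obtains c where "c > a" "c > b" "s \<in> ball (of_real c) (c - b)"
proof -
  define q where "q = ((Re s)\<^sup>2 + (Im s)\<^sup>2 - b\<^sup>2) / (2 * (Re s - b))"
  define c where "c = max q (max a b) + 1"
  have "q < c" by (simp add: c_def)
  hence "(Re s)\<^sup>2 + (Im s)\<^sup>2 - b\<^sup>2 < c * (2 * (Re s - b))"
    using assms by (simp add: q_def divide_less_eq)
  hence "(norm (s - of_real c))\<^sup>2 < (c - b)\<^sup>2"
    unfolding cmod_power2 by (simp add: power2_eq_square algebra_simps)
  hence "norm (s - of_real c) < c - b" by (rule power2_less_imp_less) (simp add: c_def)
  hence "s \<in> ball (of_real c) (c - b)" by (simp add: dist_norm norm_minus_commute)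
  thus ?thesis by (rule that[rotated 2]) (auto simp: c_def)
qed

theorem landau_laplace:
  assumes meas: "g \<in> borel_measurable borel" and supp: "\<And>u. u < 0 \<Longrightarrow> g u = 0"
    and nonneg: "\<And>u. g u \<ge> 0"
    and hol: "N holomorphic_on {s. Re s > b}"
    and int: "\<And>c. c > c0 \<Longrightarrow> integrable lborel (damped c g)"
    and eq: "\<And>s. Re s > c0 \<Longrightarrow> N s = laplace g s"
    and s: "Re s > b"
  shows "integrable lborel (damped (Re s) g)" and "N s = laplace g s"
proof -
  obtain c where c: "c > c0" "c > b" "s \<in> ball (of_real c) (c - b)"
    using half_plane_obtains_disc[OF s] by blast
  define r where "r = min ((c - c0) / 2) (c - b)"
  have r: "r > 0" "r \<le> c - b" "c - r > c0"
    using c(1,2) by (auto simp: r_def min_def field_simps)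
  have sub: "ball (of_real c) \<rho> \<subseteq> {s. Re s > c - \<rho>}" for \<rho>
  proof
    fix w assume "w \<in> ball (complex_of_real c) \<rho>"
    thus "w \<in> {s. Re s > c - \<rho>}" using abs_Re_le_cmod[of "of_real c - w"] by (auto simp: dist_norm)
  qed
  have hol': "N holomorphic_on ball (of_real c) (c - b)"
    using sub[of "c - b"] by (intro holomorphic_on_subset[OF hol]) simp
  have eq': "N w = laplace g w" if "w \<in> ball (of_real c) r" for w
    using sub[of r] that r(3) by (intro eq) auto
  note disc = landau_laplace_disc[OF meas supp nonneg hol' r(1,2) int[OF r(3)] eq' c(3)]
  show "integrable lborel (damped (Re s) g)" by (rule disc(1))
  show "N s = laplace g s" by (rule disc(2))
qed

section \<open>The Laplace transform of a square in the logarithmic variable\<close>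

definition log_square :: "(real \<Rightarrow> real) \<Rightarrow> real \<Rightarrow> real" where
  "log_square E u = (if u > 0 then (E (exp u))\<^sup>2 else 0)"

lemma log_square_nonneg: "log_square E u \<ge> 0"
  and log_square_nonpos: "u \<le> 0 \<Longrightarrow> log_square E u = 0"
  by (simp_all add: log_square_def)

lemma continuous_on_compose_exp:
  fixes E :: "real \<Rightarrow> 'a::topological_space"
  shows "continuous_on {0<..} E \<Longrightarrow> continuous_on A (\<lambda>u. E (exp u))"
  by (rule continuous_on_compose2) (auto intro!: continuous_intros)

lemma log_square_measurable:
  assumes "continuous_on {0<..} E"
  shows "log_square E \<in> borel_measurable borel"
proof -
  have [measurable]: "(\<lambda>u. E (exp u)) \<in> borel_measurable borel"
    by (intro borel_measurable_continuous_onI continuous_on_compose_exp assms)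
  show ?thesis unfolding log_square_def[abs_def] by measurable
qed

lemma set_integrable_exp_bound:
  fixes f :: "real \<Rightarrow> 'a::{banach, second_countable_topology}"
  assumes "continuous_on {0<..} f" and "d > 0"
    and "\<And>u. u > 0 \<Longrightarrow> norm (f u) \<le> C * exp (- (d * u))"
  shows "set_integrable lborel {0<..} f"
proof (rule set_integrable_bound)
  show "set_integrable lborel {0<..} (\<lambda>u. C * exp (- (u * d)))"
    using integrable_I0i_exp_mscale[OF assms(2)] by (rule set_integrable_mult_right)
  show "set_borel_measurable lborel {0<..} f"
    using borel_measurable_continuous_on_indicator[OF _ assms(1)]
    by (simp add: set_borel_measurable_def)
  show "AE u in lborel. u \<in> {0<..} \<longrightarrow> norm (f u) \<le> norm (C * exp (- (u * d)))"
  proof (intro AE_I2 impI)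
    fix u :: real assume "u \<in> {0<..}"
    hence "norm (f u) \<le> C * exp (- (u * d))" using assms(3)[of u] by (simp add: mult.commute)
    also have "\<dots> \<le> norm (C * exp (- (u * d)))" by simp
    finally show "norm (f u) \<le> norm (C * exp (- (u * d)))" .
  qed
qed

lemma set_integrable_powr_atLeast:
  assumes "e < -1"
  shows "set_integrable lborel {1<..} (\<lambda>x::real. x powr e)"
proof -
  have "(\<lambda>x::real. x powr e) integrable_on {1..}"
    using has_integral_powr_to_inf[OF assms, of 1] by auto
  hence "(\<lambda>x::real. x powr e) absolutely_integrable_on {1..}"
    by (rule nonnegative_absolutely_integrable_1) auto
  hence "(\<lambda>x::real. x powr e) absolutely_integrable_on {1<..}"
    by (rule set_integrable_subset) auto
  thus ?thesis unfolding set_integrable_def by (subst (asm) integrable_completion) auto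
qed

lemma set_integral_exp_substitution:
  fixes f :: "real \<Rightarrow> 'a::euclidean_space"
  assumes f: "continuous_on {0<..} f" and e: "e < -1"
    and bound: "\<And>x. x \<ge> 1 \<Longrightarrow> norm (f x) \<le> C * x powr e"
  shows "set_integrable lborel {1<..} f"
    and "set_integrable lborel {0<..} (\<lambda>u. exp u *\<^sub>R f (exp u))"
    and "(LBINT x:{1<..}. f x) = (LBINT u:{0<..}. exp u *\<^sub>R f (exp u))"
proof -
  show int: "set_integrable lborel {1<..} f"
  proof (rule set_integrable_bound)
    show "set_integrable lborel {1<..} (\<lambda>x. C * x powr e)"
      by (intro set_integrable_mult_right set_integrable_powr_atLeast e)
    have "continuous_on {1<..} f" by (rule continuous_on_subset[OF f]) auto
    thus "set_borel_measurable lborel {1<..} f"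
      using borel_measurable_continuous_on_indicator[of "{1<..}" f]
      by (simp add: set_borel_measurable_def)
    show "AE x in lborel. x \<in> {1<..} \<longrightarrow> norm (f x) \<le> norm (C * x powr e)"
      using bound by (auto intro!: order.trans[OF bound abs_ge_self])
  qed
  show int_exp: "set_integrable lborel {0<..} (\<lambda>u. exp u *\<^sub>R f (exp u))"
  proof (rule set_integrable_exp_bound[where d = "- e - 1" and C = C])
    show "continuous_on {0<..} (\<lambda>u. exp u *\<^sub>R f (exp u))"
      by (intro continuous_intros continuous_on_compose_exp f)
    show "norm (exp u *\<^sub>R f (exp u)) \<le> C * exp (- ((- e - 1) * u))" if "u > 0" for u
      using mult_left_mono[OF bound[of "exp u"], of "exp u"] that
      by (simp add: powr_def algebra_simps flip: exp_add)
  qed (use e in simp)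
  have "(LBINT x=ereal 1..\<infinity>. f x) = (LBINT u=ereal 0..\<infinity>. exp u *\<^sub>R f (exp u))"
  proof (rule interval_integral_substitution_integrable)
    show "isCont f (exp x)" for x
      using f by (simp add: continuous_on_eq_continuous_at)
    show "((ereal \<circ> exp \<circ> real_of_ereal) \<longlongrightarrow> ereal 1) (at_right (ereal 0))"
      unfolding ereal_tendsto_simps by (auto intro!: tendsto_eq_intros)
    show "((ereal \<circ> exp \<circ> real_of_ereal) \<longlongrightarrow> \<infinity>) (at_left \<infinity>)"
      unfolding ereal_tendsto_simps by (rule exp_at_top)
  qed (use int int_exp in \<open>auto intro!: derivative_eq_intros\<close>)
  thus "(LBINT x:{1<..}. f x) = (LBINT u:{0<..}. exp u *\<^sub>R f (exp u))"
    unfolding interval_integral_to_infinity_eq .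
qed

lemma of_real_powr_eq_exp: "x > 0 \<Longrightarrow> of_real x powr s = exp (s * of_real (ln x) :: complex)"
  by (simp add: powr_def Ln_of_real)

lemma laplace_log_square_eq_set_integral:
  "laplace (log_square E) s = (LBINT u:{0<..}. of_real ((E (exp u))\<^sup>2) * exp (- (s * of_real u)))"
  unfolding laplace_def set_lebesgue_integral_def
  by (intro Bochner_Integration.integral_cong) (auto simp: log_square_def indicator_def)

lemma norm_log_square_kernel_le:
  assumes "(E (exp u))\<^sup>2 \<le> C * exp u ^ n"
  shows "norm (of_real ((E (exp u))\<^sup>2) * exp (- (s * of_real u)) :: complex)
      \<le> C * exp (- ((Re s - real n) * u))"
  using mult_right_mono[OF assms, of "exp (- (Re s * u))"]
  by (simp add: norm_mult norm_power algebra_simps flip: exp_of_nat_mult exp_add)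

lemma integrable_damped_log_square:
  assumes E: "continuous_on {0<..} E" and bound: "\<And>x. x \<ge> 1 \<Longrightarrow> (E x)\<^sup>2 \<le> C * x ^ n" and c: "c > real n"
  shows "integrable lborel (damped c (log_square E))"
proof -
  have "set_integrable lborel {0<..} (\<lambda>u. (E (exp u))\<^sup>2 * exp (- (c * u)))"
  proof (rule set_integrable_exp_bound[where d = "c - real n" and C = C])
    show "continuous_on {0<..} (\<lambda>u. (E (exp u))\<^sup>2 * exp (- (c * u)))"
      by (intro continuous_intros continuous_on_compose_exp E)
    show "norm ((E (exp u))\<^sup>2 * exp (- (c * u))) \<le> C * exp (- ((c - real n) * u))" if "u > 0" for u
      using norm_log_square_kernel_le[of E u C n "of_real c"] bound[of "exp u"] that
      by (simp add: norm_mult norm_power)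
  qed (use c in simp)
  moreover have "indicator {0<..} u *\<^sub>R ((E (exp u))\<^sup>2 * exp (- (c * u)))
      = damped c (log_square E) u" for u
    by (simp add: damped_def log_square_def indicator_def)
  ultimately show ?thesis unfolding set_integrable_def by simp
qed

lemma log_square_kernel_has_vector_derivative:
  fixes s :: complex
  assumes "(E has_real_derivative E') (at (exp u))"
  shows "((\<lambda>u. of_real ((E (exp u))\<^sup>2) * exp (- (s * of_real u))) has_vector_derivative
    (2 * (of_real (exp u * E' * E (exp u)) * exp (- (s * of_real u)))
      - s * (of_real ((E (exp u))\<^sup>2) * exp (- (s * of_real u))))) (at u)"
proof -
  have "((\<lambda>u. E (exp u)) has_real_derivative E' * exp u) (at u)"
    by (rule DERIV_chain2[OF assms DERIV_exp])
  hence "((\<lambda>u. (E (exp u))\<^sup>2) has_real_derivative 2 * (exp u * E' * E (exp u))) (at u)"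
    by (auto intro!: derivative_eq_intros)
  hence square: "((\<lambda>u. of_real ((E (exp u))\<^sup>2)) has_vector_derivative
      complex_of_real (2 * (exp u * E' * E (exp u)))) (at u)"
    by (intro has_vector_derivative_of_real) (simp add: has_real_derivative_iff_has_vector_derivative)
  have "((\<lambda>z. exp (- (s * z))) has_field_derivative (- s * exp (- (s * of_real u)))) (at (of_real u))"
    by (auto intro!: derivative_eq_intros)
  hence kernel: "((\<lambda>u. exp (- (s * of_real u)))
      has_vector_derivative (- s * exp (- (s * of_real u)))) (at u)"
    by (rule has_vector_derivative_real_field)
  show ?thesis
    by (rule has_vector_derivative_eq_rhs[OF has_vector_derivative_mult[OF square kernel]])
       (simp add: algebra_simps)
qed

lemma laplace_log_square_by_parts:
  assumes deriv: "\<And>x. x > 0 \<Longrightarrow> (E has_real_derivative E' x) (at x)" and E': "continuous_on {0<..} E'"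
    and bound: "\<And>x. x \<ge> 1 \<Longrightarrow> (E x)\<^sup>2 \<le> C * x ^ n" and s: "Re s > real n"
    and int: "set_integrable lborel {0<..} (\<lambda>u. of_real (exp u * E' (exp u) * E (exp u))
        * exp (- (s * of_real u)))"
  shows "2 * (LBINT u:{0<..}. of_real (exp u * E' (exp u) * E (exp u)) * exp (- (s * of_real u)))
    = s * laplace (log_square E) s - of_real ((E 1)\<^sup>2)"
proof -
  define F where "F u = of_real ((E (exp u))\<^sup>2) * exp (- (s * complex_of_real u))" for u
  define p where
    "p u = of_real (exp u * E' (exp u) * E (exp u)) * exp (- (s * complex_of_real u))" for u
  have E: "continuous_on {0<..} E"
    by (rule DERIV_continuous_on[OF has_field_derivative_at_within[OF deriv]]) simp
  have cont: "continuous_on UNIV F" "continuous_on UNIV p"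
    unfolding F_def p_def
    by (intro continuous_intros continuous_on_compose_exp E E')+
  have F_le: "norm (F u) \<le> C * exp (- ((Re s - real n) * u))" if "u \<ge> 0" for u
    unfolding F_def using that by (intro norm_log_square_kernel_le bound) simp
  have F_int: "set_integrable lborel {0<..} F"
    using F_le s by (intro set_integrable_exp_bound[where d = "Re s - real n" and C = C]
        continuous_on_subset[OF cont(1)]) auto
  have p_int: "set_integrable lborel {0<..} p" using int unfolding p_def .
  have "(LBINT u=ereal 0..\<infinity>. 2 * p u - s * F u) = 0 - of_real ((E 1)\<^sup>2)"
  proof (rule interval_integral_FTC_integrable)
    show "(F has_vector_derivative (2 * p u - s * F u)) (at u)" for u
      unfolding F_def p_def by (rule log_square_kernel_has_vector_derivative) (simp add: deriv)
    show "isCont (\<lambda>u. 2 * p u - s * F u) u" for u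
      using cont by (intro continuous_intros) (simp_all add: continuous_on_eq_continuous_at)
    have "(F \<longlongrightarrow> F 0) (at_right 0)"
      using cont(1) by (auto simp: continuous_on_def intro: tendsto_within_subset)
    thus "((F \<circ> real_of_ereal) \<longlongrightarrow> of_real ((E 1)\<^sup>2)) (at_right (ereal 0))"
      unfolding ereal_tendsto_simps by (simp add: F_def)
    have "((\<lambda>u. C * exp (- ((Re s - real n) * u))) \<longlongrightarrow> 0) at_top"
      using s by real_asymp
    moreover have "\<forall>\<^sub>F u in at_top. norm (F u) \<le> C * exp (- ((Re s - real n) * u))"
      using eventually_ge_at_top[of 0] by eventually_elim (rule F_le)
    ultimately show "((F \<circ> real_of_ereal) \<longlongrightarrow> 0) (at_left \<infinity>)"
      unfolding ereal_tendsto_simps by (rule Lim_null_comparison[rotated])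
  qed (use F_int p_int in auto)
  hence "2 * (LBINT u:{0<..}. p u) - s * (LBINT u:{0<..}. F u) = - of_real ((E 1)\<^sup>2)"
    using F_int p_int unfolding interval_integral_to_infinity_eq by (subst (asm) set_integral_diff) auto
  thus ?thesis
    unfolding laplace_log_square_eq_set_integral by (simp add: F_def p_def algebra_simps)
qed

lemma integral_mult_deriv_powr_eq_laplace:
  assumes deriv: "\<And>x. x > 0 \<Longrightarrow> (E has_real_derivative E' x) (at x)" and E': "continuous_on {0<..} E'"
    and bound: "\<And>x. x \<ge> 1 \<Longrightarrow> (E x)\<^sup>2 \<le> C * x ^ n" "\<And>x. x \<ge> 1 \<Longrightarrow> \<bar>E' x * E x\<bar> \<le> D * x ^ m"
    and s: "Re s > real n" "Re s > real m + 1"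
  shows "integral {1..} (\<lambda>x. of_real (E' x * E x) * of_real x powr (-s))
    = (s * laplace (log_square E) s - of_real ((E 1)\<^sup>2)) / 2"
proof -
  define f where "f x = of_real (E' x * E x) * (of_real x powr (-s) :: complex)" for x
  have "continuous_on {0<..} E"
    by (rule DERIV_continuous_on[OF has_field_derivative_at_within[OF deriv]]) simp
  hence f_cont: "continuous_on {0<..} f"
    unfolding f_def using E' by (intro continuous_intros) (auto simp: complex_nonpos_Reals_iff)
  have f_le: "norm (f x) \<le> D * x powr (real m - Re s)" if "x \<ge> 1" for x
  proof -
    have "norm (f x) = \<bar>E' x * E x\<bar> * x powr (- Re s)"
      using that by (simp add: f_def norm_mult norm_powr_real_powr abs_mult del: of_real_mult)
    also have "\<dots> \<le> (D * x ^ m) * x powr (- Re s)"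
      by (intro mult_right_mono bound(2) that) simp
    also have "\<dots> = D * x powr (real m - Re s)"
      using that by (simp add: powr_diff powr_minus powr_realpow divide_inverse)
    finally show ?thesis .
  qed
  have f_exp: "exp u *\<^sub>R f (exp u)
      = of_real (exp u * E' (exp u) * E (exp u)) * exp (- (s * of_real u))" for u
    by (simp add: f_def of_real_powr_eq_exp scaleR_conv_of_real)
  have int: "set_integrable lborel {1<..} f"
    and int_exp: "set_integrable lborel {0<..} (\<lambda>u. exp u *\<^sub>R f (exp u))"
    and subst: "(LBINT x:{1<..}. f x) = (LBINT u:{0<..}. exp u *\<^sub>R f (exp u))"
    using set_integral_exp_substitution[OF f_cont _ f_le] s(2) by auto
  have "integral {1..} f = integral {1<..} f"
    by (rule integral_spike_set) (auto intro: negligible_subset[of "{1}"])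
  also have "\<dots> = (LBINT x:{1<..}. f x)"
    by (rule set_borel_integral_eq_integral(2)[OF int, symmetric])
  also have "\<dots> = (s * laplace (log_square E) s - of_real ((E 1)\<^sup>2)) / 2"
    using laplace_log_square_by_parts[OF deriv E' bound(1) s(1) int_exp[unfolded f_exp]]
    unfolding subst f_exp by (simp add: field_simps)
  finally show ?thesis unfolding f_def .
qed

lemma poly_bounded_on_atLeast_oneE:
  fixes f :: "real \<Rightarrow> real"
  assumes "f poly_bounded_on {1..}"
  obtains C n where "C \<ge> 0" "\<And>x. x \<ge> 1 \<Longrightarrow> \<bar>f x\<bar> \<le> C * x ^ n"
proof -
  obtain C n where C: "C \<ge> 0" "\<And>x. x \<in> {1..} \<Longrightarrow> norm (f x) \<le> C * (1 + norm x) ^ n"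
    using assms by (rule poly_bounded_onE) blast
  show ?thesis
  proof (rule that)
    show "C * 2 ^ n \<ge> 0" using C(1) by simp
    fix x :: real assume x: "x \<ge> 1"
    have "\<bar>f x\<bar> \<le> C * (1 + x) ^ n" using C(2)[of x] x by simp
    also have "\<dots> \<le> C * (2 * x) ^ n" using C(1) x by (intro mult_left_mono power_mono) auto
    finally show "\<bar>f x\<bar> \<le> C * 2 ^ n * x ^ n" by (simp add: power_mult_distrib)
  qed
qed

lemma K_integral_eq_laplace:
  obtains c0 where "\<And>c. c > c0 \<Longrightarrow> integrable lborel (damped c (log_square (E2 P)))"
    and "\<And>s. Re s > c0 \<Longrightarrow> K_integral P s
        = (s * laplace (log_square (E2 P)) s - of_real ((E2 P 1)\<^sup>2)) / 2"
proof -
  have "(\<lambda>x. (E2 P x)\<^sup>2) poly_bounded_on {1..}"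
    by (intro poly_bounded_intros poly_bounded_on_E2)
  then obtain C n where C: "\<And>x. x \<ge> 1 \<Longrightarrow> \<bar>(E2 P x)\<^sup>2\<bar> \<le> C * x ^ n"
    by (rule poly_bounded_on_atLeast_oneE) blast
  have "(\<lambda>x. E2_deriv P x * E2 P x) poly_bounded_on {1..}"
    by (intro poly_bounded_intros poly_bounded_on_E2 poly_bounded_on_E2_deriv)
  then obtain D m where D: "\<And>x. x \<ge> 1 \<Longrightarrow> \<bar>E2_deriv P x * E2 P x\<bar> \<le> D * x ^ m"
    by (rule poly_bounded_on_atLeast_oneE) blast
  show ?thesis
  proof (rule that[of "real n + real m + 1"])
    show "integrable lborel (damped c (log_square (E2 P)))" if "c > real n + real m + 1" for c
      using C that by (intro integrable_damped_log_square[where C = C and n = n] continuous_on_E2) auto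
    show "K_integral P s = (s * laplace (log_square (E2 P)) s - of_real ((E2 P 1)\<^sup>2)) / 2"
      if "Re s > real n + real m + 1" for s
      unfolding K_integral_def E2_deriv_def[symmetric]
      by (rule integral_mult_deriv_powr_eq_laplace[where C = C and n = n and D = D and m = m])
         (use C D that in \<open>auto intro: E2_has_real_derivative continuous_on_E2_deriv\<close>)
  qed
qed

lemma laplace_log_square_E2:
  assumes K: "K holomorphic_on {s. Re s > 1}" "\<And>s. Re s > 5/3 \<Longrightarrow> K s = K_integral P s"
    and s: "Re s > 1"
  shows "integrable lborel (damped (Re s) (log_square (E2 P)))"
    and "laplace (log_square (E2 P)) s = (2 * K s + of_real ((E2 P 1)\<^sup>2)) / s"
proof -
  obtain c0 where c0: "\<And>c. c > c0 \<Longrightarrow> integrable lborel (damped c (log_square (E2 P)))"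
      "\<And>s. Re s > c0 \<Longrightarrow> K_integral P s = (s * laplace (log_square (E2 P)) s - of_real ((E2 P 1)\<^sup>2)) / 2"
    using K_integral_eq_laplace[of P] by blast
  define N where "N s = (2 * K s + of_real ((E2 P 1)\<^sup>2)) / s" for s
  have nz: "s \<noteq> 0" if "Re s > 1" for s using that by auto
  have hol: "N holomorphic_on {s. Re s > 1}"
    unfolding N_def by (intro holomorphic_intros K(1)) (use nz in auto)
  have eq: "N s = laplace (log_square (E2 P)) s" if "Re s > max c0 (5/3)" for s
    using c0(2)[of s] K(2)[of s] nz[of s] that by (simp add: N_def field_simps)
  have int: "integrable lborel (damped c (log_square (E2 P)))" if "c > max c0 (5/3)" for c
    using that by (intro c0) simp
  note landau = landau_laplace[OF log_square_measurable[OF continuous_on_E2] log_square_nonpos[OF less_imp_le]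
      log_square_nonneg hol int eq s]
  show "integrable lborel (damped (Re s) (log_square (E2 P)))" by (rule landau(1))
  have "N s = laplace (log_square (E2 P)) s" by (rule landau(2))
  thus "laplace (log_square (E2 P)) s = (2 * K s + of_real ((E2 P 1)\<^sup>2)) / s" by (simp add: N_def)
qed

lemma fourier_damped_log_square_E2:
  assumes "K holomorphic_on {s. Re s > 1}" "\<And>s. Re s > 5/3 \<Longrightarrow> K s = K_integral P s" "\<sigma> > 1"
  shows "fourier (damped \<sigma> (log_square (E2 P))) t
      = (2 * K (Complex \<sigma> t) + of_real ((E2 P 1)\<^sup>2)) / Complex \<sigma> t"
  using laplace_log_square_E2(2)[OF assms(1,2), of "Complex \<sigma> t"] assms(3)
  by (simp add: laplace_eq_fourier)

section \<open>Fourier transforms and Gaussian smoothing\<close>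

lemma norm_fourier_integral_le: "norm (fourier_integral h x) \<le> (\<integral>t. norm (h t) \<partial>lborel)"
  unfolding fourier_integral_def using integral_norm_bound[of lborel "\<lambda>t. h t * iexp (x * t)"]
  by (simp add: norm_mult)

lemma fourier_integral_measurable [measurable]:
  assumes [measurable]: "h \<in> borel_measurable borel"
  shows "fourier_integral h \<in> borel_measurable borel"
  unfolding fourier_integral_def[abs_def] by measurable

lemma norm_fourier_le: "norm (fourier G t) \<le> (\<integral>u. \<bar>G u\<bar> \<partial>lborel)"
  unfolding fourier_def using norm_fourier_integral_le[of "\<lambda>u. of_real (G u)"] by simp

lemma fourier_measurable [measurable]:
  assumes [measurable]: "G \<in> borel_measurable borel"
  shows "fourier G \<in> borel_measurable borel"
  unfolding fourier_def[abs_def] by measurable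

lemma fourier_minus: "fourier G (- t) = cnj (fourier G t)"
  unfolding fourier_def fourier_integral_def Bochner_Integration.integral_cnj[symmetric]
  by (intro Bochner_Integration.integral_cong) (auto simp: exp_cnj)

lemma borel_measurable_cnj [measurable (raw)]:
  "f \<in> borel_measurable M \<Longrightarrow> (\<lambda>x. cnj (f x)) \<in> borel_measurable M"
  using measurable_compose[of f M borel cnj borel] borel_measurable_continuous_onI[of cnj]
  by (simp add: continuous_on_cnj)

lemma norm_integral_le_nn_integral:
  fixes f :: "'a \<Rightarrow> 'b::{banach, second_countable_topology}"
  shows "ennreal (norm (integral\<^sup>L M f)) \<le> (\<integral>\<^sup>+x. ennreal (norm (f x)) \<partial>M)"
  by (cases "integrable M f") (auto simp: integral_norm_bound_ennreal not_integrable_integral_eq)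

lemma Fubini_product_bound:
  fixes f :: "real \<Rightarrow> real \<Rightarrow> 'a::{banach, second_countable_topology}" and p q :: "real \<Rightarrow> real"
  assumes f [measurable]: "case_prod f \<in> borel_measurable (lborel \<Otimes>\<^sub>M lborel)"
    and p: "integrable lborel p" and q: "integrable lborel q"
    and bound: "\<And>x y. norm (f x y) \<le> p x * q y"
  shows "(\<integral>x. (\<integral>y. f x y \<partial>lborel) \<partial>lborel) = (\<integral>y. (\<integral>x. f x y \<partial>lborel) \<partial>lborel)"
proof -
  have [measurable]: "p \<in> borel_measurable lborel" "q \<in> borel_measurable lborel" using p q by auto
  have "integrable (lborel \<Otimes>\<^sub>M lborel) (\<lambda>(x, y). p x * q y)"
  proof (rule lborel_pair.Fubini_integrable)
    have "integrable lborel (\<lambda>x. \<bar>p x\<bar> * (\<integral>y. \<bar>q y\<bar> \<partial>lborel))"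
      by (intro integrable_mult_left integrable_abs p)
    thus "integrable lborel (\<lambda>x. \<integral>y. norm (case (x, y) of (x, y) \<Rightarrow> p x * q y) \<partial>lborel)"
      by (simp add: abs_mult)
    show "AE x in lborel. integrable lborel (\<lambda>y. case (x, y) of (x, y) \<Rightarrow> p x * q y)"
      using q by auto
  qed measurable
  hence "integrable (lborel \<Otimes>\<^sub>M lborel) (case_prod f)"
    by (rule Bochner_Integration.integrable_bound) (use bound in \<open>auto intro!: order.trans[OF bound]\<close>)
  thus ?thesis by (rule lborel_pair.Fubini_integral[symmetric])
qed

lemma nn_integral_schur:
  fixes h :: "real \<Rightarrow> 'a::{real_normed_vector, second_countable_topology}" and k :: "real \<Rightarrow> real"
  assumes [measurable]: "h \<in> borel_measurable borel" "k \<in> borel_measurable borel"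
    and k: "\<And>x. k x \<ge> 0"
  shows "(\<integral>\<^sup>+t. (\<integral>\<^sup>+t'. ennreal (norm (h t) * norm (h t') * k (t - t')) \<partial>lborel) \<partial>lborel)
    \<le> (\<integral>\<^sup>+x. ennreal (k x) \<partial>lborel) * (\<integral>\<^sup>+t. ennreal ((norm (h t))\<^sup>2) \<partial>lborel)"
proof -
  let ?N = "\<lambda>t. ennreal ((norm (h t))\<^sup>2 / 2)" and ?k = "\<lambda>t t'. ennreal (k (t - t'))"
  have row: "(\<integral>\<^sup>+t'. ?k t t' \<partial>lborel) = (\<integral>\<^sup>+x. ennreal (k x) \<partial>lborel)" for t
    using nn_integral_real_affine[of "\<lambda>x. ennreal (k x)" "-1" t] by simp
  have col: "(\<integral>\<^sup>+t. ?k t t' \<partial>lborel) = (\<integral>\<^sup>+x. ennreal (k x) \<partial>lborel)" for t'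
    using nn_integral_real_affine[of "\<lambda>x. ennreal (k x)" 1 "- t'"] by (simp add: add.commute)
  have "(\<integral>\<^sup>+t. (\<integral>\<^sup>+t'. ennreal (norm (h t) * norm (h t') * k (t - t')) \<partial>lborel) \<partial>lborel)
      \<le> (\<integral>\<^sup>+t. (\<integral>\<^sup>+t'. ?N t * ?k t t' + ?N t' * ?k t t' \<partial>lborel) \<partial>lborel)"
  proof (intro nn_integral_mono)
    fix t t'
    have "norm (h t) * norm (h t') \<le> (norm (h t))\<^sup>2 / 2 + (norm (h t'))\<^sup>2 / 2"
      using sum_squares_bound[of "norm (h t)" "norm (h t')"] by simp
    hence "ennreal (norm (h t) * norm (h t') * k (t - t'))
        \<le> ennreal (((norm (h t))\<^sup>2 / 2 + (norm (h t'))\<^sup>2 / 2) * k (t - t'))"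
      by (intro ennreal_leI mult_right_mono k)
    also have "\<dots> = ?N t * ?k t t' + ?N t' * ?k t t'"
      by (simp add: k distrib_right flip: ennreal_mult ennreal_plus)
    finally show "ennreal (norm (h t) * norm (h t') * k (t - t')) \<le> ?N t * ?k t t' + ?N t' * ?k t t'" .
  qed
  also have "\<dots> = (\<integral>\<^sup>+t. (\<integral>\<^sup>+t'. ?N t * ?k t t' \<partial>lborel) \<partial>lborel)
      + (\<integral>\<^sup>+t. (\<integral>\<^sup>+t'. ?N t' * ?k t t' \<partial>lborel) \<partial>lborel)"
    by (simp add: nn_integral_add)
  also have "(\<integral>\<^sup>+t. (\<integral>\<^sup>+t'. ?N t' * ?k t t' \<partial>lborel) \<partial>lborel)
      = (\<integral>\<^sup>+t'. (\<integral>\<^sup>+t. ?N t' * ?k t t' \<partial>lborel) \<partial>lborel)"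
    by (rule lborel_pair.Fubini') (simp add: split_beta')
  also have "(\<integral>\<^sup>+t. (\<integral>\<^sup>+t'. ?N t * ?k t t' \<partial>lborel) \<partial>lborel) + \<dots>
      = (\<integral>\<^sup>+x. ennreal (k x) \<partial>lborel) * (\<integral>\<^sup>+t. ?N t + ?N t \<partial>lborel)"
    by (simp add: nn_integral_cmult nn_integral_multc nn_integral_add row col distrib_left mult.commute)
  also have "(\<integral>\<^sup>+t. ?N t + ?N t \<partial>lborel) = (\<integral>\<^sup>+t. ennreal ((norm (h t))\<^sup>2) \<partial>lborel)"
    by (intro nn_integral_cong) (simp flip: ennreal_plus)
  finally show ?thesis .
qed

lemma integrable_weight_norm_square_fourier_integral:
  assumes [measurable]: "h \<in> borel_measurable borel" and w: "integrable lborel w"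
  shows "integrable lborel (\<lambda>u. w u * (norm (fourier_integral h u))\<^sup>2)"
proof (rule Bochner_Integration.integrable_bound)
  have [measurable]: "w \<in> borel_measurable borel" using w by auto
  show "(\<lambda>u. w u * (norm (fourier_integral h u))\<^sup>2) \<in> borel_measurable lborel" by measurable
  show "integrable lborel (\<lambda>u. w u * (\<integral>t. norm (h t) \<partial>lborel)\<^sup>2)" using w by auto
  show "AE u in lborel. norm (w u * (norm (fourier_integral h u))\<^sup>2)
      \<le> norm (w u * (\<integral>t. norm (h t) \<partial>lborel)\<^sup>2)"
    using norm_fourier_integral_le[of h] by (auto simp: abs_mult intro!: mult_left_mono power_mono)
qed

lemma integral_weight_norm_square_fourier_integral:
  fixes h :: "real \<Rightarrow> complex" and w :: "real \<Rightarrow> real"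
  assumes h: "integrable lborel h" and w: "integrable lborel w"
  shows "(\<integral>u. of_real (w u * (norm (fourier_integral h u))\<^sup>2) \<partial>lborel)
    = (\<integral>t. h t * (\<integral>t'. cnj (h t') * fourier_integral (\<lambda>u. of_real (w u)) (t - t') \<partial>lborel) \<partial>lborel)"
proof -
  let ?S = "fourier_integral h" and ?W = "fourier_integral (\<lambda>u. of_real (w u))"
  have [measurable]: "h \<in> borel_measurable borel" "w \<in> borel_measurable borel" using h w by auto
  have inner: "(\<integral>u. of_real (w u) * cnj (?S u) * iexp (u * t) \<partial>lborel)
      = (\<integral>t'. cnj (h t') * ?W (t - t') \<partial>lborel)" for t
  proof -
    have "(\<integral>u. of_real (w u) * cnj (?S u) * iexp (u * t) \<partial>lborel) =
        (\<integral>u. (\<integral>t'. of_real (w u) * iexp (u * t) * cnj (h t' * iexp (u * t')) \<partial>lborel) \<partial>lborel)"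
      unfolding fourier_integral_def
      by (simp only: integral_mult_right_zero Bochner_Integration.integral_cnj mult_ac)
    also have "\<dots>
        = (\<integral>t'. (\<integral>u. of_real (w u) * iexp (u * t) * cnj (h t' * iexp (u * t')) \<partial>lborel) \<partial>lborel)"
      by (rule Fubini_product_bound[where p = "\<lambda>u. \<bar>w u\<bar>" and q = "\<lambda>t'. norm (h t')"])
         (use h w in \<open>auto simp: norm_mult\<close>)
    also have "\<dots> = (\<integral>t'. cnj (h t') * ?W (t - t') \<partial>lborel)"
      unfolding fourier_integral_def integral_mult_right_zero[symmetric]
      by (intro Bochner_Integration.integral_cong refl)
         (simp add: exp_cnj algebra_simps exp_diff exp_minus field_simps)
    finally show ?thesis .
  qed
  have "complex_of_real (w u * (norm (?S u))\<^sup>2) = of_real (w u) * cnj (?S u) * ?S u" for u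
    by (simp only: of_real_mult complex_norm_square mult_ac)
  hence "(\<integral>u. of_real (w u * (norm (?S u))\<^sup>2) \<partial>lborel) =
      (\<integral>u. (\<integral>t. of_real (w u) * cnj (?S u) * (h t * iexp (u * t)) \<partial>lborel) \<partial>lborel)"
    by (simp only: integral_mult_right_zero fourier_integral_def)
  also have "\<dots> = (\<integral>t. (\<integral>u. of_real (w u) * cnj (?S u) * (h t * iexp (u * t)) \<partial>lborel) \<partial>lborel)"
    by (rule Fubini_product_bound[where p = "\<lambda>u. \<bar>w u\<bar> * (\<integral>t. norm (h t) \<partial>lborel)"
        and q = "\<lambda>t. norm (h t)"])
       (use h w norm_fourier_integral_le[of h] in \<open>auto simp: norm_mult intro!: mult_right_mono mult_left_mono\<close>)
  also have "\<dots> = (\<integral>t. h t * (\<integral>t'. cnj (h t') * ?W (t - t') \<partial>lborel) \<partial>lborel)"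
    unfolding inner[symmetric] integral_mult_right_zero[symmetric] by (simp only: mult_ac)
  finally show ?thesis .
qed

lemma nn_integral_weight_norm_square_fourier_integral_le:
  fixes h :: "real \<Rightarrow> complex" and w :: "real \<Rightarrow> real"
  assumes h: "integrable lborel h" and w: "integrable lborel w" "\<And>u. w u \<ge> 0"
  shows "(\<integral>\<^sup>+u. ennreal (w u * (norm (fourier_integral h u))\<^sup>2) \<partial>lborel)
    \<le> (\<integral>\<^sup>+x. ennreal (norm (fourier_integral (\<lambda>u. of_real (w u)) x)) \<partial>lborel)
      * (\<integral>\<^sup>+t. ennreal ((norm (h t))\<^sup>2) \<partial>lborel)"
proof -
  let ?S = "fourier_integral h" and ?W = "fourier_integral (\<lambda>u. of_real (w u))"
  let ?inner = "\<lambda>t. \<integral>t'. cnj (h t') * ?W (t - t') \<partial>lborel"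
  have [measurable]: "h \<in> borel_measurable borel" "w \<in> borel_measurable borel" using h w by auto
  have "(\<integral>\<^sup>+u. ennreal (w u * (norm (?S u))\<^sup>2) \<partial>lborel) = ennreal (\<integral>u. w u * (norm (?S u))\<^sup>2 \<partial>lborel)"
    using w by (intro nn_integral_eq_integral integrable_weight_norm_square_fourier_integral) auto
  also have "\<dots> \<le> ennreal (norm (\<integral>u. complex_of_real (w u * (norm (?S u))\<^sup>2) \<partial>lborel))"
    unfolding integral_complex_of_real by (intro ennreal_leI) simp
  also have "(\<integral>u. complex_of_real (w u * (norm (?S u))\<^sup>2) \<partial>lborel) = (\<integral>t. h t * ?inner t \<partial>lborel)"
    by (rule integral_weight_norm_square_fourier_integral[OF h w(1)])
  also have "ennreal (norm \<dots>) \<le> (\<integral>\<^sup>+t. ennreal (norm (h t * ?inner t)) \<partial>lborel)"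
    by (rule norm_integral_le_nn_integral)
  also have "\<dots>
      \<le> (\<integral>\<^sup>+t. (\<integral>\<^sup>+t'. ennreal (norm (h t) * norm (h t') * norm (?W (t - t'))) \<partial>lborel) \<partial>lborel)"
  proof (rule nn_integral_mono)
    fix t
    have "ennreal (norm (h t * ?inner t))
        = ennreal (norm (\<integral>t'. h t * (cnj (h t') * ?W (t - t')) \<partial>lborel))"
      by (simp only: integral_mult_right_zero)
    also have "\<dots> \<le> (\<integral>\<^sup>+t'. ennreal (norm (h t * (cnj (h t') * ?W (t - t')))) \<partial>lborel)"
      by (rule norm_integral_le_nn_integral)
    finally show "ennreal (norm (h t * ?inner t))
        \<le> (\<integral>\<^sup>+t'. ennreal (norm (h t) * norm (h t') * norm (?W (t - t'))) \<partial>lborel)"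
      by (simp add: norm_mult mult.assoc)
  qed
  also have "\<dots> \<le> (\<integral>\<^sup>+x. ennreal (norm (?W x)) \<partial>lborel) * (\<integral>\<^sup>+t. ennreal ((norm (h t))\<^sup>2) \<partial>lborel)"
    by (rule nn_integral_schur) auto
  finally show ?thesis .
qed

lemma integrable_gauss:
  fixes b :: real
  assumes b: "b \<noteq> 0"
  shows "integrable lborel (\<lambda>t. exp (- (b * t)\<^sup>2 / 2))"
proof -
  have "integrable lborel std_normal_density" using integrable_std_normal_moment[of 0] by simp
  hence "integrable lborel (\<lambda>t. sqrt (2 * pi) * std_normal_density (0 + b * t))"
    by (intro integrable_mult_right lborel_integrable_real_affine b)
  thus ?thesis by (simp add: std_normal_density_def)
qed

lemma fourier_integral_gauss:
  assumes "b > 0"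
  shows "fourier_integral (\<lambda>t. of_real (exp (- (b * t)\<^sup>2 / 2))) x
      = of_real (sqrt (2 * pi) / b * exp (- (x / b)\<^sup>2 / 2))"
proof -
  have "complex_of_real (exp (- (x / b)\<^sup>2 / 2)) = char std_normal_distribution (x / b)"
    by (simp add: char_std_normal_distribution)
  also have "\<dots> = (\<integral>t. of_real (std_normal_density t) * iexp (x / b * t) \<partial>lborel)"
    unfolding char_def by (subst integral_density) (auto simp: scaleR_conv_of_real)
  also have "\<dots>
      = \<bar>b\<bar> *\<^sub>R (\<integral>t. of_real (std_normal_density (0 + b * t)) * iexp (x / b * (0 + b * t)) \<partial>lborel)"
    by (rule lborel_integral_real_affine) (use assms in auto)
  also have "\<dots> = of_real (b / sqrt (2 * pi)) * fourier_integral (\<lambda>t. of_real (exp (- (b * t)\<^sup>2 / 2))) x"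
    unfolding fourier_integral_def integral_mult_right_zero[symmetric] integral_scaleR_right[symmetric]
    using assms
    by (intro Bochner_Integration.integral_cong) (auto simp: std_normal_density_def scaleR_conv_of_real)
  finally show ?thesis using assms by (simp add: field_simps)
qed

lemma integral_gauss: "b > 0 \<Longrightarrow> (\<integral>t. exp (- (b * t)\<^sup>2 / 2) \<partial>lborel) = sqrt (2 * pi) / b"
  using fourier_integral_gauss[of b 0]
  by (simp add: fourier_integral_def integral_complex_of_real flip: of_real_divide)

lemma nn_integral_norm_fourier_integral_gauss:
  assumes b: "b > 0"
  shows "(\<integral>\<^sup>+x. ennreal (norm (fourier_integral (\<lambda>u. of_real (exp (- (b * u)\<^sup>2 / 2))) x)) \<partial>lborel)
      = ennreal (2 * pi)"
proof -
  have "(\<integral>\<^sup>+x. ennreal (norm (fourier_integral (\<lambda>u. of_real (exp (- (b * u)\<^sup>2 / 2))) x)) \<partial>lborel)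
      = (\<integral>\<^sup>+x. ennreal (sqrt (2 * pi) / b * exp (- (x / b)\<^sup>2 / 2)) \<partial>lborel)"
    unfolding fourier_integral_gauss[OF b] norm_of_real using b by simp
  also have "\<dots> = ennreal (sqrt (2 * pi) / b * (sqrt (2 * pi) * b))"
    using b integral_gauss[of "1 / b"] integrable_gauss[of "1 / b"]
    by (subst nn_integral_eq_integral) auto
  finally show ?thesis using b by simp
qed

text \<open>Gaussian weights make the left side a quadratic form in \<open>h\<close> whose kernel has mass \<open>2 * pi\<close>
  whatever the width of the weight, which is then sent to infinity.\<close>

lemma plancherel_le:
  fixes h :: "real \<Rightarrow> complex"
  assumes h: "integrable lborel h"
  shows "(\<integral>\<^sup>+u. ennreal ((norm (fourier_integral h u))\<^sup>2) \<partial>lborel)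
    \<le> ennreal (2 * pi) * (\<integral>\<^sup>+t. ennreal ((norm (h t))\<^sup>2) \<partial>lborel)"
proof (rule LIMSEQ_le_const2)
  let ?S = "fourier_integral h"
  have [measurable]: "h \<in> borel_measurable borel" using h by auto
  define w where "w n u = exp (- (inverse (real (Suc n)) * u)\<^sup>2 / 2)" for n u
  show "(\<lambda>n. \<integral>\<^sup>+u. ennreal (w n u * (norm (?S u))\<^sup>2) \<partial>lborel)
      \<longlonglongrightarrow> (\<integral>\<^sup>+u. ennreal ((norm (?S u))\<^sup>2) \<partial>lborel)"
  proof (rule nn_integral_LIMSEQ)
    have "w m u \<le> w n u" if "m \<le> n" for m n u
      using that
      by (auto simp: w_def power_mult_distrib intro!: mult_right_mono power_mono le_imp_inverse_le)
    thus "incseq (\<lambda>n u. ennreal (w n u * (norm (?S u))\<^sup>2))"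
      by (intro incseq_SucI le_funI ennreal_leI mult_right_mono) auto
    have "(\<lambda>n. w n u) \<longlonglongrightarrow> exp (- (0 * u)\<^sup>2 / 2)" for u
      unfolding w_def by (intro tendsto_intros LIMSEQ_inverse_real_of_nat) simp
    from tendsto_mult_right[OF this] show "(\<lambda>n. ennreal (w n u * (norm (?S u))\<^sup>2))
        \<longlonglongrightarrow> ennreal ((norm (?S u))\<^sup>2)" for u
      by (intro tendsto_ennrealI) simp
  qed (simp add: w_def)
  have "(\<integral>\<^sup>+u. ennreal (w n u * (norm (?S u))\<^sup>2) \<partial>lborel)
      \<le> ennreal (2 * pi) * (\<integral>\<^sup>+t. ennreal ((norm (h t))\<^sup>2) \<partial>lborel)" for n
  proof -
    define b where "b = inverse (real (Suc n))"
    have b: "b > 0" by (simp add: b_def)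
    have "integrable lborel (\<lambda>u. w n u)"
      unfolding w_def b_def[symmetric] using b by (intro integrable_gauss) simp
    from nn_integral_weight_norm_square_fourier_integral_le[OF h this] show ?thesis
      unfolding w_def b_def[symmetric] nn_integral_norm_fourier_integral_gauss[OF b] by simp
  qed
  thus "\<exists>N. \<forall>n\<ge>N. (\<integral>\<^sup>+u. ennreal (w n u * (norm (?S u))\<^sup>2) \<partial>lborel)
      \<le> ennreal (2 * pi) * (\<integral>\<^sup>+t. ennreal ((norm (h t))\<^sup>2) \<partial>lborel)" by blast
qed

lemma std_normal_density_altdef: "std_normal_density x = sqrt (2 * pi) / (2 * pi) * exp (- x\<^sup>2 / 2)"
  by (simp add: std_normal_density_def sqrt_divide_self_eq inverse_eq_divide)

lemma std_normal_density_power_le: "std_normal_density x * \<bar>x\<bar> ^ m \<le> fact m"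
proof -
  have "exp (1/2) \<le> sqrt (2 * pi)"
  proof (rule real_le_rsqrt)
    have "(exp (1/2))\<^sup>2 = exp (1::real)" by (simp flip: exp_double)
    thus "(exp (1/2))\<^sup>2 \<le> 2 * pi" using exp_le pi_ge_two by linarith
  qed
  have "\<bar>x\<bar> - x\<^sup>2 / 2 \<le> 1/2"
    using zero_le_power2[of "\<bar>x\<bar> - 1"] by (simp add: power2_diff)
  have "std_normal_density x * exp \<bar>x\<bar> = exp (\<bar>x\<bar> - x\<^sup>2 / 2) / sqrt (2 * pi)"
    by (simp add: std_normal_density_def flip: exp_add)
  also have "\<dots> \<le> exp (1/2) / sqrt (2 * pi)"
    using \<open>\<bar>x\<bar> - x\<^sup>2 / 2 \<le> 1/2\<close> by (intro divide_right_mono) auto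
  also have "\<dots> \<le> 1"
    using \<open>exp (1/2) \<le> sqrt (2 * pi)\<close> by (subst divide_le_eq_1_pos) auto
  finally have exp_abs: "std_normal_density x * exp \<bar>x\<bar> \<le> 1" .
  have "std_normal_density x * \<bar>x\<bar> ^ m = fact m * (std_normal_density x * (\<bar>x\<bar> ^ m / fact m))" by simp
  also have "\<dots> \<le> fact m * (std_normal_density x * exp \<bar>x\<bar>)"
    by (intro mult_left_mono power_div_fact_le_exp) auto
  also have "\<dots> \<le> fact m * 1"
    by (intro mult_left_mono exp_abs) auto
  finally show ?thesis by simp
qed

lemma std_normal_density_le_1: "std_normal_density x \<le> 1"
  using std_normal_density_power_le[of x 0] by simp

lemma std_normal_density_le_inverse_power:
  assumes "0 < d" "d \<le> \<bar>x\<bar>"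
  shows "std_normal_density x \<le> fact m / d ^ m"
proof -
  have "std_normal_density x * d ^ m \<le> std_normal_density x * \<bar>x\<bar> ^ m"
    using assms by (intro mult_left_mono power_mono) auto
  also have "\<dots> \<le> fact m" by (rule std_normal_density_power_le)
  finally show ?thesis using assms by (simp add: field_simps)
qed

definition gauss_moment :: "nat \<Rightarrow> real" where
  "gauss_moment k = (\<integral>v. std_normal_density v * \<bar>v\<bar> ^ k \<partial>lborel)"

lemma gauss_moment_nonneg: "gauss_moment k \<ge> 0"
  unfolding gauss_moment_def by (intro integral_nonneg_AE AE_I2) auto

definition gauss_conv :: "real \<Rightarrow> (real \<Rightarrow> real) \<Rightarrow> real \<Rightarrow> real" where
  "gauss_conv b G u = (\<integral>v. std_normal_density v * G (u + b * v) \<partial>lborel)"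

lemma integrable_gauss_conv:
  assumes G: "integrable lborel G" and b: "b \<noteq> 0"
  shows "integrable lborel (\<lambda>v. std_normal_density v * G (u + b * v))"
proof (rule Bochner_Integration.integrable_bound)
  show "integrable lborel (\<lambda>v. G (u + b * v))" by (rule lborel_integrable_real_affine[OF G b])
  have [measurable]: "G \<in> borel_measurable borel" using G by auto
  show "(\<lambda>v. std_normal_density v * G (u + b * v)) \<in> borel_measurable lborel" by measurable
  show "AE v in lborel. norm (std_normal_density v * G (u + b * v)) \<le> norm (G (u + b * v))"
    using std_normal_density_le_1 by (auto simp: abs_mult intro!: mult_left_le_one_le)
qed

lemma gauss_conv_measurable [measurable]:
  assumes [measurable]: "G \<in> borel_measurable borel"
  shows "gauss_conv b G \<in> borel_measurable borel"
  unfolding gauss_conv_def[abs_def] by measurable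

lemma gauss_conv_eq_fourier_integral:
  assumes G: "integrable lborel G" and b: "b > 0"
  shows "complex_of_real (gauss_conv b G u) =
    fourier_integral (\<lambda>t. of_real (exp (- (b * t)\<^sup>2 / 2) / (2 * pi)) * fourier G t) u"
proof -
  define k where "k t = complex_of_real (exp (- (b * t)\<^sup>2 / 2) / (2 * pi))" for t
  have [measurable]: "G \<in> borel_measurable lborel" using G by auto
  have kernel: "complex_of_real (std_normal_density ((w - u) / b) / b)
      = (\<integral>t. k t * iexp ((u - w) * t) \<partial>lborel)" for w
  proof -
    have "(\<integral>t. k t * iexp ((u - w) * t) \<partial>lborel) =
        of_real (sqrt (2 * pi) / b * exp (- ((u - w) / b)\<^sup>2 / 2)) / of_real (2 * pi)"
      unfolding fourier_integral_gauss[OF b, symmetric] fourier_integral_def integral_divide_zero[symmetric]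
      by (simp add: k_def)
    also have "\<dots> = of_real (std_normal_density ((w - u) / b) / b)"
      unfolding of_real_divide[symmetric] of_real_eq_iff
      by (simp add: std_normal_density_altdef power2_commute power_divide del: real_sqrt_mult)
    finally show ?thesis ..
  qed
  have "gauss_conv b G u = (\<integral>w. std_normal_density ((w - u) / b) / b * G w \<partial>lborel)"
    using lborel_integral_real_affine[of b "\<lambda>w. std_normal_density ((w - u) / b) / b * G w" u] b
    by (simp add: gauss_conv_def)
  hence "complex_of_real (gauss_conv b G u)
      = (\<integral>w. (\<integral>t. k t * iexp ((u - w) * t) * of_real (G w) \<partial>lborel) \<partial>lborel)"
    by (simp only: integral_complex_of_real[symmetric] of_real_mult kernel integral_mult_left_zero)
  also have "\<dots> = (\<integral>t. (\<integral>w. k t * iexp ((u - w) * t) * of_real (G w) \<partial>lborel) \<partial>lborel)"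
  proof (rule Fubini_product_bound)
    show "integrable lborel (\<lambda>w. \<bar>G w\<bar>)" using G by auto
    show "integrable lborel (\<lambda>t. exp (- (b * t)\<^sup>2 / 2) / (2 * pi))"
      using b by (intro integrable_divide integrable_gauss) simp
  qed (auto simp: k_def norm_mult norm_divide mult.commute)
  also have "\<dots> = fourier_integral (\<lambda>t. k t * fourier G t) u"
    unfolding fourier_def fourier_integral_def
      integral_mult_left_zero[symmetric] integral_mult_right_zero[symmetric]
    by (intro Bochner_Integration.integral_cong refl)
       (simp add: algebra_simps exp_diff exp_minus field_simps)
  finally show ?thesis unfolding k_def .
qed

lemma nn_integral_gauss_conv_square_le:
  assumes G: "integrable lborel G" and b: "b > 0"
  shows "(\<integral>\<^sup>+u. ennreal ((gauss_conv b G u)\<^sup>2) \<partial>lborel)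
    \<le> (\<integral>\<^sup>+t. ennreal (exp (- (b * t)\<^sup>2) * (norm (fourier G t))\<^sup>2 / (2 * pi)) \<partial>lborel)"
proof -
  define L where "L = (\<integral>x. \<bar>G x\<bar> \<partial>lborel)"
  define h where "h t = of_real (exp (- (b * t)\<^sup>2 / 2) / (2 * pi)) * fourier G t" for t
  have [measurable]: "G \<in> borel_measurable borel" using G by auto
  have h_int: "integrable lborel h"
  proof (rule Bochner_Integration.integrable_bound)
    show "integrable lborel (\<lambda>t. exp (- (b * t)\<^sup>2 / 2) / (2 * pi) * L)"
      using b by (intro integrable_mult_left integrable_divide integrable_gauss) simp
    show "h \<in> borel_measurable lborel" unfolding h_def by measurable
    show "AE t in lborel. norm (h t) \<le> norm (exp (- (b * t)\<^sup>2 / 2) / (2 * pi) * L)"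
      using norm_fourier_le[of G]
      by (auto simp: h_def L_def norm_mult norm_divide abs_mult intro!: divide_right_mono mult_left_mono)
  qed
  have "ennreal ((gauss_conv b G u)\<^sup>2) = ennreal ((norm (fourier_integral h u))\<^sup>2)" for u
    unfolding h_def gauss_conv_eq_fourier_integral[OF G b, symmetric] by simp
  hence "(\<integral>\<^sup>+u. ennreal ((gauss_conv b G u)\<^sup>2) \<partial>lborel)
      \<le> ennreal (2 * pi) * (\<integral>\<^sup>+t. ennreal ((norm (h t))\<^sup>2) \<partial>lborel)"
    using plancherel_le[OF h_int] by simp
  also have "\<dots> = (\<integral>\<^sup>+t. ennreal (2 * pi * (norm (h t))\<^sup>2) \<partial>lborel)"
    using h_int by (simp add: ennreal_mult' nn_integral_cmult)
  also have "\<dots> = (\<integral>\<^sup>+t. ennreal (exp (- (b * t)\<^sup>2) * (norm (fourier G t))\<^sup>2 / (2 * pi)) \<partial>lborel)"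
  proof (rule nn_integral_cong)
    fix t
    have "(exp (- (b * t)\<^sup>2 / 2))\<^sup>2 = exp (- (b * t)\<^sup>2)" by (simp flip: exp_double)
    thus "ennreal (2 * pi * (norm (h t))\<^sup>2)
        = ennreal (exp (- (b * t)\<^sup>2) * (norm (fourier G t))\<^sup>2 / (2 * pi))"
      by (simp add: h_def norm_mult norm_divide power_mult_distrib power_divide power2_eq_square[of pi])
  qed
  finally show ?thesis .
qed

lemma exp_square_times_le_truncation:
  fixes b X t y L :: real
  assumes "b > 0" "X > 0" "0 \<le> y" "y \<le> L"
  shows "exp (- (b * t)\<^sup>2) * y\<^sup>2
    \<le> indicator {-X..X} t * y\<^sup>2 + exp (- (b * X)\<^sup>2 / 2) * L\<^sup>2 * exp (- (b * t)\<^sup>2 / 2)"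
proof (cases "\<bar>t\<bar> \<le> X")
  case True
  have "exp (- (b * t)\<^sup>2) * y\<^sup>2 \<le> 1 * y\<^sup>2" by (intro mult_right_mono) auto
  thus ?thesis using True by (simp add: abs_le_iff add_increasing2)
next
  case False
  have "(b * X)\<^sup>2 \<le> (b * t)\<^sup>2"
    using False assms by (simp add: power_mult_distrib abs_le_square_iff[symmetric])
  have "exp (- (b * t)\<^sup>2) * y\<^sup>2 = exp (- (b * t)\<^sup>2 / 2) * exp (- (b * t)\<^sup>2 / 2) * y\<^sup>2"
    by (simp flip: exp_add)
  also have "\<dots> \<le> exp (- (b * X)\<^sup>2 / 2) * exp (- (b * t)\<^sup>2 / 2) * L\<^sup>2"
    using \<open>(b * X)\<^sup>2 \<le> (b * t)\<^sup>2\<close> assms by (intro mult_mono power_mono) auto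
  also have "\<dots> \<le> indicator {-X..X} t * y\<^sup>2 + exp (- (b * X)\<^sup>2 / 2) * L\<^sup>2 * exp (- (b * t)\<^sup>2 / 2)"
    by (simp add: mult_ac)
  finally show ?thesis .
qed

lemma set_integrable_norm_fourier_square:
  assumes G: "integrable lborel G"
  shows "set_integrable lborel {a..b} (\<lambda>t. (norm (fourier G t))\<^sup>2)"
proof (rule set_integrable_bound)
  have [measurable]: "G \<in> borel_measurable borel" using G by auto
  show "set_integrable lborel {a..b} (\<lambda>t. (\<integral>x. \<bar>G x\<bar> \<partial>lborel)\<^sup>2)"
    by (intro borel_integrable_atLeastAtMost' continuous_intros)
  show "set_borel_measurable lborel {a..b} (\<lambda>t. (norm (fourier G t))\<^sup>2)"
    unfolding set_borel_measurable_def by measurable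
  show "AE t in lborel. t \<in> {a..b} \<longrightarrow> norm ((norm (fourier G t))\<^sup>2) \<le> norm ((\<integral>x. \<bar>G x\<bar> \<partial>lborel)\<^sup>2)"
    using norm_fourier_le[of G] by (auto intro!: power_mono)
qed

lemma gauss_conv_L2_le:
  assumes G: "integrable lborel G" and b: "b > 0" and X: "X > 0"
  defines "L \<equiv> (\<integral>x. \<bar>G x\<bar> \<partial>lborel)"
  shows "integrable lborel (\<lambda>u. (gauss_conv b G u)\<^sup>2)"
    and "(\<integral>u. (gauss_conv b G u)\<^sup>2 \<partial>lborel)
      \<le> (LBINT t:{-X..X}. (norm (fourier G t))\<^sup>2) + L\<^sup>2 * fact m / (b * (b * X) ^ m)"
proof -
  define I where "I = (LBINT t:{-X..X}. (norm (fourier G t))\<^sup>2)"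
  define c where "c = exp (- (b * X)\<^sup>2 / 2) * L\<^sup>2"
  define f where
    "f t = (indicator {-X..X} t * (norm (fourier G t))\<^sup>2 + c * exp (- (b * t)\<^sup>2 / 2)) / (2 * pi)" for t
  have [measurable]: "G \<in> borel_measurable borel" using G by auto
  have trunc_int: "integrable lborel (\<lambda>t. indicator {-X..X} t * (norm (fourier G t))\<^sup>2)"
    using set_integrable_norm_fourier_square[OF G] by (simp add: set_integrable_def)
  have gauss_int: "integrable lborel (\<lambda>t. exp (- (b * t)\<^sup>2 / 2))"
    using b by (intro integrable_gauss) simp
  have f_int: "integrable lborel f" unfolding f_def using trunc_int gauss_int by auto
  have I_nonneg: "I \<ge> 0" unfolding I_def set_lebesgue_integral_def by simp
  have "(\<integral>\<^sup>+u. ennreal ((gauss_conv b G u)\<^sup>2) \<partial>lborel) \<le> (\<integral>\<^sup>+t. ennreal (f t) \<partial>lborel)"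
  proof (rule order.trans[OF nn_integral_gauss_conv_square_le[OF G b]], intro nn_integral_mono ennreal_leI)
    show "exp (- (b * t)\<^sup>2) * (norm (fourier G t))\<^sup>2 / (2 * pi) \<le> f t" for t
      unfolding f_def c_def L_def
      by (intro divide_right_mono exp_square_times_le_truncation b X norm_fourier_le) auto
  qed
  also have "\<dots> = ennreal (\<integral>t. f t \<partial>lborel)"
    by (rule nn_integral_eq_integral[OF f_int]) (auto simp: f_def c_def)
  also have "(\<integral>t. f t \<partial>lborel) = I / (2 * pi) + c * (sqrt (2 * pi) / b) / (2 * pi)"
    unfolding f_def using trunc_int gauss_int integral_gauss[OF b]
    by (simp add: I_def set_lebesgue_integral_def add_divide_distrib)
  also have "c * (sqrt (2 * pi) / b) / (2 * pi) = L\<^sup>2 * std_normal_density (b * X) / b"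
    by (simp add: c_def std_normal_density_altdef mult_ac del: real_sqrt_mult)
  also have "ennreal (I / (2 * pi) + L\<^sup>2 * std_normal_density (b * X) / b)
      \<le> ennreal (I + L\<^sup>2 * (fact m / (b * X) ^ m) / b)"
  proof (intro ennreal_leI add_mono divide_right_mono mult_left_mono std_normal_density_le_inverse_power)
    have "1 \<le> 2 * pi" using pi_ge_two by simp
    thus "I / (2 * pi) \<le> I"
      using I_nonneg by (simp add: divide_le_eq mult_left_mono[of 1 "2 * pi" I, simplified])
  qed (use b X in auto)
  finally have nn_bound: "(\<integral>\<^sup>+u. ennreal ((gauss_conv b G u)\<^sup>2) \<partial>lborel)
      \<le> ennreal (I + L\<^sup>2 * fact m / (b * (b * X) ^ m))"
    by (simp add: mult.commute)
  thus "integrable lborel (\<lambda>u. (gauss_conv b G u)\<^sup>2)"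
    by (intro integrableI_nonneg) (auto simp: le_less_trans)
  show "(\<integral>u. (gauss_conv b G u)\<^sup>2 \<partial>lborel)
      \<le> (LBINT t:{-X..X}. (norm (fourier G t))\<^sup>2) + L\<^sup>2 * fact m / (b * (b * X) ^ m)"
    using nn_bound I_nonneg b X unfolding I_def by (intro integral_real_bounded) auto
qed

lemma gauss_conv_L2_le_of_width_ge:
  assumes G: "integrable lborel G" and b: "0 < b" "b \<le> b'" and X: "X > 0"
  shows "(\<integral>u. (gauss_conv b' G u)\<^sup>2 \<partial>lborel) \<le> (LBINT t:{-X..X}. (norm (fourier G t))\<^sup>2)
    + (\<integral>x. \<bar>G x\<bar> \<partial>lborel)\<^sup>2 * fact m / (b * (b * X) ^ m)"
proof -
  have "b' > 0" using b by simp
  from gauss_conv_L2_le(2)[OF G this X, of m]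
  have "(\<integral>u. (gauss_conv b' G u)\<^sup>2 \<partial>lborel) \<le> (LBINT t:{-X..X}. (norm (fourier G t))\<^sup>2)
    + (\<integral>x. \<bar>G x\<bar> \<partial>lborel)\<^sup>2 * fact m / (b' * (b' * X) ^ m)" .
  also have "\<dots> \<le> (LBINT t:{-X..X}. (norm (fourier G t))\<^sup>2)
    + (\<integral>x. \<bar>G x\<bar> \<partial>lborel)\<^sup>2 * fact m / (b * (b * X) ^ m)"
    using b X
    by (intro add_left_mono divide_left_mono mult_mono power_mono mult_pos_pos zero_less_power) auto
  finally show ?thesis .
qed

section \<open>Finite differences of analytic functions\<close>

text \<open>The sign convention differs from the usual forward difference by \<open>(-1) ^ n\<close>, so that the
term \<open>f x\<close> has coefficient 1.\<close>

definition fdiff :: "nat \<Rightarrow> ('a::comm_ring_1 \<Rightarrow> 'a) \<Rightarrow> 'a \<Rightarrow> 'a \<Rightarrow> 'a" where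
  "fdiff n f h x = (\<Sum>j\<le>n. (-1) ^ j * of_nat (n choose j) * f (x + of_nat j * h))"

lemma fdiff_0: "fdiff 0 f h x = f x"
  by (simp add: fdiff_def)

lemma fdiff_eq_add_sum:
  "fdiff n f h x = f x + (\<Sum>j=1..n. (-1) ^ j * of_nat (n choose j) * f (x + of_nat j * h))"
  unfolding fdiff_def by (simp add: atMost_atLeast0 sum.atLeast_Suc_atMost)

lemma fdiff_Suc: "fdiff (Suc n) f h x = fdiff n f h x - fdiff n f h (x + h)"
proof -
  let ?F = "\<lambda>j. f (x + of_nat j * h)"
  have here: "fdiff n f h x = ?F 0 + (\<Sum>j\<le>n. (-1) ^ Suc j * of_nat (n choose Suc j) * ?F (Suc j))"
  proof -
    have "fdiff n f h x = (\<Sum>j\<le>Suc n. (-1) ^ j * of_nat (n choose j) * ?F j)"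
      by (simp add: fdiff_def binomial_eq_0)
    thus ?thesis by (subst (asm) sum.atMost_Suc_shift) simp
  qed
  have shifted: "fdiff n f h (x + h) = - (\<Sum>j\<le>n. (-1) ^ Suc j * of_nat (n choose j) * ?F (Suc j))"
    by (simp add: fdiff_def sum_negf[symmetric] algebra_simps)
  have "fdiff (Suc n) f h x = ?F 0 + (\<Sum>j\<le>n. (-1) ^ Suc j * of_nat (Suc n choose Suc j) * ?F (Suc j))"
    unfolding fdiff_def by (subst sum.atMost_Suc_shift) simp
  also have "\<dots> = ?F 0 + (\<Sum>j\<le>n. (-1) ^ Suc j * of_nat (n choose Suc j) * ?F (Suc j))
      + (\<Sum>j\<le>n. (-1) ^ Suc j * of_nat (n choose j) * ?F (Suc j))"
    by (simp add: sum.distrib[symmetric] algebra_simps)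
  finally show ?thesis unfolding here shifted by simp
qed

lemma fdiff_has_field_derivative:
  assumes "\<And>j. j \<le> n \<Longrightarrow> (f has_field_derivative f' (x + of_nat j * h)) (at (x + of_nat j * h))"
  shows "(fdiff n f h has_field_derivative fdiff n f' h x) (at x within A)"
proof -
  have "((\<lambda>y. f (y + of_nat j * h)) has_field_derivative f' (x + of_nat j * h)) (at x within A)"
      if "j \<le> n" for j
  proof -
    have "((\<lambda>y. y + of_nat j * h) has_field_derivative 1) (at x within A)"
      by (auto intro!: derivative_eq_intros)
    from DERIV_chain2[of f, OF assms[OF that] this] show ?thesis by simp
  qed
  thus ?thesis
    unfolding fdiff_def[abs_def] by (auto intro!: DERIV_sum DERIV_cmult)
qed

lemma norm_fdiff_le:
  fixes f :: "complex \<Rightarrow> complex"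
  assumes S: "open S" "convex S"
  assumes "f holomorphic_on S" "x \<in> S" "x + of_nat n * h \<in> S"
    and "\<And>z. z \<in> S \<Longrightarrow> norm ((deriv ^^ n) f z) \<le> B"
  shows "norm (fdiff n f h x) \<le> B * norm h ^ n"
  using assms(3-6)
proof (induction n arbitrary: f x)
  case 0
  thus ?case by (simp add: fdiff_0)
next
  case (Suc n)
  have mem: "y + of_nat j * h \<in> S" if y: "y \<in> closed_segment x (x + h)" and j: "j \<le> n" for y j
  proof -
    obtain c where c: "0 \<le> c" "c \<le> 1" "y = x + of_real c * h"
      using y by (auto simp: in_segment scaleR_conv_of_real algebra_simps)
    define l where "l = (c + real j) / real (Suc n)"
    have l: "0 \<le> l" "l \<le> 1" using c j by (auto simp: l_def)
    have "(1 - l) *\<^sub>R x + l *\<^sub>R (x + of_nat (Suc n) * h) \<in> S"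
      using l Suc.prems by (intro convexD[OF S(2)]) auto
    also have "(1 - l) *\<^sub>R x + l *\<^sub>R (x + of_nat (Suc n) * h) = x + of_real (l * real (Suc n)) * h"
      by (simp add: scaleR_conv_of_real algebra_simps)
    also have "l * real (Suc n) = c + real j" by (simp add: l_def)
    finally show ?thesis using c by (simp add: algebra_simps)
  qed
  have "norm (fdiff n f h x - fdiff n f h (x + h)) \<le> B * norm h ^ n * norm (x - (x + h))"
  proof (rule field_differentiable_bound[where f' = "fdiff n (deriv f) h"])
    fix y assume y: "y \<in> closed_segment x (x + h)"
    show "(fdiff n f h has_field_derivative fdiff n (deriv f) h y) (at y within closed_segment x (x + h))"
      by (rule fdiff_has_field_derivative[OF holomorphic_derivI[OF Suc.prems(1) S(1) mem[OF y]]])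
    show "norm (fdiff n (deriv f) h y) \<le> B * norm h ^ n"
    proof (rule Suc.IH)
      show "deriv f holomorphic_on S" by (rule holomorphic_deriv[OF Suc.prems(1) S(1)])
      show "norm ((deriv ^^ n) (deriv f) z) \<le> B" if "z \<in> S" for z
        using Suc.prems(4)[OF that] by (simp add: funpow_Suc_right del: funpow.simps)
    qed (use mem[OF y, of 0] mem[OF y, of n] in auto)
  qed auto
  thus ?case by (simp add: fdiff_Suc mult_ac)
qed

lemma norm_fdiff_le_of_bounded:
  fixes f :: "complex \<Rightarrow> complex"
  assumes f: "f holomorphic_on ball u \<rho>" and \<rho>: "\<rho> > 0"
    and M: "\<And>z. z \<in> ball u \<rho> \<Longrightarrow> norm (f z) \<le> M" and h: "real n * norm h < \<rho> / 2"
  shows "norm (fdiff n f h u) \<le> fact n * M * (4 * norm h / \<rho>) ^ n"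
proof -
  have "norm (fdiff n f h u) \<le> (fact n * M / (\<rho> / 4) ^ n) * norm h ^ n"
  proof (rule norm_fdiff_le[of "ball u (\<rho> / 2)"])
    show "f holomorphic_on ball u (\<rho> / 2)"
      by (rule holomorphic_on_subset[OF f]) (use \<rho> in auto)
    fix z assume z: "z \<in> ball u (\<rho> / 2)"
    have sub: "cball z (\<rho> / 4) \<subseteq> ball u \<rho>"
    proof
      fix w assume "w \<in> cball z (\<rho> / 4)"
      thus "w \<in> ball u \<rho>" using z \<rho> dist_triangle[of u w z] by auto
    qed
    show "norm ((deriv ^^ n) f z) \<le> fact n * M / (\<rho> / 4) ^ n"
    proof (rule Cauchy_inequality)
      show "f holomorphic_on ball z (\<rho> / 4)"
        using sub by (intro holomorphic_on_subset[OF f]) auto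
      show "continuous_on (cball z (\<rho> / 4)) f"
        using sub by (intro holomorphic_on_imp_continuous_on holomorphic_on_subset[OF f]) auto
      show "norm (f w) \<le> M" if "norm (z - w) = \<rho> / 4" for w
        using that sub by (intro M) (auto simp: dist_norm)
    qed (use \<rho> in auto)
  qed (use \<rho> h in \<open>auto simp: dist_norm norm_mult\<close>)
  also have "\<dots> = fact n * M * (4 * norm h / \<rho>) ^ n"
    by (simp add: power_divide power_mult_distrib)
  finally show ?thesis .
qed

definition holomorphic_bound_at :: "(real \<Rightarrow> real) \<Rightarrow> real \<Rightarrow> real \<Rightarrow> real \<Rightarrow> bool" where
  "holomorphic_bound_at G u \<rho> M \<longleftrightarrow> (\<exists>f. f holomorphic_on ball (of_real u) \<rho> \<and>
     (\<forall>z\<in>ball (of_real u) \<rho>. norm (f z) \<le> M) \<and>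
     (\<forall>x\<in>ball u \<rho>. f (of_real x) = of_real (G x)))"

lemma abs_fdiff_le:
  assumes G: "holomorphic_bound_at G u \<rho> M" and \<rho>: "\<rho> > 0" and h: "real n * \<bar>h\<bar> < \<rho> / 2"
  shows "\<bar>fdiff n G h u\<bar> \<le> fact n * M * (4 * \<bar>h\<bar> / \<rho>) ^ n"
proof -
  obtain f where f: "f holomorphic_on ball (of_real u) \<rho>"
      "\<And>z. z \<in> ball (of_real u) \<rho> \<Longrightarrow> norm (f z) \<le> M"
      "\<And>x. x \<in> ball u \<rho> \<Longrightarrow> f (of_real x) = of_real (G x)"
    using G unfolding holomorphic_bound_at_def by blast
  have "f (of_real u + of_nat j * of_real h) = of_real (G (u + of_nat j * h))" if "j \<le> n" for j
  proof -
    have "\<bar>real j * h\<bar> \<le> real n * \<bar>h\<bar>" using that by (simp add: abs_mult mult_right_mono)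
    hence "u + real j * h \<in> ball u \<rho>" using h \<rho> by (simp add: dist_norm)
    from f(3)[OF this] show ?thesis by simp
  qed
  hence "fdiff n f (of_real h) (of_real u) = of_real (fdiff n G h u)"
    unfolding fdiff_def of_real_sum by (intro sum.cong) auto
  thus ?thesis
    using norm_fdiff_le_of_bounded[OF f(1) \<rho> f(2), of n "of_real h"] h by simp
qed

lemma holomorphic_bound_at_imp_abs_le:
  "holomorphic_bound_at G u \<rho> M \<Longrightarrow> \<rho> > 0 \<Longrightarrow> \<bar>G u\<bar> \<le> M"
  using abs_fdiff_le[of G u \<rho> M 0 0] by (simp add: fdiff_0)

section \<open>Recovering an analytic function from its Gaussian averages\<close>

lemma
  assumes G: "integrable lborel G" and b: "b \<noteq> 0"
  shows integrable_gauss_fdiff: "integrable lborel (\<lambda>v. std_normal_density v * fdiff n G (b * v) u)"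
    and integral_gauss_fdiff: "(\<integral>v. std_normal_density v * fdiff n G (b * v) u \<partial>lborel)
      = G u + (\<Sum>j=1..n. (-1) ^ j * of_nat (n choose j) * gauss_conv (real j * b) G u)"
proof -
  have pointwise: "std_normal_density v * fdiff n G (b * v) u = std_normal_density v * G u +
      (\<Sum>j=1..n. (-1) ^ j * of_nat (n choose j) * (std_normal_density v * G (u + real j * b * v)))" for v
    unfolding fdiff_eq_add_sum by (simp add: distrib_left sum_distrib_left mult_ac)
  have const_int: "integrable lborel (\<lambda>v. std_normal_density v * G u)" by simp
  have conv_int: "integrable lborel (\<lambda>v. std_normal_density v * G (u + real j * b * v))"
      if "j \<in> {1..n}" for j
    using that b by (intro integrable_gauss_conv G) auto
  have sum_int: "integrable lborel (\<lambda>v. \<Sum>j=1..n. (-1) ^ j * of_nat (n choose j) *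
      (std_normal_density v * G (u + real j * b * v)))"
    by (intro Bochner_Integration.integrable_sum integrable_mult_right conv_int)
  show "integrable lborel (\<lambda>v. std_normal_density v * fdiff n G (b * v) u)"
    unfolding pointwise by (intro Bochner_Integration.integrable_add const_int sum_int)
  show "(\<integral>v. std_normal_density v * fdiff n G (b * v) u \<partial>lborel)
      = G u + (\<Sum>j=1..n. (-1) ^ j * of_nat (n choose j) * gauss_conv (real j * b) G u)"
    unfolding pointwise gauss_conv_def using conv_int
    by (subst Bochner_Integration.integral_add[OF const_int sum_int],
        subst Bochner_Integration.integral_sum) auto
qed

lemma abs_gauss_fdiff_le:
  fixes G :: "real \<Rightarrow> real"
  assumes \<delta>: "\<delta> > 0" and B: "B \<ge> 0" and near: "\<bar>v\<bar> \<le> \<delta> \<Longrightarrow> \<bar>fdiff n G (b * v) u\<bar> \<le> B * \<bar>v\<bar> ^ n"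
  shows "\<bar>std_normal_density v * fdiff n G (b * v) u\<bar>
    \<le> (B + \<bar>G u\<bar> / \<delta> ^ n) * (std_normal_density v * \<bar>v\<bar> ^ n)
      + fact n / \<delta> ^ n * (\<Sum>j=1..n. real (n choose j) * \<bar>G (u + real j * b * v)\<bar>)"
proof -
  define S where "S = (\<Sum>j=1..n. real (n choose j) * \<bar>G (u + real j * b * v)\<bar>)"
  have S: "S \<ge> 0" unfolding S_def by (intro sum_nonneg) auto
  have "\<bar>std_normal_density v * fdiff n G (b * v) u\<bar>
      \<le> (B + \<bar>G u\<bar> / \<delta> ^ n) * (std_normal_density v * \<bar>v\<bar> ^ n) + fact n / \<delta> ^ n * S"
  proof (cases "\<bar>v\<bar> \<le> \<delta>")
    case True
    have "\<bar>std_normal_density v * fdiff n G (b * v) u\<bar> \<le> std_normal_density v * (B * \<bar>v\<bar> ^ n)"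
      using near[OF True] by (simp add: abs_mult mult_left_mono)
    also have "\<dots> \<le> (B + \<bar>G u\<bar> / \<delta> ^ n) * (std_normal_density v * \<bar>v\<bar> ^ n)"
      using \<delta> by (simp add: algebra_simps)
    finally show ?thesis using \<delta> S by (simp add: add_increasing2)
  next
    case False
    hence "\<delta> \<le> \<bar>v\<bar>" by simp
    have "\<bar>\<Sum>j=1..n. (-1) ^ j * of_nat (n choose j) * G (u + real j * (b * v))\<bar> \<le> S"
      unfolding S_def by (rule order.trans[OF sum_abs]) (simp add: abs_mult mult.assoc)
    hence "\<bar>fdiff n G (b * v) u\<bar> \<le> \<bar>G u\<bar> + S"
      unfolding fdiff_eq_add_sum by linarith
    hence "\<bar>std_normal_density v * fdiff n G (b * v) u\<bar>
        \<le> std_normal_density v * \<bar>G u\<bar> + std_normal_density v * S"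
      by (simp add: abs_mult mult_left_mono flip: distrib_left)
    also have "std_normal_density v * S \<le> fact n / \<delta> ^ n * S"
      by (intro mult_right_mono std_normal_density_le_inverse_power \<delta> S \<open>\<delta> \<le> \<bar>v\<bar>\<close>)
    also have "std_normal_density v * \<bar>G u\<bar> \<le> (std_normal_density v * \<bar>G u\<bar>) * (\<bar>v\<bar> ^ n / \<delta> ^ n)"
      using \<delta> \<open>\<delta> \<le> \<bar>v\<bar>\<close> mult_left_mono[of 1 "\<bar>v\<bar> ^ n / \<delta> ^ n" "std_normal_density v * \<bar>G u\<bar>"]
      by (simp add: power_mono)
    also have "\<dots> \<le> (B + \<bar>G u\<bar> / \<delta> ^ n) * (std_normal_density v * \<bar>v\<bar> ^ n)"
      using B by (simp add: algebra_simps)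
    finally show ?thesis by simp
  qed
  thus ?thesis unfolding S_def .
qed

lemma sum_choose_atLeast_one_le: "(\<Sum>j=1..n. real (n choose j)) \<le> 2 ^ n"
proof -
  have "(\<Sum>j=1..n. real (n choose j)) \<le> (\<Sum>j\<le>n. real (n choose j))" by (intro sum_mono2) auto
  also have "\<dots> = 2 ^ n" by (simp add: choose_row_sum flip: of_nat_sum)
  finally show ?thesis .
qed

lemma
  assumes G: "integrable lborel G" and b: "b > 0"
  shows integrable_sum_choose_shifts:
      "integrable lborel (\<lambda>v. \<Sum>j=1..n. real (n choose j) * \<bar>G (u + real j * b * v)\<bar>)"
    and integral_sum_choose_shifts_le:
      "(\<integral>v. (\<Sum>j=1..n. real (n choose j) * \<bar>G (u + real j * b * v)\<bar>) \<partial>lborel)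
      \<le> 2 ^ n * ((\<integral>x. \<bar>G x\<bar> \<partial>lborel) / b)"
proof -
  let ?L = "\<integral>x. \<bar>G x\<bar> \<partial>lborel"
  have shift_int: "integrable lborel (\<lambda>v. \<bar>G (u + real j * b * v)\<bar>)"
    and shift_le: "(\<integral>v. \<bar>G (u + real j * b * v)\<bar> \<partial>lborel) \<le> ?L / b" if "j \<in> {1..n}" for j
  proof -
    have width_nonzero: "real j * b \<noteq> 0" using that b by auto
    show "integrable lborel (\<lambda>v. \<bar>G (u + real j * b * v)\<bar>)"
      by (intro integrable_abs lborel_integrable_real_affine G width_nonzero)
    have "?L / b = real j * (\<integral>v. \<bar>G (u + real j * b * v)\<bar> \<partial>lborel)"
      using lborel_integral_real_affine[OF width_nonzero, of "\<lambda>x. \<bar>G x\<bar>" u] b by simp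
    thus "(\<integral>v. \<bar>G (u + real j * b * v)\<bar> \<partial>lborel) \<le> ?L / b"
      using that mult_right_mono[of 1 "real j" "\<integral>v. \<bar>G (u + real j * b * v)\<bar> \<partial>lborel"] by simp
  qed
  show "integrable lborel (\<lambda>v. \<Sum>j=1..n. real (n choose j) * \<bar>G (u + real j * b * v)\<bar>)"
    by (intro Bochner_Integration.integrable_sum integrable_mult_right shift_int)
  have "(\<integral>v. (\<Sum>j=1..n. real (n choose j) * \<bar>G (u + real j * b * v)\<bar>) \<partial>lborel)
      = (\<Sum>j=1..n. real (n choose j) * (\<integral>v. \<bar>G (u + real j * b * v)\<bar> \<partial>lborel))"
    using shift_int by (subst Bochner_Integration.integral_sum) auto
  also have "\<dots> \<le> (\<Sum>j=1..n. real (n choose j) * (?L / b))"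
    by (intro sum_mono mult_left_mono shift_le) auto
  also have "\<dots> \<le> 2 ^ n * (?L / b)"
    unfolding sum_distrib_right[symmetric] using b
    by (intro mult_right_mono sum_choose_atLeast_one_le) simp
  finally show "(\<integral>v. (\<Sum>j=1..n. real (n choose j) * \<bar>G (u + real j * b * v)\<bar>) \<partial>lborel)
      \<le> 2 ^ n * (?L / b)" .
qed

lemma abs_integral_gauss_fdiff_le:
  assumes G: "integrable lborel G" and b: "b > 0" and \<delta>: "\<delta> > 0" and B: "B \<ge> 0"
    and near: "\<And>v. \<bar>v\<bar> \<le> \<delta> \<Longrightarrow> \<bar>fdiff n G (b * v) u\<bar> \<le> B * \<bar>v\<bar> ^ n"
  shows "\<bar>\<integral>v. std_normal_density v * fdiff n G (b * v) u \<partial>lborel\<bar>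
    \<le> (B + \<bar>G u\<bar> / \<delta> ^ n) * gauss_moment n + fact n / \<delta> ^ n * (2 ^ n * ((\<integral>x. \<bar>G x\<bar> \<partial>lborel) / b))"
proof -
  let ?S = "\<lambda>v. \<Sum>j=1..n. real (n choose j) * \<bar>G (u + real j * b * v)\<bar>"
  have "\<bar>\<integral>v. std_normal_density v * fdiff n G (b * v) u \<partial>lborel\<bar>
      \<le> (\<integral>v. \<bar>std_normal_density v * fdiff n G (b * v) u\<bar> \<partial>lborel)"
    by (rule integral_abs_bound)
  also have "\<dots>
      \<le> (\<integral>v. (B + \<bar>G u\<bar> / \<delta> ^ n) * (std_normal_density v * \<bar>v\<bar> ^ n) + fact n / \<delta> ^ n * ?S v \<partial>lborel)"
    using b
    by (intro integral_mono integrable_abs integrable_gauss_fdiff G abs_gauss_fdiff_le \<delta> B near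
        Bochner_Integration.integrable_add integrable_mult_right integrable_std_normal_moment_abs
        integrable_sum_choose_shifts) auto
  also have "\<dots> = (B + \<bar>G u\<bar> / \<delta> ^ n) * gauss_moment n + fact n / \<delta> ^ n * (\<integral>v. ?S v \<partial>lborel)"
    using integrable_sum_choose_shifts[OF G b, of n u] integrable_std_normal_moment_abs[of n]
    by (subst Bochner_Integration.integral_add) (auto simp: gauss_moment_def)
  also have "\<dots>
      \<le> (B + \<bar>G u\<bar> / \<delta> ^ n) * gauss_moment n + fact n / \<delta> ^ n * (2 ^ n * ((\<integral>x. \<bar>G x\<bar> \<partial>lborel) / b))"
    using \<delta> by (intro add_left_mono mult_left_mono integral_sum_choose_shifts_le G b) auto
  finally show ?thesis .
qed

lemma abs_integral_gauss_fdiff_le_of_holomorphic_bound: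
  assumes G: "integrable lborel G" "holomorphic_bound_at G u \<rho> M" and "\<rho> > 0" "b > 0" "n > 0"
  shows "\<bar>\<integral>v. std_normal_density v * fdiff n G (b * v) u \<partial>lborel\<bar>
    \<le> (4 * real n * b / \<rho>) ^ n
       * ((fact n + 1) * M * gauss_moment n + 2 ^ n * fact n * (\<integral>x. \<bar>G x\<bar> \<partial>lborel) / b)"
proof -
  define q where "q = 4 * real n * b / \<rho>"
  have q: "q > 0" using assms by (simp add: q_def)
  have Gu: "\<bar>G u\<bar> \<le> M" by (rule holomorphic_bound_at_imp_abs_le[OF G(2) assms(3)])
  have "\<bar>\<integral>v. std_normal_density v * fdiff n G (b * v) u \<partial>lborel\<bar>
    \<le> (fact n * M * q ^ n + \<bar>G u\<bar> / (1 / q) ^ n) * gauss_moment n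
      + fact n / (1 / q) ^ n * (2 ^ n * ((\<integral>x. \<bar>G x\<bar> \<partial>lborel) / b))"
  proof (rule abs_integral_gauss_fdiff_le[OF G(1) assms(4)])
    show "fact n * M * q ^ n \<ge> 0" using q Gu by (auto intro!: mult_nonneg_nonneg)
    fix v :: real assume v: "\<bar>v\<bar> \<le> 1 / q"
    have "real n * \<bar>b * v\<bar> \<le> real n * b * (1 / q)"
      using v assms(4) mult_left_mono[OF v, of "real n * b"] by (simp add: abs_mult mult.assoc)
    also have "\<dots> < \<rho> / 2" using assms by (simp add: q_def)
    finally have "\<bar>fdiff n G (b * v) u\<bar> \<le> fact n * M * (4 * \<bar>b * v\<bar> / \<rho>) ^ n"
      by (rule abs_fdiff_le[OF G(2) assms(3)])
    also have "\<dots> \<le> fact n * M * (q * \<bar>v\<bar>) ^ n"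
    proof (intro mult_left_mono power_mono)
      have "4 * b * \<bar>v\<bar> / \<rho> * 1 \<le> 4 * b * \<bar>v\<bar> / \<rho> * real n" using assms by (intro mult_left_mono) auto
      thus "4 * \<bar>b * v\<bar> / \<rho> \<le> q * \<bar>v\<bar>" using assms(4) by (simp add: q_def abs_mult mult_ac)
    qed (use Gu assms in auto)
    finally show "\<bar>fdiff n G (b * v) u\<bar> \<le> fact n * M * q ^ n * \<bar>v\<bar> ^ n"
      by (simp add: power_mult_distrib mult.assoc)
  qed (use q in auto)
  also have "\<dots> \<le> (fact n * M * q ^ n + M / (1 / q) ^ n) * gauss_moment n
      + fact n / (1 / q) ^ n * (2 ^ n * ((\<integral>x. \<bar>G x\<bar> \<partial>lborel) / b))"
    using Gu q gauss_moment_nonneg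
    by (intro add_right_mono add_left_mono mult_right_mono divide_right_mono) auto
  finally show ?thesis unfolding q_def[symmetric] by (simp add: power_divide algebra_simps)
qed

lemma square_le_gauss_conv:
  assumes "integrable lborel G" "b \<noteq> 0"
  shows "(G u)\<^sup>2 \<le> 2 * (\<integral>v. std_normal_density v * fdiff n G (b * v) u \<partial>lborel)\<^sup>2
    + 2 * 4 ^ n * (\<Sum>j=1..n. (gauss_conv (real j * b) G u)\<^sup>2)"
proof -
  define c where "c j = (-1) ^ j * real (n choose j)" for j
  define D where "D = (\<integral>v. std_normal_density v * fdiff n G (b * v) u \<partial>lborel)"
  define S where "S = (\<Sum>j=1..n. c j * gauss_conv (real j * b) G u)"
  have "(G u)\<^sup>2 = (D - S)\<^sup>2"
    unfolding D_def S_def c_def integral_gauss_fdiff[OF assms] by simp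
  also have "\<dots> \<le> 2 * D\<^sup>2 + 2 * S\<^sup>2"
    using sum_squares_bound[of D "- S"] by (simp add: power2_diff)
  also have "S\<^sup>2 \<le> (\<Sum>j=1..n. (c j)\<^sup>2) * (\<Sum>j=1..n. (gauss_conv (real j * b) G u)\<^sup>2)"
    unfolding S_def by (rule Cauchy_Schwarz_ineq_sum)
  also have "\<dots> \<le> 4 ^ n * (\<Sum>j=1..n. (gauss_conv (real j * b) G u)\<^sup>2)"
  proof (intro mult_right_mono sum_nonneg)
    have "(\<Sum>j=1..n. (c j)\<^sup>2) \<le> (\<Sum>j\<le>n. (real (n choose j))\<^sup>2)"
      unfolding c_def power_mult_distrib by (simp flip: power_mult) (intro sum_mono2, auto)
    also have "\<dots> = real (2 * n choose n)"
      by (simp add: choose_square_sum flip: of_nat_power of_nat_sum)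
    also have "\<dots> \<le> 4 ^ n"
      using binomial_le_pow2[of "2 * n" n] by (simp add: power_mult flip: of_nat_le_iff)
    finally show "(\<Sum>j=1..n. (c j)\<^sup>2) \<le> 4 ^ n" .
  qed auto
  finally show ?thesis by (simp add: D_def)
qed

lemma L2_le_fourier_truncation:
  assumes G: "integrable lborel G" and near: "\<And>u. u \<in> {a..c} \<Longrightarrow> holomorphic_bound_at G u \<rho> M"
    and "\<rho> > 0" "b > 0" "n > 0" and X: "X > 0" and ac: "a \<le> c"
  defines "L \<equiv> (\<integral>x. \<bar>G x\<bar> \<partial>lborel)"
  defines "R \<equiv> (4 * real n * b / \<rho>) ^ n * ((fact n + 1) * M * gauss_moment n + 2 ^ n * fact n * L / b)"
  shows "(LBINT u:{a..c}. (G u)\<^sup>2) \<le> 2 * R\<^sup>2 * (c - a)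
    + 2 * 4 ^ n * real n * ((LBINT t:{-X..X}. (norm (fourier G t))\<^sup>2) + L\<^sup>2 * fact n / (b * (b * X) ^ n))"
proof -
  define Q where "Q = (LBINT t:{-X..X}. (norm (fourier G t))\<^sup>2) + L\<^sup>2 * fact n / (b * (b * X) ^ n)"
  have conv_int: "integrable lborel (\<lambda>u. (gauss_conv (real j * b) G u)\<^sup>2)" if "j \<in> {1..n}" for j
    using that assms(4) by (intro gauss_conv_L2_le(1)[OF G _ X]) auto
  have conv_le: "(\<integral>u. (gauss_conv (real j * b) G u)\<^sup>2 \<partial>lborel) \<le> Q" if "j \<in> {1..n}" for j
    unfolding Q_def L_def using that assms(4) by (intro gauss_conv_L2_le_of_width_ge G X) auto
  define Z where
    "Z u = indicator {a..c} u * (2 * R\<^sup>2) + 2 * 4 ^ n * (\<Sum>j=1..n. (gauss_conv (real j * b) G u)\<^sup>2)" for u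
  have ind_int: "integrable lborel (\<lambda>u. indicator {a..c} u * (2 * R\<^sup>2))"
    by (intro integrable_mult_left) (auto simp: integrable_indicator_iff emeasure_lborel_Icc_eq)
  have sum_int: "integrable lborel (\<lambda>u. 2 * 4 ^ n * (\<Sum>j=1..n. (gauss_conv (real j * b) G u)\<^sup>2))"
    by (intro integrable_mult_right Bochner_Integration.integrable_sum conv_int)
  have "(LBINT u:{a..c}. (G u)\<^sup>2) \<le> (\<integral>u. Z u \<partial>lborel)"
    unfolding set_lebesgue_integral_def
  proof (rule integral_mono')
    show "integrable lborel Z"
      unfolding Z_def by (intro Bochner_Integration.integrable_add ind_int sum_int)
    show "0 \<le> Z u" for u unfolding Z_def by (intro add_nonneg_nonneg mult_nonneg_nonneg sum_nonneg) auto
    show "indicator {a..c} u *\<^sub>R (G u)\<^sup>2 \<le> Z u" for u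
    proof (cases "u \<in> {a..c}")
      case True
      have "\<bar>\<integral>v. std_normal_density v * fdiff n G (b * v) u \<partial>lborel\<bar> \<le> R"
        unfolding R_def L_def
        by (rule abs_integral_gauss_fdiff_le_of_holomorphic_bound[OF G near[OF True] assms(3-5)])
      hence "(\<integral>v. std_normal_density v * fdiff n G (b * v) u \<partial>lborel)\<^sup>2 \<le> R\<^sup>2"
        by (rule abs_le_square_iff[THEN iffD1, OF order.trans[OF _ abs_ge_self]])
      thus ?thesis
        using square_le_gauss_conv[OF G, of b u n] assms(4) True by (simp add: Z_def)
    qed (use \<open>0 \<le> Z u\<close> in simp)
  qed
  also have "\<dots> = 2 * R\<^sup>2 * (c - a) + 2 * 4 ^ n * (\<Sum>j=1..n. \<integral>u. (gauss_conv (real j * b) G u)\<^sup>2 \<partial>lborel)"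
    unfolding Z_def using ac conv_int
    by (subst Bochner_Integration.integral_add[OF ind_int sum_int])
       (simp add: Bochner_Integration.integral_sum mult_ac)
  also have "\<dots> \<le> 2 * R\<^sup>2 * (c - a) + 2 * 4 ^ n * (\<Sum>j=1..n. Q)"
    by (intro add_left_mono mult_left_mono sum_mono conv_le) auto
  finally show ?thesis by (simp add: Q_def mult_ac)
qed

definition truncation_const :: "(real \<Rightarrow> real) \<Rightarrow> real \<Rightarrow> real \<Rightarrow> nat \<Rightarrow> real" where
  "truncation_const G C r n =
     2 * ((4 * real n / r) ^ n
       * ((fact n + 1) * C * gauss_moment n + 2 ^ n * fact n * (\<integral>x. \<bar>G x\<bar> \<partial>lborel)))\<^sup>2
     + 2 * 4 ^ n * real n * (1 + (\<integral>x. \<bar>G x\<bar> \<partial>lborel)\<^sup>2 * fact n)"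

lemma gauss_remainder_bound_le:
  assumes pos: "r > 0" "T > 0" "b > 0" "C \<ge> 0" "L \<ge> 0"
    and small: "M * (b * T) ^ n \<le> 1" "(b * T) ^ n \<le> b"
  shows "(4 * real n * b / (r / T)) ^ n * ((fact n + 1) * (C * M) * gauss_moment n + 2 ^ n * fact n * L / b)
    \<le> (4 * real n / r) ^ n * ((fact n + 1) * C * gauss_moment n + 2 ^ n * fact n * L)"
proof -
  have "(b * T) ^ n / b \<le> 1" using small(2) pos by simp
  have "(4 * real n * b / (r / T)) ^ n * ((fact n + 1) * (C * M) * gauss_moment n + 2 ^ n * fact n * L / b)
    = (4 * real n / r) ^ n
      * ((fact n + 1) * C * gauss_moment n * (M * (b * T) ^ n) + 2 ^ n * fact n * L * ((b * T) ^ n / b))"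
    by (simp add: power_mult_distrib power_divide distrib_left add_divide_distrib mult_ac)
  also have "\<dots>
      \<le> (4 * real n / r) ^ n * ((fact n + 1) * C * gauss_moment n * 1 + 2 ^ n * fact n * L * 1)"
    using pos gauss_moment_nonneg[of n]
    by (intro mult_left_mono add_mono small(1) \<open>(b * T) ^ n / b \<le> 1\<close>) auto
  finally show ?thesis by simp
qed

lemma L2_le_truncation_const:
  assumes G: "integrable lborel G" and near: "\<And>u. u \<in> {a..c} \<Longrightarrow> holomorphic_bound_at G u (r / T) (C * M)"
    and pos: "r > 0" "T > 0" "b > 0" "n > 0" "C \<ge> 0" "M \<ge> 0" and ac: "a \<le> c" "c \<le> a + 1"
    and small: "M * (b * T) ^ n \<le> 1" "(b * T) ^ n \<le> b"
    and X: "X = 1 / (b\<^sup>2 * T)"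
  shows "(LBINT u:{a..c}. (G u)\<^sup>2)
      \<le> truncation_const G C r n * (1 + (LBINT t:{-X..X}. (norm (fourier G t))\<^sup>2))"
proof -
  define L where "L = (\<integral>x. \<bar>G x\<bar> \<partial>lborel)"
  define I where "I = (LBINT t:{-X..X}. (norm (fourier G t))\<^sup>2)"
  define R where "R = (4 * real n * b / (r / T)) ^ n
    * ((fact n + 1) * (C * M) * gauss_moment n + 2 ^ n * fact n * L / b)"
  define A where "A = (4 * real n / r) ^ n * ((fact n + 1) * C * gauss_moment n + 2 ^ n * fact n * L)"
  have "L \<ge> 0" by (simp add: L_def)
  hence "0 \<le> R"
    unfolding R_def using pos gauss_moment_nonneg[of n]
    by (intro mult_nonneg_nonneg add_nonneg_nonneg) auto
  moreover have "R \<le> A"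
    unfolding R_def A_def using pos \<open>L \<ge> 0\<close> by (intro gauss_remainder_bound_le small)
  ultimately have "2 * R\<^sup>2 * (c - a) \<le> 2 * A\<^sup>2 * 1"
    using ac by (intro mult_mono power_mono) auto
  have "L\<^sup>2 * fact n / (b * (b * X) ^ n) = L\<^sup>2 * fact n * ((b * T) ^ n / b)"
    using pos by (simp add: X power2_eq_square power_divide power_mult_distrib)
  also have "\<dots> \<le> L\<^sup>2 * fact n * 1" using small(2) pos by (intro mult_left_mono) auto
  finally have tail: "L\<^sup>2 * fact n / (b * (b * X) ^ n) \<le> L\<^sup>2 * fact n" by simp
  have "(LBINT u:{a..c}. (G u)\<^sup>2) \<le> 2 * R\<^sup>2 * (c - a)
      + 2 * 4 ^ n * real n * (I + L\<^sup>2 * fact n / (b * (b * X) ^ n))"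
    unfolding R_def I_def L_def
    by (rule L2_le_fourier_truncation[OF G near]) (use pos ac in \<open>auto simp: X\<close>)
  also have "\<dots> \<le> 2 * A\<^sup>2 * 1 + 2 * 4 ^ n * real n * (I + L\<^sup>2 * fact n)"
    by (intro add_mono mult_left_mono tail \<open>2 * R\<^sup>2 * (c - a) \<le> 2 * A\<^sup>2 * 1\<close>) auto
  also have "\<dots> \<le> truncation_const G C r n * (1 + I)"
  proof -
    have "I \<ge> 0" by (simp add: I_def set_lebesgue_integral_def)
    hence "x + w * (I + y) \<le> (x + w * (1 + y)) * (1 + I)" if "x \<ge> 0" "w \<ge> 0" "y \<ge> 0" for x w y
      using that mult_nonneg_nonneg[of x I] mult_nonneg_nonneg[of "w * y" I]
      by (simp add: algebra_simps)
    thus ?thesis by (simp add: truncation_const_def A_def L_def)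
  qed
  finally show ?thesis unfolding I_def .
qed

text \<open>With \<open>b = T powr (- (1 + \<epsilon> / 2))\<close> and \<open>X = T powr (1 + \<epsilon>)\<close> both \<open>b * T\<close> and \<open>1 / (b * X)\<close>
  equal \<open>T powr (- \<epsilon> / 2)\<close>, so a difference of large order \<open>n\<close> absorbs any power of \<open>T\<close>.\<close>

lemma dyadic_L2_le_fourier_truncation:
  assumes G: "integrable lborel G" and \<epsilon>: "\<epsilon> > 0" and r: "r > 0" and C: "C \<ge> 0"
    and near: "\<And>T u. T \<ge> 2 \<Longrightarrow> u \<in> {ln T..ln (2 * T)} \<Longrightarrow> holomorphic_bound_at G u (r / T) (C * T ^ k)"
  obtains D where "D \<ge> 0" and "\<And>T. T \<ge> 2 \<Longrightarrow> (LBINT u:{ln T..ln (2 * T)}. (G u)\<^sup>2)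
    \<le> D * (1 + (LBINT t:{- (T powr (1 + \<epsilon>))..T powr (1 + \<epsilon>)}. (norm (fourier G t))\<^sup>2))"
proof -
  define n where "n = nat \<lceil>(2 * real k + 2 + \<epsilon>) / \<epsilon>\<rceil> + 1"
  have "(2 * real k + 2 + \<epsilon>) / \<epsilon> \<le> real n" unfolding n_def by linarith
  hence order_large: "real k \<le> \<epsilon> / 2 * real n" "1 + \<epsilon> / 2 \<le> \<epsilon> / 2 * real n"
    using \<epsilon> by (simp_all add: field_simps)
  have "(LBINT u:{ln T..ln (2 * T)}. (G u)\<^sup>2) \<le> truncation_const G C r n
      * (1 + (LBINT t:{- (T powr (1 + \<epsilon>))..T powr (1 + \<epsilon>)}. (norm (fourier G t))\<^sup>2))" if T: "T \<ge> 2" for T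
  proof -
    define b where "b = T powr (- (1 + \<epsilon> / 2))"
    have "b * T = T powr (- (1 + \<epsilon> / 2) + 1)" unfolding b_def powr_add using T by simp
    hence bT: "(b * T) ^ n = T powr (- (\<epsilon> / 2 * real n))"
      using T by (simp add: powr_power mult.commute)
    show ?thesis
    proof (rule L2_le_truncation_const[OF G near[OF T]])
      have "T ^ k * (b * T) ^ n = T powr (real k - \<epsilon> / 2 * real n)"
        using T unfolding bT by (simp add: powr_realpow[symmetric] flip: powr_add)
      also have "\<dots> \<le> T powr 0" using order_large(1) T by (intro powr_mono) auto
      finally show "T ^ k * (b * T) ^ n \<le> 1" using T by simp
      show "(b * T) ^ n \<le> b"
        unfolding bT unfolding b_def using order_large(2) T by (intro powr_mono) auto
      have "b\<^sup>2 * T = T powr (- (1 + \<epsilon> / 2) + (- (1 + \<epsilon> / 2)) + 1)"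
        unfolding b_def powr_add power2_eq_square using T by simp
      hence "b\<^sup>2 * T = T powr (- (1 + \<epsilon>))" by simp
      thus "T powr (1 + \<epsilon>) = 1 / (b\<^sup>2 * T)" unfolding powr_minus_divide by simp
    qed (use T r C ln_2_less_1 in \<open>auto simp: b_def n_def ln_mult\<close>)
  qed
  moreover have "truncation_const G C r n \<ge> 0" by (simp add: truncation_const_def)
  ultimately show ?thesis by (rule that[rotated])
qed

section \<open>The fourth moment of the error term\<close>

lemma exp_mem_Icc:
  fixes u :: real
  assumes "0 < a" "a \<le> b" "u \<in> {ln a..ln b}"
  shows "exp u \<in> {a..b}"
proof -
  have "exp (ln a) \<le> exp u" "exp u \<le> exp (ln b)"
    using assms(3) by (simp_all del: exp_ln exp_ln_iff)
  thus ?thesis using assms(1,2) by simp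
qed

lemma exp_mem_half_strip:
  assumes T: "T \<ge> 2" and u: "u \<in> {ln T..ln (2 * T)}" and w: "w \<in> ball (of_real u) (1 / 16 / T)"
  shows "exp w \<in> half_strip" and "norm (exp w) \<le> 3 * T" and "Re w > 0"
proof -
  have exp_u: "T \<le> exp u" "exp u \<le> 2 * T" using exp_mem_Icc[OF _ _ u] T by auto
  have dist: "norm (w - of_real u) < 1 / (16 * T)" using w by (simp add: dist_norm norm_minus_commute)
  also have "\<dots> \<le> 1/2" using T by (simp add: field_simps)
  finally have half: "norm (w - of_real u) \<le> 1/2" by simp
  have "exp w - of_real (exp u) = of_real (exp u) * (exp (w - of_real u) - 1)"
    by (simp add: exp_diff exp_of_real[symmetric] algebra_simps)
  hence "norm (exp w - of_real (exp u)) = exp u * norm (exp (w - of_real u) - 1)"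
    by (simp add: norm_mult)
  also have "\<dots> \<le> (2 * T) * (3 / 2 * (1 / (16 * T)))"
    using norm_exp_bounds(2)[OF half] dist exp_u T by (intro mult_mono) auto
  also have "\<dots> < 1/4" using T by simp
  finally have close: "norm (exp w - of_real (exp u)) < 1/4" .
  show "exp w \<in> half_strip"
    using abs_Re_le_cmod[of "exp w - of_real (exp u)"] abs_Im_le_cmod[of "exp w - of_real (exp u)"]
      close exp_u T
    by (simp add: half_strip_def del: Re_exp Im_exp)
  show "norm (exp w) \<le> 3 * T"
    using norm_triangle_ineq2[of "exp w" "of_real (exp u)"] close exp_u T by (simp del: norm_exp_eq_Re)
  have "1/2 < ln T" using T ln2_ge_two_thirds ln_mono[of 2 T] by linarith
  thus "Re w > 0" using u abs_Re_le_cmod[of "w - of_real u"] half by auto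
qed

lemma holomorphic_bound_at_damped_log_square:
  assumes F: "F holomorphic_on half_strip" and C: "C \<ge> 0"
    and bound: "\<And>z. z \<in> half_strip \<Longrightarrow> norm (F z) \<le> C * (1 + norm z) ^ n"
    and ext: "\<And>x. x > 1/2 \<Longrightarrow> F (of_real x) = of_real (E x)"
    and \<sigma>: "\<sigma> \<ge> 0" and T: "T \<ge> 2" and u: "u \<in> {ln T..ln (2 * T)}"
  shows "holomorphic_bound_at (damped \<sigma> (log_square E)) u (1 / 16 / T) ((C * 4 ^ n)\<^sup>2 * T ^ (2 * n))"
  unfolding holomorphic_bound_at_def
proof (intro exI conjI ballI)
  let ?B = "ball (complex_of_real u) (1 / 16 / T)"
  let ?f = "\<lambda>w. (F (exp w))\<^sup>2 * exp (- (of_real \<sigma> * w))"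
  note near = exp_mem_half_strip[OF T u]
  have "(F \<circ> exp) holomorphic_on ?B"
    by (rule holomorphic_on_compose_gen[OF holomorphic_on_exp F]) (use near(1) in blast)
  thus "?f holomorphic_on ?B" unfolding o_def by (intro holomorphic_intros)
  show "norm (?f w) \<le> (C * 4 ^ n)\<^sup>2 * T ^ (2 * n)" if w: "w \<in> ?B" for w
  proof -
    have "norm (F (exp w)) \<le> C * (1 + norm (exp w)) ^ n" by (intro bound near w)
    also have "\<dots> \<le> C * (4 * T) ^ n"
      using near(2)[OF w] T C by (intro mult_left_mono power_mono) auto
    finally have "norm (F (exp w)) \<le> C * (4 * T) ^ n" .
    hence "norm (?f w) \<le> (C * (4 * T) ^ n)\<^sup>2 * 1"
      unfolding norm_mult norm_power using \<sigma> near(3)[OF w] by (intro mult_mono power_mono) auto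
    thus ?thesis by (simp add: power_mult_distrib power_even_eq)
  qed
  show "?f (of_real x) = of_real (damped \<sigma> (log_square E) x)" if x: "x \<in> ball u (1 / 16 / T)" for x
  proof -
    have "x > 0" using near(3)[of "of_real x"] x by (simp add: dist_norm flip: of_real_diff)
    hence "1 < exp x" by simp
    hence "F (of_real (exp x)) = of_real (E (exp x))" by (intro ext) linarith
    thus ?thesis using \<open>x > 0\<close> by (simp add: damped_def log_square_def flip: exp_of_real)
  qed
qed

lemma holomorphic_bound_at_E2:
  assumes "\<sigma> \<ge> 0"
  obtains C n where "C \<ge> 0" and "\<And>T u. T \<ge> 2 \<Longrightarrow> u \<in> {ln T..ln (2 * T)} \<Longrightarrow>
    holomorphic_bound_at (damped \<sigma> (log_square (E2 P))) u (1 / 16 / T) (C * T ^ n)"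
proof -
  obtain F where F: "F holomorphic_on half_strip" "F poly_bounded_on half_strip"
      "\<And>x. x > 1/2 \<Longrightarrow> F (of_real x) = of_real (E2 P x)"
    by (rule E2_holomorphic_extension[of P]) blast
  obtain C n where C: "C \<ge> 0" "\<And>z. z \<in> half_strip \<Longrightarrow> norm (F z) \<le> C * (1 + norm z) ^ n"
    using F(2) by (rule poly_bounded_onE) blast
  show ?thesis
  proof (rule that)
    show "(C * 4 ^ n)\<^sup>2 \<ge> 0" by simp
    show "holomorphic_bound_at (damped \<sigma> (log_square (E2 P))) u (1 / 16 / T)
        ((C * 4 ^ n)\<^sup>2 * T ^ (2 * n))"
      if "T \<ge> 2" "u \<in> {ln T..ln (2 * T)}" for T u
      by (rule holomorphic_bound_at_damped_log_square[OF F(1) C F(3) assms that])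
  qed
qed

lemma exp_mult_fourth_power_eq:
  assumes "u > 0"
  shows "exp u * E (exp u) ^ 4 = exp ((2 * \<sigma> + 1) * u) * (damped \<sigma> (log_square E) u)\<^sup>2"
proof -
  have "(damped \<sigma> (log_square E) u)\<^sup>2 = E (exp u) ^ 4 * (exp (- (\<sigma> * u)))\<^sup>2"
    using assms by (simp add: damped_def log_square_def power_mult_distrib flip: power_mult)
  moreover have "exp ((2 * \<sigma> + 1) * u) * (exp (- (\<sigma> * u)))\<^sup>2 = exp u"
    by (simp add: algebra_simps flip: exp_double exp_add)
  ultimately show ?thesis by (simp add: mult_ac)
qed

lemma has_integral_exp_substitution:
  fixes f :: "real \<Rightarrow> real"
  assumes "0 < a" "a \<le> b" and "continuous_on {a..b} f"
  shows "((\<lambda>u. exp u * f (exp u)) has_integral integral {a..b} f) {ln a..ln b}"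
proof -
  have "((\<lambda>u. exp u *\<^sub>R f (exp u)) has_integral integral {exp (ln a)..exp (ln b)} f) {ln a..ln b}"
  proof (rule has_integral_substitution[where c = a and d = b])
    show "exp ` {ln a..ln b} \<subseteq> {a..b}"
      using assms(1,2) by (intro image_subsetI exp_mem_Icc)
  qed (use assms in \<open>auto intro!: derivative_eq_intros\<close>)
  thus ?thesis using assms by simp
qed

lemma integral_fourth_power_le:
  fixes E :: "real \<Rightarrow> real"
  assumes E: "continuous_on {0<..} E" and T: "T > 1" and \<sigma>: "\<sigma> \<ge> 0"
  shows "integral {T..2*T} (\<lambda>t. E t ^ 4)
    \<le> (2 * T) powr (2 * \<sigma> + 1) * (LBINT u:{ln T..ln (2 * T)}. (damped \<sigma> (log_square E) u)\<^sup>2)"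
proof -
  let ?w = "\<lambda>u. (damped \<sigma> (log_square E) u)\<^sup>2" and ?I = "{ln T..ln (2 * T)}"
  have u_pos: "u > 0" if "u \<in> ?I" for u using that by (intro less_le_trans[OF ln_gt_zero[OF T]]) simp
  have "continuous_on ?I (\<lambda>u. ((E (exp u))\<^sup>2 * exp (- (\<sigma> * u)))\<^sup>2)"
    by (intro continuous_intros continuous_on_compose_exp E)
  hence "continuous_on ?I ?w"
  proof (rule continuous_on_eq)
    show "((E (exp u))\<^sup>2 * exp (- (\<sigma> * u)))\<^sup>2 = ?w u" if "u \<in> ?I" for u
      using u_pos[OF that] by (simp add: damped_def log_square_def)
  qed
  hence int: "set_integrable lborel ?I ?w" by (rule borel_integrable_atLeastAtMost')
  have "integral {T..2*T} (\<lambda>t. E t ^ 4) \<le> integral ?I (\<lambda>u. (2 * T) powr (2 * \<sigma> + 1) * ?w u)"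
  proof (rule has_integral_le)
    show "((\<lambda>u. exp u * E (exp u) ^ 4) has_integral integral {T..2*T} (\<lambda>t. E t ^ 4)) ?I"
      using T by (intro has_integral_exp_substitution continuous_intros continuous_on_subset[OF E]) auto
    show "((\<lambda>u. (2 * T) powr (2 * \<sigma> + 1) * ?w u)
        has_integral integral ?I (\<lambda>u. (2 * T) powr (2 * \<sigma> + 1) * ?w u)) ?I"
      by (intro integrable_integral integrable_on_mult_right set_borel_integral_eq_integral(1)[OF int])
    fix u assume u: "u \<in> ?I"
    have "exp ((2 * \<sigma> + 1) * u) \<le> (2 * T) powr (2 * \<sigma> + 1)"
      using u T \<sigma> by (auto simp: powr_def intro!: mult_left_mono)
    thus "exp u * E (exp u) ^ 4 \<le> (2 * T) powr (2 * \<sigma> + 1) * ?w u"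
      unfolding exp_mult_fourth_power_eq[OF u_pos[OF u], of E \<sigma>] by (intro mult_right_mono) auto
  qed
  thus ?thesis using set_borel_integral_eq_integral(2)[OF int] by simp
qed

lemma set_integral_even:
  fixes f :: "real \<Rightarrow> real"
  assumes "X \<ge> 0" "set_integrable lborel {-X..X} f" "\<And>t. f (- t) = f t"
  shows "(LBINT t:{-X..X}. f t) = 2 * (LBINT t:{0..X}. f t)"
proof -
  have int: "interval_lebesgue_integrable lborel (ereal a) (ereal b) f"
      if "- X \<le> a" "a \<le> b" "b \<le> X" for a b
  proof -
    have "{a<..<b} \<subseteq> {-X..X}" using that by auto
    from set_integrable_subset[OF assms(2) _ this] that show ?thesis
      by (simp add: interval_lebesgue_integrable_def)
  qed
  have "(LBINT t=-X..0. f t) + (LBINT t=0..X. f t) = (LBINT t=-X..X. f t)"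
    using assms(1) int[of "- X" X]
    by (intro interval_integral_sum) (simp add: min_def max_def zero_ereal_def)
  moreover have "(LBINT t=-X..0. f t) = (LBINT t=0..X. f t)"
    by (subst interval_integral_reflect) (simp add: assms(3) zero_ereal_def)
  ultimately show ?thesis
    using assms(1) by (simp add: interval_integral_Icc zero_ereal_def)
qed

lemma norm_square_divide_Complex_le:
  fixes z :: complex
  assumes "\<sigma> \<ge> 1"
  shows "(norm ((2 * z + of_real a) / Complex \<sigma> t))\<^sup>2
      \<le> 8 * ((norm z)\<^sup>2 / (1 + t\<^sup>2)) + 2 * a\<^sup>2 * (1 / (1 + t\<^sup>2))"
proof -
  have denom: "0 < 1 + t\<^sup>2" "1 + t\<^sup>2 \<le> (norm (Complex \<sigma> t))\<^sup>2"
    using assms by (simp_all add: add_pos_nonneg cmod_power2 one_le_power)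
  have "(norm (2 * z + of_real a))\<^sup>2 \<le> (2 * norm z + \<bar>a\<bar>)\<^sup>2"
    using norm_triangle_ineq[of "2 * z" "of_real a"] by (intro power_mono) (auto simp: norm_mult)
  also have "\<dots> \<le> 8 * (norm z)\<^sup>2 + 2 * a\<^sup>2"
    using sum_squares_bound[of "2 * norm z" "\<bar>a\<bar>"] by (simp add: power2_sum power_mult_distrib)
  finally have num: "(norm (2 * z + of_real a))\<^sup>2 \<le> 8 * (norm z)\<^sup>2 + 2 * a\<^sup>2" .
  have "(norm ((2 * z + of_real a) / Complex \<sigma> t))\<^sup>2
      = (norm (2 * z + of_real a))\<^sup>2 / (norm (Complex \<sigma> t))\<^sup>2"
    by (simp only: norm_divide power_divide)
  also have "\<dots> \<le> (8 * (norm z)\<^sup>2 + 2 * a\<^sup>2) / (1 + t\<^sup>2)"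
    using denom by (intro frac_le num) auto
  finally show ?thesis by (simp add: add_divide_distrib)
qed

lemma has_integral_inverse_one_plus_square:
  assumes "X \<ge> 0"
  shows "((\<lambda>t. 1 / (1 + t\<^sup>2)) has_integral arctan X) {0..X}"
proof -
  have "((\<lambda>t. 1 / (1 + t\<^sup>2)) has_integral (arctan X - arctan 0)) {0..X}"
    by (rule fundamental_theorem_of_calculus[OF assms])
       (auto intro!: derivative_eq_intros simp: inverse_eq_divide
          simp flip: has_real_derivative_iff_has_vector_derivative)
  thus ?thesis by simp
qed

lemma
  assumes K: "K holomorphic_on {s. Re s > 1}" and \<sigma>: "\<sigma> > 1"
  shows norm_square_vertical_line_integrable:
      "(\<lambda>t. (norm (K (Complex \<sigma> t)))\<^sup>2 / (1 + t\<^sup>2)) integrable_on {a..b}"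
    and norm_square_vertical_line_integral_nonneg:
      "integral {a..b} (\<lambda>t. (norm (K (Complex \<sigma> t)))\<^sup>2 / (1 + t\<^sup>2)) \<ge> 0"
proof -
  have "1 + t\<^sup>2 \<noteq> 0" for t :: real using zero_le_power2[of t] by linarith
  moreover have "continuous_on {a..b} (\<lambda>t. K (Complex \<sigma> t))"
    by (rule continuous_on_compose2[OF holomorphic_on_imp_continuous_on[OF K]])
       (use \<sigma> in \<open>auto intro!: continuous_intros simp: Complex_eq\<close>)
  ultimately show integrable: "(\<lambda>t. (norm (K (Complex \<sigma> t)))\<^sup>2 / (1 + t\<^sup>2)) integrable_on {a..b}"
    by (intro integrable_continuous_real continuous_intros) auto
  show "integral {a..b} (\<lambda>t. (norm (K (Complex \<sigma> t)))\<^sup>2 / (1 + t\<^sup>2)) \<ge> 0"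
    by (rule Henstock_Kurzweil_Integration.integral_nonneg[OF integrable]) simp
qed

lemma fourier_E2_L2_le:
  assumes K: "K holomorphic_on {s. Re s > 1}" "\<And>s. Re s > 5/3 \<Longrightarrow> K s = K_integral P s"
    and \<sigma>: "\<sigma> > 1" and X: "X \<ge> 0"
  defines "J \<equiv> integral {0..X} (\<lambda>t. (norm (K (Complex \<sigma> t)))\<^sup>2 / (1 + t\<^sup>2))"
  shows "(LBINT t:{-X..X}. (norm (fourier (damped \<sigma> (log_square (E2 P))) t))\<^sup>2)
      \<le> 16 * J + 8 * E2 P 1 ^ 4"
proof -
  let ?G = "damped \<sigma> (log_square (E2 P))" and ?k = "\<lambda>t. (norm (K (Complex \<sigma> t)))\<^sup>2 / (1 + t\<^sup>2)"
  have "integrable lborel ?G" using laplace_log_square_E2(1)[OF K, of "of_real \<sigma>"] \<sigma> by simp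
  hence int: "set_integrable lborel {a..b} (\<lambda>t. (norm (fourier ?G t))\<^sup>2)" for a b
    by (rule set_integrable_norm_fourier_square)
  have "(LBINT t:{-X..X}. (norm (fourier ?G t))\<^sup>2) = 2 * (LBINT t:{0..X}. (norm (fourier ?G t))\<^sup>2)"
    by (rule set_integral_even[OF X int]) (simp add: fourier_minus)
  also have "(LBINT t:{0..X}. (norm (fourier ?G t))\<^sup>2) = integral {0..X} (\<lambda>t. (norm (fourier ?G t))\<^sup>2)"
    by (rule set_borel_integral_eq_integral(2)[OF int])
  also have "\<dots> \<le> 8 * J + 2 * ((E2 P 1)\<^sup>2)\<^sup>2 * arctan X"
  proof (rule has_integral_le)
    show "((\<lambda>t. 8 * ?k t + 2 * ((E2 P 1)\<^sup>2)\<^sup>2 * (1 / (1 + t\<^sup>2))) has_integral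
        8 * J + 2 * ((E2 P 1)\<^sup>2)\<^sup>2 * arctan X) {0..X}"
      unfolding J_def
      by (intro has_integral_add has_integral_mult_right integrable_integral
          norm_square_vertical_line_integrable K(1) \<sigma> has_integral_inverse_one_plus_square X)
    show "(norm (fourier ?G t))\<^sup>2 \<le> 8 * ?k t + 2 * ((E2 P 1)\<^sup>2)\<^sup>2 * (1 / (1 + t\<^sup>2))" for t
    proof -
      have "fourier ?G t = (2 * K (Complex \<sigma> t) + of_real ((E2 P 1)\<^sup>2)) / Complex \<sigma> t"
        by (rule fourier_damped_log_square_E2[OF K \<sigma>])
      thus ?thesis using \<sigma> by (simp only:) (intro norm_square_divide_Complex_le, simp)
    qed
  qed (intro integrable_integral set_borel_integral_eq_integral(1) int)
  also have "\<dots> \<le> 8 * J + 2 * ((E2 P 1)\<^sup>2)\<^sup>2 * 2"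
    using arctan_ubound[of X] pi_less_4 by (intro add_left_mono mult_left_mono) auto
  finally show ?thesis by (simp flip: power_mult)
qed

lemma E2_fourth_moment_le:
  assumes K: "K holomorphic_on {s. Re s > 1}" "\<And>s. Re s > 5/3 \<Longrightarrow> K s = K_integral P s"
    and \<sigma>: "\<sigma> > 1" and \<epsilon>: "\<epsilon> > 0"
  defines "J \<equiv> \<lambda>T. integral {0..T powr (1 + \<epsilon>)} (\<lambda>t. (norm (K (Complex \<sigma> t)))\<^sup>2 / (1 + t\<^sup>2))"
  obtains D where "\<And>T. T \<ge> 2 \<Longrightarrow> integral {T..2*T} (\<lambda>t. E2 P t ^ 4)
      \<le> D * (T powr (2 * \<sigma> + 1) * (1 + J T))"
proof -
  let ?G = "damped \<sigma> (log_square (E2 P))"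
  let ?I = "\<lambda>X. LBINT t:{-X..X}. (norm (fourier ?G t))\<^sup>2"
  have G: "integrable lborel ?G" using laplace_log_square_E2(1)[OF K, of "of_real \<sigma>"] \<sigma> by simp
  obtain C n where C: "C \<ge> 0" "\<And>T u. T \<ge> 2 \<Longrightarrow> u \<in> {ln T..ln (2 * T)} \<Longrightarrow>
      holomorphic_bound_at ?G u (1 / 16 / T) (C * T ^ n)"
    using holomorphic_bound_at_E2[of \<sigma> P] \<sigma> by (metis less_imp_le less_trans zero_less_one)
  obtain D where D: "D \<ge> 0" "\<And>T. T \<ge> 2 \<Longrightarrow>
      (LBINT u:{ln T..ln (2 * T)}. (?G u)\<^sup>2) \<le> D * (1 + ?I (T powr (1 + \<epsilon>)))"
    by (rule dyadic_L2_le_fourier_truncation[OF G \<epsilon> _ C]) auto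
  define c where "c = 17 + 8 * E2 P 1 ^ 4"
  have "integral {T..2*T} (\<lambda>t. E2 P t ^ 4)
      \<le> 2 powr (2 * \<sigma> + 1) * D * c * (T powr (2 * \<sigma> + 1) * (1 + J T))" if T: "T \<ge> 2" for T
  proof -
    have J_nonneg: "J T \<ge> 0"
      unfolding J_def by (rule norm_square_vertical_line_integral_nonneg[OF K(1) \<sigma>])
    hence "0 \<le> E2 P 1 ^ 4 * J T" by simp
    moreover have "?I (T powr (1 + \<epsilon>)) \<le> 16 * J T + 8 * E2 P 1 ^ 4"
      unfolding J_def by (rule fourier_E2_L2_le[OF K \<sigma>]) auto
    moreover have "c * (1 + J T) = 17 + 8 * E2 P 1 ^ 4 + 17 * J T + 8 * (E2 P 1 ^ 4 * J T)"
      by (simp add: c_def algebra_simps)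
    ultimately have I_le: "1 + ?I (T powr (1 + \<epsilon>)) \<le> c * (1 + J T)" using J_nonneg by linarith
    have "integral {T..2*T} (\<lambda>t. E2 P t ^ 4)
        \<le> (2 * T) powr (2 * \<sigma> + 1) * (LBINT u:{ln T..ln (2 * T)}. (?G u)\<^sup>2)"
      using T \<sigma> by (intro integral_fourth_power_le continuous_on_E2) auto
    also have "\<dots> \<le> (2 * T) powr (2 * \<sigma> + 1) * (D * (c * (1 + J T)))"
      using D(1) I_le by (intro mult_left_mono order.trans[OF D(2)[OF T]]) auto
    also have "\<dots> = 2 powr (2 * \<sigma> + 1) * D * c * (T powr (2 * \<sigma> + 1) * (1 + J T))"
      using T by (simp add: powr_mult)
    finally show ?thesis .
  qed
  thus ?thesis by (rule that)
qed

theorem theorem3: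
  fixes P :: "real poly" and K :: "complex \<Rightarrow> complex" and \<sigma> \<epsilon> :: real
  assumes "degree P = 4" and "lead_coeff P = 1 / (2 * pi\<^sup>2)"
    and "E2 P \<in> o[at_top](\<lambda>T. T)"
    and "K holomorphic_on {s. Re s > 1}"
    and "\<And>s. Re s > 5/3 \<Longrightarrow> K s = K_integral P s"
    and "\<sigma> > 1" and "\<epsilon> > 0"
  shows "(\<lambda>T. integral {T..2*T} (\<lambda>t. E2 P t ^ 4)) \<in>
           O[at_top](\<lambda>T. T powr (2*\<sigma> + 1) *
             (1 + integral {0..T powr (1 + \<epsilon>)} (\<lambda>t. (norm (K (Complex \<sigma> t)))\<^sup>2 / (1 + t\<^sup>2))))"
proof -
  let ?J = "\<lambda>T. integral {0..T powr (1 + \<epsilon>)} (\<lambda>t. (norm (K (Complex \<sigma> t)))\<^sup>2 / (1 + t\<^sup>2))"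
  obtain D where D: "\<And>T. T \<ge> 2 \<Longrightarrow>
      integral {T..2*T} (\<lambda>t. E2 P t ^ 4) \<le> D * (T powr (2 * \<sigma> + 1) * (1 + ?J T))"
    using E2_fourth_moment_le[OF assms(4-7)] by blast
  have J_nonneg: "?J T \<ge> 0" for T
    by (rule norm_square_vertical_line_integral_nonneg[OF assms(4,6)])
  have "\<forall>\<^sub>F T in at_top. norm (integral {T..2*T} (\<lambda>t. E2 P t ^ 4))
      \<le> D * norm (T powr (2*\<sigma> + 1) * (1 + ?J T))"
    using eventually_ge_at_top[of 2]
  proof eventually_elim
    case (elim T)
    have "integral {T..2*T} (\<lambda>t. E2 P t ^ 4) \<ge> 0"
      using elim by (intro Henstock_Kurzweil_Integration.integral_nonneg integrable_continuous_real
          continuous_intros continuous_on_subset[OF continuous_on_E2]) auto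
    thus ?case using D[OF elim] J_nonneg[of T] by (simp add: abs_mult)
  qed
  thus ?thesis by (rule bigoI)
qed

end
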